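(* Let $v\colon K\to\mathbb{R}\cup\{\infty\}$ be a nontrivial valuation on a field $K$ with valuation ring $K^\circ$ and value group $\Gamma$, and assume $\Gamma$ is neither discrete (as a subgroup of $\mathbb{R}$) nor divisible. Let $r$ be a positive integer with $r\Gamma\neq\Gamma$, let $\gamma\in\Gamma\smallsetminus r\Gamma$ be positive, let $\pi\in K^\circ$ satisfy $v(\pi)=\gamma$, and let $n$ be a positive integer. Let $\mathbb{T}=\mathbb{G}_{m,K^\circ}^n$ act on $\mathbb{P}^{2n}_{K^\circ}$ through the embedding of tori $\mathbb{T}\to\mathbb{G}_{m,K^\circ}^{2n+1}/\mathbb{G}_{m,K^\circ}\subset\mathbb{P}_{K^\circ}^{2n}$ given by $$(z_1,\ldots,z_n)\mapsto(1:z_1^r:z_1^{r+1}:z_2^r:z_2^{r+1}:\cdots:z_n^r:z_n^{r+1}),$$ let $y=(\pi:1:1:\cdots:1)\in\mathbb{P}^{2n}(K)$, and let $\mathcal{Y}=\overline{\mathbb{T}\cdot y}$ be the closure in $\mathbb{P}^{2n}_{K^\circ}$ of the orbit of $y$. Then the normalization of $\mathcal{Y}$ is not of finite type over $K^\circ$.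
   Context: The torus $\mathbb{G}_{m,K^\circ}^{2n+1}/\mathbb{G}_{m,K^\circ}$ acts on $\mathbb{P}^{2n}_{K^\circ}$ by coordinatewise multiplication, so $(z_1,\dots,z_n)$ acts by $(x_0:x_1:x_2:\cdots:x_{2n-1}:x_{2n})\mapsto(x_0:z_1^rx_1:z_1^{r+1}x_2:\cdots:z_n^rx_{2n-1}:z_n^{r+1}x_{2n})$. The orbit of $y$ is the orbit under the generic fiber $\mathbb{T}_\eta=\mathbb{G}_{m,K}^n$ inside $\mathbb{P}^{2n}_K\subset\mathbb{P}^{2n}_{K^\circ}$, and its closure $\mathcal{Y}$ carries the reduced induced scheme structure. The scheme $\mathcal{Y}$ is integral and is a projective $\mathbb{T}$-toric variety over $K^\circ$; its normalization is the usual normalization of an integral scheme in its function field. *)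

theory Defs
  imports
    "HOL-Analysis.Analysis"
    "HOL-Library.Poly_Mapping"
    "HOL-Computational_Algebra.Fraction_Field"
    "HOL-Algebra.Algebra"
    "HOL-Algebra.Algebraic_Closure_Type"
begin

section \<open>Valuations\<close>

definition valuation :: "('k::field \<Rightarrow> ereal) \<Rightarrow> bool" where
  "valuation v \<longleftrightarrow>
     (\<forall>x. v x \<noteq> -\<infinity>) \<and> (\<forall>x. v x = \<infinity> \<longleftrightarrow> x = 0) \<and>
     (\<forall>x y. v (x * y) = v x + v y) \<and> (\<forall>x y. min (v x) (v y) \<le> v (x + y))"

definition nontrivial_valuation :: "('k::field \<Rightarrow> ereal) \<Rightarrow> bool" where
  "nontrivial_valuation v \<longleftrightarrow> valuation v \<and> (\<exists>x. x \<noteq> 0 \<and> v x \<noteq> 0)"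

definition val_ring :: "('k::field \<Rightarrow> ereal) \<Rightarrow> 'k set" where
  "val_ring v = {x. 0 \<le> v x}"

definition value_group :: "('k::field \<Rightarrow> ereal) \<Rightarrow> real set" where
  "value_group v = {t. \<exists>x. x \<noteq> 0 \<and> v x = ereal t}"

definition divisible :: "real set \<Rightarrow> bool" where
  "divisible \<Gamma> \<longleftrightarrow> (\<forall>k::nat. 0 < k \<longrightarrow> (\<lambda>t. real k * t) ` \<Gamma> = \<Gamma>)"


section \<open>Integral schemes\<close>

text \<open>
  On an integral scheme Y with function field F the structure sheaf is a subsheaf of the
  constant sheaf F: each local ring is a subring of F, restriction maps are inclusions, and
  the sections over a nonempty open set U are the intersection of the local rings at the
  points of U. The following record stores an integral scheme over Spec B in this form: the
  underlying space, the function field, the local rings as subsets of the function field, and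
  the structure homomorphism from B to F, which is meant to be applied to elements of
  B only (B is a subring of the type \<open>'b\<close> and is kept as a separate parameter).
\<close>

record ('p, 'f, 'b) ischeme =
  pts :: "'p topology"
  ffield :: "'f ring"
  stalk :: "'p \<Rightarrow> 'f set"
  scal :: "'b \<Rightarrow> 'f"

definition sections :: "('p, 'f, 'b) ischeme \<Rightarrow> 'p set \<Rightarrow> 'f set" where
  "sections Y U = {s \<in> carrier (ffield Y). \<forall>x\<in>U. s \<in> stalk Y x}"

abbreviation sub :: "'f ring \<Rightarrow> 'f set \<Rightarrow> 'f ring" where
  "sub F A \<equiv> F\<lparr>carrier := A\<rparr>"

text \<open>For a prime ideal p of a subring A of the field F: the localization of A at p,
  as a subring of F.\<close>

definition loc :: "'f ring \<Rightarrow> 'f set \<Rightarrow> 'f set \<Rightarrow> 'f set" where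
  "loc F A p = {a \<otimes>\<^bsub>F\<^esub> inv\<^bsub>F\<^esub> s | a s. a \<in> A \<and> s \<in> A \<and> s \<notin> p}"

definition nonunits :: "'f ring \<Rightarrow> 'f set \<Rightarrow> 'f set" where
  "nonunits F A = A - Units (sub F A)"

definition Spec :: "'f ring \<Rightarrow> 'f set set" where
  "Spec R = {p. primeideal p R}"

text \<open>The Zariski topology on a set of primes of a ring with carrier A; used for Spec and
  for Proj. (In Proj, the set of homogeneous primes not containing f is the union of the basic
  open sets of the homogeneous components of f.)\<close>

definition zariski :: "'f set \<Rightarrow> 'f set set \<Rightarrow> 'f set topology" where
  "zariski A P = topology_generated_by {{p \<in> P. f \<notin> p} | f. f \<in> A}"

text \<open>A nonempty open U is affine iff the canonical morphism from U to Spec A, where A is the ring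
  of sections over U, is an isomorphism. It sends x to the ideal of those sections that are
  not invertible in the local ring at x. The third condition says that F is the fraction
  field of A.\<close>

definition point_ideal :: "('p, 'f, 'b) ischeme \<Rightarrow> 'f set \<Rightarrow> 'p \<Rightarrow> 'f set" where
  "point_ideal Y A x = A \<inter> nonunits (ffield Y) (stalk Y x)"

definition affine_open :: "('p, 'f, 'b) ischeme \<Rightarrow> 'p set \<Rightarrow> bool" where
  "affine_open Y U \<longleftrightarrow>
     (let F = ffield Y; A = sections Y U in
       openin (pts Y) U \<and> U \<noteq> {} \<and>
       carrier F = loc F A {\<zero>\<^bsub>F\<^esub>} \<and>
       homeomorphic_map (subtopology (pts Y) U) (zariski A (Spec (sub F A))) (point_ideal Y A) \<and>
       (\<forall>x\<in>U. stalk Y x = loc F A (point_ideal Y A x)))"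

text \<open>Finite type over the affine base Spec B: a finite affine open cover whose rings of sections are
  finitely generated B-algebras.\<close>

definition finite_type :: "'b set \<Rightarrow> ('p, 'f, 'b) ischeme \<Rightarrow> bool" where
  "finite_type B Y \<longleftrightarrow>
     (\<exists>\<U>. finite \<U> \<and> \<Union>\<U> = topspace (pts Y) \<and>
        (\<forall>U\<in>\<U>. affine_open Y U \<and>
           (\<exists>G. finite G \<and> G \<subseteq> sections Y U \<and>
                sections Y U = generate_ring (ffield Y) (scal Y ` B \<union> G))))"


section \<open>Reduced induced structure on an irreducible closed subset\<close>

text \<open>Let Z be irreducible and closed with generic point e. The function field of Z with its
  reduced structure is the residue field of Y at e, and its local ring at z is the
  quotient of the local ring of Y at z by the prime ideal of Z, that is, the image of that
  local ring (which is contained in the local ring at e) in the residue field.\<close>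

definition generic_point :: "('p, 'f, 'b) ischeme \<Rightarrow> 'p set \<Rightarrow> 'p" where
  "generic_point Y Z = (THE x. x \<in> topspace (pts Y) \<and> pts Y closure_of {x} = Z)"

definition reduced_closed :: "('p, 'f, 'b) ischeme \<Rightarrow> 'p set \<Rightarrow> ('p, 'f set, 'b) ischeme" where
  "reduced_closed Y Z =
     (let L = sub (ffield Y) (stalk Y (generic_point Y Z));
          m = nonunits (ffield Y) (stalk Y (generic_point Y Z));
          res = (\<lambda>a. m +>\<^bsub>L\<^esub> a)
      in \<lparr> pts = subtopology (pts Y) Z,
           ffield = L Quot m,
           stalk = (\<lambda>z. res ` stalk Y z),
           scal = (\<lambda>c. res (scal Y c)) \<rparr>)"


section \<open>Normalization\<close>

text \<open>Elements of F that are roots of a monic polynomial with coefficients in A; polynomials are lists with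
  the leading coefficient first.\<close>

definition integral_closure_in :: "'f ring \<Rightarrow> 'f set \<Rightarrow> 'f set" where
  "integral_closure_in F A =
     {x \<in> carrier F. \<exists>p. set p \<subseteq> A \<and> ring.eval F (\<one>\<^bsub>F\<^esub> # p) x = \<zero>\<^bsub>F\<^esub>}"

text \<open>
  The normalization is obtained by gluing the spectra of the integral closures A' (in the
  function field) of the rings A = O(U), for U affine open. Since integral closure commutes with
  localization, the primes of A' over the point x of U correspond to the maximal ideals q of the
  integral closure C of the local ring at x, with the same local rings. So the points are the
  pairs (x, q), and the basic open subsets of the charts Spec A' form a base of the topology.
\<close>

definition normalization_points :: "('p, 'f, 'b) ischeme \<Rightarrow> ('p \<times> 'f set) set" where
  "normalization_points Y =
     {(x, q). x \<in> topspace (pts Y) \<and>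
        maximalideal q (sub (ffield Y) (integral_closure_in (ffield Y) (stalk Y x)))}"

definition normalization :: "('p, 'f, 'b) ischeme \<Rightarrow> ('p \<times> 'f set, 'f, 'b) ischeme" where
  "normalization Y =
     \<lparr> pts = topology_generated_by
         {{(x, q) \<in> normalization_points Y. x \<in> U \<and> f \<notin> q} | U f.
            affine_open Y U \<and> f \<in> integral_closure_in (ffield Y) (sections Y U)},
       ffield = ffield Y,
       stalk = (\<lambda>(x, q). loc (ffield Y) (integral_closure_in (ffield Y) (stalk Y x)) q),
       scal = scal Y \<rparr>"


section \<open>Projective space over a subring B of a field\<close>

type_synonym 'k mpoly = "(nat \<Rightarrow>\<^sub>0 nat) \<Rightarrow>\<^sub>0 'k"

definition mdeg :: "(nat \<Rightarrow>\<^sub>0 nat) \<Rightarrow> nat" where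
  "mdeg t = (\<Sum>i\<in>Poly_Mapping.keys t. Poly_Mapping.lookup t i)"

definition homog :: "nat \<Rightarrow> ('k::field) mpoly \<Rightarrow> bool" where
  "homog d f \<longleftrightarrow> (\<forall>t\<in>Poly_Mapping.keys f. mdeg t = d)"

definition hcomp :: "nat \<Rightarrow> ('k::field) mpoly \<Rightarrow> 'k mpoly" where
  "hcomp d f = (\<Sum>t\<in>{t \<in> Poly_Mapping.keys f. mdeg t = d}. Poly_Mapping.single t (Poly_Mapping.lookup f t))"

text \<open>The polynomial ring over B in the variables with indices 0, ..., m.\<close>

definition hcoord :: "nat \<Rightarrow> ('k::field) set \<Rightarrow> 'k mpoly set" where
  "hcoord m B = {f. (\<forall>t\<in>Poly_Mapping.keys f. Poly_Mapping.keys t \<subseteq> {..m}) \<and> (\<forall>t. Poly_Mapping.lookup f t \<in> B)}"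

definition Proj :: "nat \<Rightarrow> ('k::field) set \<Rightarrow> 'k mpoly set set" where
  "Proj m B =
     {p. primeideal p (sub ring_of_type_algebra (hcoord m B)) \<and>
         (\<forall>f\<in>p. \<forall>d. hcomp d f \<in> p) \<and>
         \<not> {f \<in> hcoord m B. hcomp 0 f = 0} \<subseteq> p}"

definition hfrac :: "nat \<Rightarrow> ('k::field) set \<Rightarrow> 'k mpoly set \<Rightarrow> 'k mpoly fract set" where
  "hfrac m B p = {Fract a s | a s d. a \<in> hcoord m B \<and> s \<in> hcoord m B \<and>
                     homog d a \<and> homog d s \<and> s \<notin> p}"

definition projective_space ::
    "nat \<Rightarrow> ('k::field) set \<Rightarrow> ('k mpoly set, 'k mpoly fract, 'k) ischeme" where
  "projective_space m B =
     \<lparr> pts = zariski (hcoord m B) (Proj m B),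
       ffield = sub ring_of_type_algebra (hfrac m B {0}),
       stalk = (\<lambda>p. hfrac m B p),
       scal = (\<lambda>c. Fract (Poly_Mapping.single 0 c) 1) \<rparr>"


section \<open>Torus orbits in projective space\<close>

type_synonym 'k lpoly = "(nat \<Rightarrow>\<^sub>0 int) \<Rightarrow>\<^sub>0 'k"

text \<open>The ring of Laurent polynomials in the variables with indices 1, ..., n, whose spectrum is the
  torus of dimension n over the field K.\<close>

definition laurent :: "nat \<Rightarrow> ('k::field) lpoly set" where
  "laurent n = {f. \<forall>t\<in>Poly_Mapping.keys f. Poly_Mapping.keys t \<subseteq> {1..n}}"

definition zvar :: "nat \<Rightarrow> ('k::field) lpoly" where
  "zvar i = Poly_Mapping.single (Poly_Mapping.single i 1) 1"

definition meval :: "(nat \<Rightarrow> ('k::field) lpoly) \<Rightarrow> 'k mpoly \<Rightarrow> 'k lpoly" where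
  "meval u f = (\<Sum>t\<in>Poly_Mapping.keys f.
     Poly_Mapping.single 0 (Poly_Mapping.lookup f t) * (\<Prod>i\<in>Poly_Mapping.keys t. u i ^ Poly_Mapping.lookup t i))"

text \<open>A tuple \<open>(u 0 : \<dots> : u m)\<close> of Laurent polynomials generating the unit ideal defines a morphism
  from the torus over K to projective space over K, hence to projective space over B. The image of
  a prime q is the homogeneous prime of all f each of whose homogeneous components takes a
  value in q at the tuple.\<close>

definition torus_map :: "nat \<Rightarrow> ('k::field) set \<Rightarrow> (nat \<Rightarrow> 'k lpoly) \<Rightarrow> 'k lpoly set \<Rightarrow> 'k mpoly set" where
  "torus_map m B u q = {f \<in> hcoord m B. \<forall>d. meval u (hcomp d f) \<in> q}"

text \<open>The embedding of tori \<open>(1 : z\<^sub>1^r : z\<^sub>1^(r+1) : \<dots> : z\<^sub>n^r : z\<^sub>n^(r+1))\<close>.\<close>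

definition torus_emb :: "nat \<Rightarrow> nat \<Rightarrow> ('k::field) lpoly" where
  "torus_emb r j =
     (if j = 0 then 1
      else if odd j then zvar ((j + 1) div 2) ^ r
      else zvar (j div 2) ^ (r + 1))"

text \<open>The orbit under the torus over K of the K-rational point with homogeneous coordinates y: the
  image of the orbit morphism given by coordinatewise multiplication with y. It contains all
  scheme-theoretic points of the image, not only the K-rational ones.\<close>

definition torus_orbit :: "nat \<Rightarrow> nat \<Rightarrow> ('k::field) set \<Rightarrow> (nat \<Rightarrow> 'k) \<Rightarrow> 'k mpoly set set" where
  "torus_orbit n r B y =
     torus_map (2 * n) B (\<lambda>j. torus_emb r j * Poly_Mapping.single 0 (y j)) `
       Spec (sub ring_of_type_algebra (laurent n))"

definition orbit_closure ::
    "nat \<Rightarrow> nat \<Rightarrow> ('k::field) set \<Rightarrow> (nat \<Rightarrow> 'k) \<Rightarrow> ('k mpoly set, 'k mpoly fract set, 'k) ischeme" where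
  "orbit_closure n r B y =
     (let P = projective_space (2 * n) B in
        reduced_closed P (pts P closure_of torus_orbit n r B y))"

end

theory Submission
  imports Defs "Jordan_Normal_Form.Char_Poly"
begin

text \<open>
  The linear function of weight \<open>\<omega> = \<gamma> / r\<close> on exponents defines a Gauss valuation W on the function
  field \<open>K(z\<^sub>1, \<dots>, z\<^sub>n)\<close>, which belongs to a vertex outside \<open>\<Gamma>\<close> of the polyhedral complex of the orbit
  closure. Its center on the orbit closure is a point \<open>\<xi>\<close>, and the elements of positive value form a
  maximal ideal of the integral closure of the local ring at \<open>\<xi>\<close>, hence a point of the normalization;
  its local ring R consists of elements with \<open>W \<ge> 0\<close>. The fractions of Laurent polynomials
  supported on exponents of weight in \<open>\<Gamma>\<close> form a subfield L with value group \<open>\<Gamma>\<close> and with the same residue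
  field as W. Therefore each element of R lies in \<open>O\<^sub>L + {W \<ge> \<epsilon>}\<close> for some \<open>\<epsilon> > 0\<close>, where \<open>O\<^sub>L\<close> is the
  valuation ring of L. For fixed \<open>\<epsilon>\<close> this sum is a ring that contains the valuation ring of K and
  the inverses of its elements of value 0. If an affine neighbourhood had a finitely generated ring of
  sections, then one \<open>\<epsilon>\<close> would serve for its generators, hence for all of R. But \<open>\<Gamma>\<close> is dense
  in the reals, so R contains some \<open>a z\<^sub>1\<close> whose value lies strictly between 0 and \<open>\<epsilon>\<close> and not in \<open>\<Gamma>\<close>,
  and such an element is not in the sum.
\<close>

section \<open>Integral closure of subrings\<close>

text \<open>The exponents r and r + 1 make z_1 the quotient of coordinates 2 and 1, and z_1^r /
  \<open>\<pi>\<close> is the quotient of coordinates 1 and 0. For a scalar c with 0 \<le> v c <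
  \<gamma> / r, the r-th power of z_1 / c is therefore \<open>\<pi>\<close> / c^r times a function
  regular at \<open>\<xi>\<close>. So z_1 / c is integral over the local ring, and its value
  \<gamma> / r - v c can be made small. The weight \<gamma> / r gives \<open>\<pi>\<close> and all
  z_i^r the same value \<gamma>. No coordinate has a smaller value, so forms of degree d have value
  at least d * \<gamma>, and those attaining the bound are the ones that do not vanish at
  \<open>\<xi>\<close>. Maximality of the ideal of positive elements is not immediate, because the
  inverse of an integral element of value 0 need not a priori be integral; an integral equation of
  that element is used instead. Moreover, a point belongs to the normalization only if it lies over
  an affine open set, so one chart of the orbit closure has to be proved affine in full. The
  function field is a ring of cosets; valuation arguments therefore take place in the fractions of
  Laurent polynomials, through the embedding \<open>\<Phi>\<close>.\<close>

definition is_subring :: "'a::comm_ring_1 set \<Rightarrow> bool" where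
  "is_subring A \<longleftrightarrow> 1 \<in> A \<and> (\<forall>x\<in>A. \<forall>y\<in>A. x - y \<in> A \<and> x * y \<in> A)"

context
  fixes A :: "'a::comm_ring_1 set"
  assumes A: "is_subring A"
begin

lemma is_subring_one: "1 \<in> A"
  and is_subring_diff: "x \<in> A \<Longrightarrow> y \<in> A \<Longrightarrow> x - y \<in> A"
  and is_subring_mult: "x \<in> A \<Longrightarrow> y \<in> A \<Longrightarrow> x * y \<in> A"
  using A by (auto simp: is_subring_def)

lemma is_subring_zero: "0 \<in> A"
  using is_subring_diff[OF is_subring_one is_subring_one] by simp

lemma is_subring_uminus: "x \<in> A \<Longrightarrow> - x \<in> A"
  using is_subring_diff[OF is_subring_zero] by simp

lemma is_subring_add: "x \<in> A \<Longrightarrow> y \<in> A \<Longrightarrow> x + y \<in> A"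
  using is_subring_diff[OF _ is_subring_uminus] by fastforce

lemma is_subring_sum: "(\<And>i. i \<in> I \<Longrightarrow> f i \<in> A) \<Longrightarrow> sum f I \<in> A"
  by (induction I rule: infinite_finite_induct) (auto intro: is_subring_zero is_subring_add)

lemma is_subring_prod: "(\<And>i. i \<in> I \<Longrightarrow> f i \<in> A) \<Longrightarrow> prod f I \<in> A"
  by (induction I rule: infinite_finite_induct) (auto intro: is_subring_one is_subring_mult)

lemma is_subring_power: "x \<in> A \<Longrightarrow> x ^ k \<in> A"
  by (induction k) (auto intro: is_subring_one is_subring_mult)

text \<open>Allows the closure rules for sums and products to be applied to the Leibniz expansion of
  a determinant with polynomial entries.\<close>

lemma is_subring_polys: "is_subring {p. \<forall>i. Polynomial.coeff p i \<in> A}"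
  unfolding is_subring_def
proof (intro conjI ballI)
  show "1 \<in> {p. \<forall>i. Polynomial.coeff p i \<in> A}"
    by (auto simp: is_subring_one is_subring_zero)
  fix p q assume pq: "p \<in> {p. \<forall>i. Polynomial.coeff p i \<in> A}" "q \<in> {p. \<forall>i. Polynomial.coeff p i \<in> A}"
  then show "p - q \<in> {p. \<forall>i. Polynomial.coeff p i \<in> A}"
    by (auto intro: is_subring_diff)
  show "p * q \<in> {p. \<forall>i. Polynomial.coeff p i \<in> A}"
    using pq by (auto simp: coeff_mult intro!: is_subring_sum is_subring_mult)
qed

end

lemma coeff_char_poly_in:
  assumes A: "is_subring A"
    and M: "M \<in> carrier_mat n n" and MA: "\<And>i j. i < n \<Longrightarrow> j < n \<Longrightarrow> M $$ (i, j) \<in> A"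
  shows "Polynomial.coeff (char_poly M) k \<in> A"
proof -
  let ?P = "{p. \<forall>i. Polynomial.coeff p i \<in> A}"
  have entry: "char_poly_matrix M $$ (i, j) \<in> ?P" if "i < n" "j < n" for i j
    using that M MA[OF that] is_subring_zero[OF A] is_subring_one[OF A] is_subring_uminus[OF A]
    by (auto simp: char_poly_matrix_def coeff_pCons split: nat.splits)
  have dims: "dim_row (char_poly_matrix M) = n" "dim_col (char_poly_matrix M) = n"
    using M by (auto simp: char_poly_matrix_def)
  have "char_poly M \<in> ?P"
    unfolding char_poly_def Determinant.det_def dims if_P[OF refl]
  proof (intro is_subring_sum[OF is_subring_polys[OF A]] is_subring_mult[OF is_subring_polys[OF A]]
      is_subring_prod[OF is_subring_polys[OF A]])
    fix p assume p: "p \<in> {p. p permutes {0..<n}}"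
    show "of_int (sign p) \<in> ?P"
      using is_subring_zero[OF A] is_subring_one[OF A] is_subring_uminus[OF A is_subring_one[OF A]]
      by (cases p rule: sign_cases) auto
    fix i assume i: "i \<in> {0..<n}"
    then have "p i < n" using p permutes_in_image by fastforce
    with i show "char_poly_matrix M $$ (i, p i) \<in> ?P" by (intro entry) auto
  qed
  then show ?thesis by simp
qed

text \<open>Integrality over type-class fields, where the polynomial and matrix libraries apply;
  \<open>mem_C_iff\<close> links it to the list-based \<open>integral_closure_in\<close>.\<close>

definition integral_over :: "'a::field set \<Rightarrow> 'a \<Rightarrow> bool" where
  "integral_over A x \<longleftrightarrow>
     (\<exists>p. Polynomial.lead_coeff p = 1 \<and> (\<forall>i. Polynomial.coeff p i \<in> A) \<and> poly p x = 0)"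

text \<open>The submodule generated by a finite \<open>G\<close>. Coefficients are indexed by the
  generators themselves, so an enumeration is fixed only where a matrix is needed.\<close>

definition lincombs :: "'a::comm_ring_1 set \<Rightarrow> 'a set \<Rightarrow> 'a set" where
  "lincombs A G = {\<Sum>g\<in>G. c g * g | c. \<forall>g\<in>G. c g \<in> A}"

text \<open>The determinant trick: x is an eigenvalue of a matrix over A.\<close>

lemma integral_over_if_stable:
  fixes A :: "'a::field set"
  assumes A: "is_subring A" and fin: "finite G" and G: "g0 \<in> G" "g0 \<noteq> 0"
    and stable: "\<And>g. g \<in> G \<Longrightarrow> x * g \<in> lincombs A G"
  shows "integral_over A x"
proof -
  obtain gs where gs: "set gs = G" "distinct gs" using fin finite_distinct_list by blast
  let ?n = "length gs"
  have "\<forall>g\<in>G. \<exists>c. (\<forall>h\<in>G. c h \<in> A) \<and> x * g = (\<Sum>h\<in>G. c h * h)"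
    using stable unfolding lincombs_def by blast
  then obtain c where c: "\<And>g h. g \<in> G \<Longrightarrow> h \<in> G \<Longrightarrow> c g h \<in> A"
    "\<And>g. g \<in> G \<Longrightarrow> x * g = (\<Sum>h\<in>G. c g h * h)"
    by metis
  define M where "M = Matrix.mat ?n ?n (\<lambda>(i, j). c (gs ! i) (gs ! j))"
  have M: "M \<in> carrier_mat ?n ?n" by (simp add: M_def)
  let ?w = "vec_of_list gs"
  have sum_gs: "(\<Sum>h\<in>G. f h) = (\<Sum>j<?n. f (gs ! j))" for f :: "'a \<Rightarrow> 'a"
    by (simp add: gs(1)[symmetric] sum.distinct_set_conv_list[OF gs(2)] sum_list_sum_nth atLeast0LessThan)
  have "M *\<^sub>v ?w = x \<cdot>\<^sub>v ?w"
  proof (rule eq_vecI)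
    fix i assume i: "i < dim_vec (x \<cdot>\<^sub>v ?w)"
    then have i': "i < ?n" by simp
    then have "gs ! i \<in> G" using gs by auto
    with i' show "vec_index (M *\<^sub>v ?w) i = vec_index (x \<cdot>\<^sub>v ?w) i"
      using c(2)[of "gs ! i"]
      by (simp add: M_def scalar_prod_def sum_gs vec_of_list_index atLeast0LessThan)
  qed (simp add: M_def)
  moreover have "?w \<noteq> 0\<^sub>v ?n"
  proof
    assume w: "?w = 0\<^sub>v ?n"
    obtain i where "i < ?n" "gs ! i = g0" using G(1) gs(1) by (metis in_set_conv_nth)
    with w G(2) show False by (metis vec_of_list_index index_zero_vec(1))
  qed
  ultimately have "eigenvector M ?w x"
    using carrier_matD(1)[OF M] carrier_vecI[of ?w ?n] by (simp add: eigenvector_def)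
  then have "poly (char_poly M) x = 0"
    using eigenvalue_root_char_poly[OF M] by (auto simp: eigenvalue_def)
  moreover have "Polynomial.coeff (char_poly M) i \<in> A" for i
    using c(1) gs by (intro coeff_char_poly_in[OF A M]) (auto simp: M_def)
  ultimately show ?thesis
    using degree_monic_char_poly[OF M] unfolding integral_over_def by metis
qed

section \<open>Finitely generated submodules and sums and products of integral elements\<close>

context
  fixes A G :: "'a::field set"
  assumes A: "is_subring A" and fin: "finite G"
begin

lemma lincombs_diff: "x \<in> lincombs A G \<Longrightarrow> y \<in> lincombs A G \<Longrightarrow> x - y \<in> lincombs A G"
proof -
  assume "x \<in> lincombs A G" "y \<in> lincombs A G"
  then obtain c d where cd: "x = (\<Sum>g\<in>G. c g * g)" "\<forall>g\<in>G. c g \<in> A" "y = (\<Sum>g\<in>G. d g * g)" "\<forall>g\<in>G. d g \<in> A"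
    unfolding lincombs_def by auto
  show ?thesis unfolding lincombs_def
    by (rule CollectI, rule exI[of _ "\<lambda>g. c g - d g"])
      (use cd is_subring_diff[OF A] in \<open>auto simp: sum_subtractf left_diff_distrib\<close>)
qed

lemma lincombs_scale: "a \<in> A \<Longrightarrow> x \<in> lincombs A G \<Longrightarrow> a * x \<in> lincombs A G"
proof -
  assume a: "a \<in> A" and "x \<in> lincombs A G"
  then obtain c where c: "x = (\<Sum>g\<in>G. c g * g)" "\<forall>g\<in>G. c g \<in> A"
    unfolding lincombs_def by auto
  show ?thesis unfolding lincombs_def
    by (rule CollectI, rule exI[of _ "\<lambda>g. a * c g"])
      (use c a is_subring_mult[OF A] in \<open>auto simp: sum_distrib_left mult.assoc\<close>)
qed

lemma lincombs_zero: "0 \<in> lincombs A G"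
  unfolding lincombs_def by (rule CollectI, rule exI[of _ "\<lambda>_. 0"]) (auto simp: is_subring_zero[OF A])

lemma lincombs_add: "x \<in> lincombs A G \<Longrightarrow> y \<in> lincombs A G \<Longrightarrow> x + y \<in> lincombs A G"
  using lincombs_diff[OF _ lincombs_diff[OF lincombs_zero]] by fastforce

lemma lincombs_sum: "(\<And>i. i \<in> I \<Longrightarrow> f i \<in> lincombs A G) \<Longrightarrow> sum f I \<in> lincombs A G"
  by (induction I rule: infinite_finite_induct) (auto intro: lincombs_zero lincombs_add)

lemma lincombs_lin:
  assumes "\<And>i. i \<in> I \<Longrightarrow> a i \<in> A" "\<And>i. i \<in> I \<Longrightarrow> f i \<in> lincombs A G"
  shows "(\<Sum>i\<in>I. a i * f i) \<in> lincombs A G"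
  by (rule lincombs_sum, rule lincombs_scale) (use assms in auto)

lemma lincombs_base: "g \<in> G \<Longrightarrow> g \<in> lincombs A G"
  unfolding lincombs_def
  by (rule CollectI, rule exI[of _ "\<lambda>h. if h = g then 1 else 0"])
    (auto simp: if_distrib[of "\<lambda>c. c * _"] fin is_subring_zero[OF A] is_subring_one[OF A] cong: if_cong)

lemma lincombs_stable_mult:
  assumes "\<And>g. g \<in> G \<Longrightarrow> x * g \<in> lincombs A G" "z \<in> lincombs A G"
  shows "x * z \<in> lincombs A G"
proof -
  obtain c where c: "z = (\<Sum>g\<in>G. c g * g)" "\<forall>g\<in>G. c g \<in> A"
    using assms(2) unfolding lincombs_def by auto
  have "x * z = (\<Sum>g\<in>G. c g * (x * g))" by (simp add: c(1) sum_distrib_left mult.left_commute)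
  also have "\<dots> \<in> lincombs A G" using c(2) assms(1) by (intro lincombs_lin) auto
  finally show ?thesis .
qed

end

text \<open>A monic equation is solved for its top power. The degree is positive because a monic
  constant polynomial is 1 and has no root.\<close>

lemma integral_over_power_expand:
  assumes A: "is_subring A" and x: "integral_over A x"
  obtains k a where "0 < k" "\<And>i. a i \<in> A" "x ^ k = (\<Sum>i<k. a i * x ^ i)"
proof -
  from x obtain p where p: "Polynomial.lead_coeff p = 1" "\<And>i. Polynomial.coeff p i \<in> A" "poly p x = 0"
    unfolding integral_over_def by blast
  let ?k = "Polynomial.degree p"
  have k: "0 < ?k"
  proof (rule ccontr)
    assume "\<not> 0 < ?k"
    then obtain c where "p = [:c:]" using degree_eq_zeroE by auto
    with p show False by (auto split: if_splits)
  qed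
  have "0 = (\<Sum>i\<le>?k. Polynomial.coeff p i * x ^ i)" using p(3) by (simp add: poly_altdef)
  also have "\<dots> = (\<Sum>i<?k. Polynomial.coeff p i * x ^ i) + x ^ ?k"
    using p(1) by (simp add: lessThan_Suc_atMost[symmetric])
  finally have "x ^ ?k = (\<Sum>i<?k. - Polynomial.coeff p i * x ^ i)"
    by (simp add: sum_negf eq_neg_iff_add_eq_0 add.commute)
  with k p(2) show ?thesis by (intro that[of ?k "\<lambda>i. - Polynomial.coeff p i"]) (auto intro: is_subring_uminus[OF A])
qed

text \<open>The monomials x^i * y^j with exponents below the degrees of the two equations generate a
  module stable under both elements: a product that leaves the range is reduced by an equation. The
  generator 1 later serves as the nonzero element in the determinant trick.\<close>

lemma integral_over_common_module:
  fixes x y :: "'a::field"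
  assumes A: "is_subring A" and x: "integral_over A x" and y: "integral_over A y"
  obtains G where "finite G" "1 \<in> G" "\<And>g. g \<in> G \<Longrightarrow> x * g \<in> lincombs A G" "\<And>g. g \<in> G \<Longrightarrow> y * g \<in> lincombs A G"
proof -
  obtain k a where k: "0 < k" and a: "\<And>i. a i \<in> A" and xk: "x ^ k = (\<Sum>i<k. a i * x ^ i)"
    using integral_over_power_expand[OF A x] by metis
  obtain l b where l: "0 < l" and b: "\<And>i. b i \<in> A" and yl: "y ^ l = (\<Sum>i<l. b i * y ^ i)"
    using integral_over_power_expand[OF A y] by metis
  define G where "G = (\<lambda>(i, j). x ^ i * y ^ j) ` ({..<k} \<times> {..<l})"
  have fin: "finite G" by (simp add: G_def)
  have mem: "x ^ i * y ^ j \<in> lincombs A G" if "i < k" "j < l" for i j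
    using that by (intro lincombs_base[OF A fin]) (auto simp: G_def)
  have "1 \<in> G" unfolding G_def using k l by (force intro: image_eqI[of _ _ "(0, 0)"])
  moreover have "x * g \<in> lincombs A G" if "g \<in> G" for g
  proof -
    obtain i j where ij: "g = x ^ i * y ^ j" "i < k" "j < l" using \<open>g \<in> G\<close> by (auto simp: G_def)
    show ?thesis
    proof (cases "Suc i = k")
      case False
      with ij show ?thesis using mem[of "Suc i" j] by (simp add: mult.assoc)
    next
      case True
      then have "x * g = (\<Sum>i<k. a i * (x ^ i * y ^ j))"
        using xk by (simp only: ij(1) mult.assoc[symmetric] power_Suc[symmetric] sum_distrib_right)
      then show ?thesis
        using lincombs_lin[OF A fin, of "{..<k}" a "\<lambda>i. x ^ i * y ^ j"] mem ij a by simp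
    qed
  qed
  moreover have "y * g \<in> lincombs A G" if "g \<in> G" for g
  proof -
    obtain i j where ij: "g = x ^ i * y ^ j" "i < k" "j < l" using \<open>g \<in> G\<close> by (auto simp: G_def)
    show ?thesis
    proof (cases "Suc j = l")
      case False
      with ij show ?thesis using mem[of i "Suc j"] by (simp add: mult.left_commute)
    next
      case True
      have "y * g = x ^ i * y ^ l" using True ij(1) by (auto simp: mult.left_commute)
      also have "\<dots> = (\<Sum>j<l. b j * (x ^ i * y ^ j))"
        by (simp add: yl sum_distrib_left mult.left_commute)
      finally show ?thesis
        using lincombs_lin[OF A fin, of "{..<l}" b "\<lambda>j. x ^ i * y ^ j"] mem ij b by simp
    qed
  qed
  ultimately show ?thesis using fin that by blast
qed

theorem is_subring_integral_over:
  fixes A :: "'a::field set"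
  assumes A: "is_subring A"
  shows "is_subring {x. integral_over A x}"
  unfolding is_subring_def
proof (intro conjI ballI)
  show "1 \<in> {x. integral_over A x}"
    using is_subring_one[OF A] is_subring_zero[OF A] is_subring_uminus[OF A is_subring_one[OF A]]
    by (auto simp: integral_over_def coeff_pCons split: nat.splits intro!: exI[of _ "[:-1, 1:]"])
  fix x y assume "x \<in> {x. integral_over A x}" "y \<in> {x. integral_over A x}"
  then obtain G where G: "finite G" "1 \<in> G" and
    xG: "\<And>g. g \<in> G \<Longrightarrow> x * g \<in> lincombs A G" and yG: "\<And>g. g \<in> G \<Longrightarrow> y * g \<in> lincombs A G"
    using integral_over_common_module[OF A] by auto
  have "(x - y) * g \<in> lincombs A G" if "g \<in> G" for g
    using lincombs_diff[OF A G(1) xG[OF that] yG[OF that]] by (simp add: left_diff_distrib)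
  then show "x - y \<in> {x. integral_over A x}"
    using integral_over_if_stable[OF A G(1,2)] by auto
  have "(x * y) * g \<in> lincombs A G" if "g \<in> G" for g
    using lincombs_stable_mult[OF A G(1) xG yG[OF that]] by (simp add: mult.assoc)
  then show "x * y \<in> {x. integral_over A x}"
    using integral_over_if_stable[OF A G(1,2)] by auto
qed

section \<open>Valuations\<close>

lemma ereal_add_strict_mono_left_finite:
  fixes a b c d :: ereal
  assumes "a < b" "c \<le> d" "c \<noteq> -\<infinity>" "c \<noteq> \<infinity>" 
  shows "a + c < b + d"
  using assms by (cases a; cases b; cases c; cases d) auto

text \<open>Formulated for integral domains because it is applied both to Laurent polynomials
  (\<open>gauss\<close>) and to their fractions (\<open>fract_val\<close>).\<close>

locale domain_valuation =
  fixes g :: "'a::idom \<Rightarrow> ereal"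
  assumes not_minfty: "g x \<noteq> -\<infinity>"
    and infty_iff: "g x = \<infinity> \<longleftrightarrow> x = 0"
    and mult: "g (x * y) = g x + g y"
    and add_ge: "min (g x) (g y) \<le> g (x + y)"
begin

lemma zero [simp]: "g 0 = \<infinity>"
  by (simp add: infty_iff)

lemma finiteE:
  assumes "x \<noteq> 0" obtains c where "g x = ereal c"
  using assms not_minfty[of x] infty_iff[of x] by (cases "g x") auto

lemma one [simp]: "g 1 = 0"
proof -
  obtain c where "g 1 = ereal c" using finiteE[of 1] by auto
  with mult[of 1 1] show ?thesis by simp
qed

lemma minus_one [simp]: "g (- 1) = 0"
proof -
  obtain c where "g (-1) = ereal c" using finiteE[of "-1"] by auto
  with mult[of "-1" "-1"] show ?thesis by simp
qed

lemma uminus [simp]: "g (- x) = g x"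
  using mult[of "-1" x] by simp

lemma power: "g x = ereal c \<Longrightarrow> g (x ^ k) = ereal (real k * c)"
  by (induction k) (auto simp: mult algebra_simps)

lemma add_geI: "c \<le> g x \<Longrightarrow> c \<le> g y \<Longrightarrow> c \<le> g (x + y)"
  using add_ge[of x y] by (auto simp: min_def split: if_splits)

lemma diff_geI: "c \<le> g x \<Longrightarrow> c \<le> g y \<Longrightarrow> c \<le> g (x - y)"
  using add_geI[of c x "- y"] by simp

lemma add_gtI: "c < g x \<Longrightarrow> c < g y \<Longrightarrow> c < g (x + y)"
  using add_ge[of x y] by (auto simp: min_def split: if_splits)

lemma diff_gtI: "c < g x \<Longrightarrow> c < g y \<Longrightarrow> c < g (x - y)"
  using add_gtI[of c x "- y"] by simp

lemma sum_geI: "(\<And>i. i \<in> I \<Longrightarrow> c \<le> g (f i)) \<Longrightarrow> c \<le> g (sum f I)"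
  by (induction I rule: infinite_finite_induct) (auto intro: add_geI)

lemma sum_gtI: "c < \<infinity> \<Longrightarrow> (\<And>i. i \<in> I \<Longrightarrow> c < g (f i)) \<Longrightarrow> c < g (sum f I)"
  by (induction I rule: infinite_finite_induct) (auto intro: add_gtI)

text \<open>If the sum had a larger value, then so would x, as the difference of the sum and
  y.\<close>

lemma add_eq_left:
  assumes "g x < g y" shows "g (x + y) = g x"
proof (rule antisym)
  show "g (x + y) \<le> g x"
  proof (rule ccontr)
    assume "\<not> g (x + y) \<le> g x"
    then have "g x < g (x + y)" by simp
    with assms have "g x < g (x + y - y)" by (intro diff_gtI)
    then show False by simp
  qed
  show "g x \<le> g (x + y)" using assms by (intro add_geI) auto
qed

lemma mult_nonneg: "0 \<le> g x \<Longrightarrow> 0 \<le> g y \<Longrightarrow> 0 \<le> g (x * y)"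
  by (simp add: mult)

end

lemma domain_valuation_if_valuation: "valuation v \<Longrightarrow> domain_valuation v"
  by unfold_locales (auto simp: valuation_def)

subsection \<open>Extension to the fraction field\<close>

definition fract_val :: "('a::idom \<Rightarrow> ereal) \<Rightarrow> 'a fract \<Rightarrow> ereal" where
  "fract_val g x = (THE c. \<exists>a b. b \<noteq> 0 \<and> x = Fract a b \<and> c = g a - g b)"

context domain_valuation
begin

text \<open>Two representations satisfy a * b' = a' * b, and the values of the denominators are
  finite, so they can be moved across the equation. This makes the definite description well
  defined.\<close>

lemma fract_val_Fract:
  assumes b: "b \<noteq> 0" shows "fract_val g (Fract a b) = g a - g b"
  unfolding fract_val_def
proof (rule the_equality)
  show "\<exists>a' b'. b' \<noteq> 0 \<and> Fract a b = Fract a' b' \<and> g a - g b = g a' - g b'" using b by blast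
  fix c assume "\<exists>a' b'. b' \<noteq> 0 \<and> Fract a b = Fract a' b' \<and> c = g a' - g b'"
  then obtain a' b' where *: "b' \<noteq> 0" "Fract a b = Fract a' b'" "c = g a' - g b'" by blast
  then have "a * b' = a' * b" using b by (simp add: eq_fract)
  then have eq: "g a + g b' = g a' + g b" using mult by metis
  obtain x y where "g b = ereal x" "g b' = ereal y" using b *(1) finiteE by metis
  then show "c = g a - g b" using eq *(3) by (cases "g a"; cases "g a'") auto
qed

lemma domain_valuation_fract: "domain_valuation (fract_val g)"
proof
  fix x y :: "'a fract"
  obtain a b where x: "x = Fract a b" "b \<noteq> 0" by (cases x) auto
  obtain c d where y: "y = Fract c d" "d \<noteq> 0" by (cases y) auto
  obtain s where s: "g b = ereal s" using finiteE[OF x(2)] .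
  obtain t where t: "g d = ereal t" using finiteE[OF y(2)] .
  show "fract_val g x \<noteq> -\<infinity>" using not_minfty[of a] by (cases "g a") (auto simp: x fract_val_Fract s)
  show "fract_val g x = \<infinity> \<longleftrightarrow> x = 0" using x(2) not_minfty[of a] infty_iff[of a]
    by (cases "g a") (auto simp: x fract_val_Fract s Zero_fract_def eq_fract)
  show "fract_val g (x * y) = fract_val g x + fract_val g y"
    using not_minfty[of a] not_minfty[of c] x(2) y(2)
    by (cases "g a"; cases "g c") (auto simp: x(1) y(1) fract_val_Fract mult s t)
  have "min (g a + g d) (g c + g b) \<le> g (a * d + c * b)"
    using add_ge[of "a * d" "c * b"] by (simp add: mult)
  then have "min (g a - ereal s) (g c - ereal t) \<le> g (a * d + c * b) - ereal (s + t)"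
    using not_minfty[of a] not_minfty[of c] unfolding min_le_iff_disj s t
    by (cases "g a"; cases "g c"; cases "g (a * d + c * b)") (simp_all, linarith?)
  then show "min (fract_val g x) (fract_val g y) \<le> fract_val g (x + y)"
    using x(2) y(2) by (simp add: x(1) y(1) fract_val_Fract mult s t add.commute)
qed

end

subsection \<open>Gauss valuations\<close>

text \<open>The infimum runs over all exponents: zero coefficients contribute infinity, so it is a
  minimum over the finite support when \<open>f\<close> is nonzero and infinity when
  \<open>f = 0\<close>, without a case distinction.\<close>

definition gauss :: "('k::field \<Rightarrow> ereal) \<Rightarrow> ('a \<Rightarrow> real) \<Rightarrow> ('a \<Rightarrow>\<^sub>0 'k) \<Rightarrow> ereal" where
  "gauss v l f = (INF t. v (Poly_Mapping.lookup f t) + ereal (l t))"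

lemma lookup_mult_finite:
  fixes f g :: "'a::monoid_add \<Rightarrow>\<^sub>0 'b::semiring_0"
  shows "Poly_Mapping.lookup (f * g) k =
    (\<Sum>(p, q)\<in>{x \<in> Poly_Mapping.keys f \<times> Poly_Mapping.keys g. fst x + snd x = k}.
       Poly_Mapping.lookup f p * Poly_Mapping.lookup g q)"
proof -
  have "Poly_Mapping.lookup (f * g) k =
      (\<Sum>(a, b). Poly_Mapping.lookup f a * Poly_Mapping.lookup g b when k = a + b)"
    by (simp add: times_poly_mapping.rep_eq prod_fun_unfold_prod)
  also have "\<dots> = (\<Sum>(a, b)\<in>{x \<in> Poly_Mapping.keys f \<times> Poly_Mapping.keys g. fst x + snd x = k}.
       (Poly_Mapping.lookup f a * Poly_Mapping.lookup g b when k = a + b))"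
    by (rule Sum_any.expand_superset) (auto simp: when_def in_keys_iff split: if_splits)
  also have "\<dots> = (\<Sum>(p, q)\<in>{x \<in> Poly_Mapping.keys f \<times> Poly_Mapping.keys g. fst x + snd x = k}.
       Poly_Mapping.lookup f p * Poly_Mapping.lookup g q)"
    by (rule sum.cong) (auto simp: when_def)
  finally show ?thesis .
qed

text \<open>The linear order on exponents breaks ties in \<open>gauss_mult\<close> and is not
  assumed compatible with \<open>l\<close>. Exponents form a group so that monomials can be
  inverted.\<close>

locale gauss_valuation = v: domain_valuation v for v :: "'k::field \<Rightarrow> ereal" +
  fixes l :: "'a::linordered_ab_group_add \<Rightarrow> real"
  assumes weight_add: "l (s + t) = l s + l t"
begin

lemma weight_zero [simp]: "l 0 = 0"
  using weight_add[of 0 0] by simp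

lemma weight_uminus: "l (- t) = - l t"
  using weight_add[of t "- t"] by simp

lemma le_gauss_iff: "c \<le> gauss v l f \<longleftrightarrow> (\<forall>t. c \<le> v (Poly_Mapping.lookup f t) + ereal (l t))"
  by (simp add: gauss_def le_INF_iff)

lemma gauss_le: "gauss v l f \<le> v (Poly_Mapping.lookup f t) + ereal (l t)"
  unfolding gauss_def by (rule INF_lower) simp

lemma gauss_attained:
  assumes "f \<noteq> 0"
  obtains t where "t \<in> Poly_Mapping.keys f" "gauss v l f = v (Poly_Mapping.lookup f t) + ereal (l t)"
proof -
  let ?h = "\<lambda>t. v (Poly_Mapping.lookup f t) + ereal (l t)"
  have ne: "Poly_Mapping.keys f \<noteq> {}" using assms by (metis keys_eq_empty)
  then obtain t where t: "t \<in> Poly_Mapping.keys f" "\<And>s. s \<in> Poly_Mapping.keys f \<Longrightarrow> ?h t \<le> ?h s"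
    using finite_keys[of f] arg_min_if_finite[of "Poly_Mapping.keys f" ?h] by (meson not_less)
  have "?h t \<le> gauss v l f" unfolding le_gauss_iff
  proof
    fix s show "?h t \<le> ?h s"
      using t(2)[of s] by (cases "s \<in> Poly_Mapping.keys f") (auto simp: in_keys_iff)
  qed
  with gauss_le t(1) that show ?thesis by (meson antisym)
qed

lemma gauss_single: "gauss v l (Poly_Mapping.single t c) = v c + ereal (l t)"
proof (rule antisym)
  show "gauss v l (Poly_Mapping.single t c) \<le> v c + ereal (l t)"
    using gauss_le[of "Poly_Mapping.single t c" t] by simp
  show "v c + ereal (l t) \<le> gauss v l (Poly_Mapping.single t c)"
    unfolding le_gauss_iff by (auto simp: lookup_single when_def)
qed

lemma gauss_add_le: "min (gauss v l f) (gauss v l g) \<le> gauss v l (f + g)"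
  unfolding le_gauss_iff
proof
  fix t
  have "gauss v l f - ereal (l t) \<le> v (Poly_Mapping.lookup f t)" "gauss v l g - ereal (l t) \<le> v (Poly_Mapping.lookup g t)"
    using gauss_le[of f t] gauss_le[of g t] by (simp_all add: ereal_minus_le)
  then have "min (gauss v l f) (gauss v l g) - ereal (l t) \<le> v (Poly_Mapping.lookup (f + g) t)"
    unfolding lookup_add
    by (intro v.add_geI; elim order_trans[rotated]; intro ereal_minus_mono) auto
  then show "min (gauss v l f) (gauss v l g) \<le> v (Poly_Mapping.lookup (f + g) t) + ereal (l t)"
    by (simp add: ereal_minus_le)
qed

lemma gauss_finite:
  assumes "f \<noteq> 0" obtains c where "gauss v l f = ereal c"
proof -
  obtain t where t: "t \<in> Poly_Mapping.keys f" "gauss v l f = v (Poly_Mapping.lookup f t) + ereal (l t)"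
    using gauss_attained[OF assms] .
  then obtain c where "v (Poly_Mapping.lookup f t) = ereal c"
    using v.finiteE by (metis in_keys_iff)
  with t(2) that show ?thesis by simp
qed

lemma gauss_zero [simp]: "gauss v l 0 = \<infinity>"
  by (simp add: gauss_def)

text \<open>Gauss's lemma. One inequality holds term by term. For the other, take among the terms of
  minimal value of each factor the one with the largest exponent: in the coefficient at the sum of
  these exponents, all other products have strictly larger value, so nothing cancels.\<close>

lemma gauss_mult: "gauss v l (f * g) = gauss v l f + gauss v l g"
proof (cases "f = 0 \<or> g = 0")
  case True
  moreover have "gauss v l h \<noteq> -\<infinity>" for h by (cases "h = 0") (auto elim: gauss_finite)
  ultimately show ?thesis by auto
next
  case False
  then have fg: "f \<noteq> 0" "g \<noteq> 0" by auto
  let ?F = "\<lambda>t. v (Poly_Mapping.lookup f t) + ereal (l t)"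
  let ?G = "\<lambda>t. v (Poly_Mapping.lookup g t) + ereal (l t)"
  obtain cf where cf: "gauss v l f = ereal cf" using gauss_finite[OF fg(1)] .
  obtain cg where cg: "gauss v l g = ereal cg" using gauss_finite[OF fg(2)] .
  let ?P = "\<lambda>k. {x \<in> Poly_Mapping.keys f \<times> Poly_Mapping.keys g. fst x + snd x = k}"
  have term_eq: "v (Poly_Mapping.lookup f p * Poly_Mapping.lookup g q) = ?F p + ?G q - ereal (l (p + q))" for p q
    using v.not_minfty[of "Poly_Mapping.lookup f p"] v.not_minfty[of "Poly_Mapping.lookup g q"]
    by (cases "v (Poly_Mapping.lookup f p)"; cases "v (Poly_Mapping.lookup g q)")
      (auto simp: v.mult weight_add)
  have ge: "gauss v l f + gauss v l g \<le> gauss v l (f * g)"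
    unfolding le_gauss_iff
  proof
    fix k
    have "ereal (cf + cg - l k) \<le> v (Poly_Mapping.lookup (f * g) k)"
      unfolding lookup_mult_finite
    proof (intro v.sum_geI, clarify)
      fix p q assume "k = fst (p, q) + snd (p, q)"
      then have "k = p + q" by simp
      moreover have "ereal cf + ereal cg \<le> ?F p + ?G q"
        using gauss_le[of f p] gauss_le[of g q] cf cg by (intro add_mono) auto
      ultimately show "ereal (cf + cg - l (fst (p, q) + snd (p, q))) \<le> v (Poly_Mapping.lookup f p * Poly_Mapping.lookup g q)"
        using ereal_minus_mono[of "ereal cf + ereal cg" "?F p + ?G q" "ereal (l k)" "ereal (l k)"]
        by (simp add: term_eq)
    qed
    then show "gauss v l f + gauss v l g \<le> v (Poly_Mapping.lookup (f * g) k) + ereal (l k)"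
      unfolding cf cg by (cases "v (Poly_Mapping.lookup (f * g) k)") auto
  qed
  define Tf where "Tf = {t \<in> Poly_Mapping.keys f. ?F t = ereal cf}"
  define Tg where "Tg = {t \<in> Poly_Mapping.keys g. ?G t = ereal cg}"
  have fin: "finite Tf" "finite Tg" by (auto simp: Tf_def Tg_def)
  have ne: "Tf \<noteq> {}" "Tg \<noteq> {}"
    unfolding Tf_def Tg_def using gauss_attained[OF fg(1)] gauss_attained[OF fg(2)] cf cg
    by (metis (mono_tags, lifting) empty_iff mem_Collect_eq)+
  define s where "s = Max Tf"
  define t where "t = Max Tg"
  have s: "s \<in> Tf" and t: "t \<in> Tg" using fin ne by (auto simp: s_def t_def)
  have st: "(s, t) \<in> ?P (s + t)" using s t by (auto simp: Tf_def Tg_def)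
  have split: "Poly_Mapping.lookup (f * g) (s + t) = Poly_Mapping.lookup f s * Poly_Mapping.lookup g t +
      (\<Sum>(p, q)\<in>?P (s + t) - {(s, t)}. Poly_Mapping.lookup f p * Poly_Mapping.lookup g q)"
    unfolding lookup_mult_finite by (subst sum.remove[OF _ st]) auto
  have lead: "v (Poly_Mapping.lookup f s * Poly_Mapping.lookup g t) = ereal (cf + cg - l (s + t))"
    using s t by (simp add: term_eq Tf_def Tg_def)
  have rest: "ereal (cf + cg - l (s + t)) < v (\<Sum>(p, q)\<in>?P (s + t) - {(s, t)}. Poly_Mapping.lookup f p * Poly_Mapping.lookup g q)"
  proof (rule v.sum_gtI, simp)
    fix x assume x: "x \<in> ?P (s + t) - {(s, t)}"
    obtain p q where pq: "x = (p, q)" by (cases x)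
    have keys: "p \<in> Poly_Mapping.keys f" "q \<in> Poly_Mapping.keys g" and sum: "p + q = s + t" and ne: "(p, q) \<noteq> (s, t)"
      using x pq by auto
    have le: "ereal cf \<le> ?F p" "ereal cg \<le> ?G q" using gauss_le[of f p] gauss_le[of g q] cf cg by auto
    \<comment> \<open>Two exponents bounded by the maxima \<open>s\<close> and \<open>t\<close> can
      have sum s + t only if they equal them.\<close>
    have "\<not> (p \<in> Tf \<and> q \<in> Tg)"
    proof
      assume "p \<in> Tf \<and> q \<in> Tg"
      then have "p \<le> s" "q \<le> t" using fin by (auto simp: s_def t_def)
      with sum ne show False
        by (metis add_le_cancel_left add_le_cancel_right antisym_conv)
    qed
    then have "ereal cf < ?F p \<or> ereal cg < ?G q"
      using keys le by (auto simp: Tf_def Tg_def order_less_le)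
    then have "ereal cf + ereal cg < ?F p + ?G q"
      using le ereal_add_strict_mono_left_finite[of "ereal cf" "?F p" "ereal cg" "?G q"]
        ereal_add_strict_mono_left_finite[of "ereal cg" "?G q" "ereal cf" "?F p"]
      by (auto simp: add.commute)
    then have "ereal (cf + cg - l (s + t)) < ?F p + ?G q - ereal (l (p + q))"
      unfolding sum by (cases "?F p + ?G q") auto
    then show "ereal (cf + cg - l (s + t)) < v (case x of (p, q) \<Rightarrow> Poly_Mapping.lookup f p * Poly_Mapping.lookup g q)"
      by (simp add: pq term_eq)
  qed
  have "v (Poly_Mapping.lookup (f * g) (s + t)) = ereal (cf + cg - l (s + t))"
    unfolding split using v.add_eq_left rest lead by simp
  then have "gauss v l (f * g) \<le> gauss v l f + gauss v l g"
    using gauss_le[of "f * g" "s + t"] cf cg by simp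
  with ge show ?thesis by (rule antisym[rotated])
qed

sublocale gauss: domain_valuation "gauss v l"
proof
  fix f g :: "'a \<Rightarrow>\<^sub>0 'k"
  show "gauss v l f \<noteq> -\<infinity>" by (cases "f = 0") (auto elim: gauss_finite)
  show "gauss v l f = \<infinity> \<longleftrightarrow> f = 0" by (metis gauss_finite gauss_zero PInfty_neq_ereal(1))
qed (rule gauss_mult gauss_add_le)+

end

subsection \<open>Approximation by a subfield\<close>

definition is_subfield :: "'a::field set \<Rightarrow> bool" where
  "is_subfield L \<longleftrightarrow> is_subring L \<and> (\<forall>x\<in>L. inverse x \<in> L)"

locale field_valuation = domain_valuation w for w :: "'e::field \<Rightarrow> ereal"
begin

lemma inverse: "w x = ereal c \<Longrightarrow> w (inverse x) = ereal (- c)"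
proof -
  assume c: "w x = ereal c"
  then have "x \<noteq> 0" by auto
  then have "w x + w (inverse x) = 0" using mult[of x "inverse x"] by simp
  with c show ?thesis by (cases "w (inverse x)") auto
qed

lemma value_group_uminus: assumes "t \<in> value_group w" shows "- t \<in> value_group w"
proof -
  obtain x where "x \<noteq> 0" "w x = ereal t" using assms by (auto simp: value_group_def)
  then show ?thesis
    unfolding value_group_def by (intro CollectI exI[of _ "inverse x"]) (simp add: inverse)
qed

lemma value_group_add:
  assumes "s \<in> value_group w" "t \<in> value_group w" shows "s + t \<in> value_group w"
proof -
  obtain x y where "x \<noteq> 0" "w x = ereal s" "y \<noteq> 0" "w y = ereal t"
    using assms by (auto simp: value_group_def)
  then show ?thesis
    unfolding value_group_def by (intro CollectI exI[of _ "x * y"]) (simp add: mult)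
qed

lemma value_group_diff: "s \<in> value_group w \<Longrightarrow> t \<in> value_group w \<Longrightarrow> s - t \<in> value_group w"
  using value_group_add[of s "- t"] value_group_uminus by simp

lemma value_group_zero: "0 \<in> value_group w"
  unfolding value_group_def by (intro CollectI exI[of _ 1]) (simp add: zero_ereal_def)

text \<open>For the valuation w, this is the ring O_L + {w \<ge> e} of the overview, expressed
  through an approximant in \<open>L\<close>. It grows as \<open>e\<close> decreases.\<close>

definition near :: "'e set \<Rightarrow> real \<Rightarrow> 'e set" where
  "near L e = {x. \<exists>a\<in>L. 0 \<le> w a \<and> ereal e \<le> w (x - a)}"

lemma near_nonneg:
  assumes "x \<in> near L e" "0 < e" shows "0 \<le> w x"
proof -
  obtain a where a: "0 \<le> w a" "ereal e \<le> w (x - a)" using assms by (auto simp: near_def)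
  have "0 \<le> w (x - a)" using order_trans[OF _ a(2), of 0] assms(2) by (simp add: zero_ereal_def)
  then have "0 \<le> w ((x - a) + a)" using a by (intro add_geI)
  then show ?thesis by simp
qed

lemma is_subring_near:
  assumes L: "is_subfield L" and e: "0 < e"
  shows "is_subring (near L e)"
  unfolding is_subring_def
proof (intro conjI ballI)
  have S: "is_subring L" using L by (simp add: is_subfield_def)
  show "1 \<in> near L e"
    using is_subring_one[OF S] by (auto simp: near_def intro!: bexI[of _ 1])
  fix x y assume x: "x \<in> near L e" and y: "y \<in> near L e"
  obtain a where a: "a \<in> L" "0 \<le> w a" "ereal e \<le> w (x - a)" using x by (auto simp: near_def)
  obtain b where b: "b \<in> L" "0 \<le> w b" "ereal e \<le> w (y - b)" using y by (auto simp: near_def)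
  have "ereal e \<le> w ((x - a) - (y - b))" by (rule diff_geI[OF a(3) b(3)])
  moreover have "0 \<le> w (a - b)" by (rule diff_geI[OF a(2) b(2)])
  ultimately show "x - y \<in> near L e"
    using is_subring_diff[OF S a(1) b(1)] by (auto simp: near_def algebra_simps intro!: bexI[of _ "a - b"])
  \<comment> \<open>The difference x * y - a * b is split as x * (y - b) + (x - a) * b; in each
    summand one factor has nonnegative value and the other has value at least
    \<open>e\<close>.\<close>
  have "ereal e \<le> w (x * (y - b))"
    using add_mono[OF near_nonneg[OF x e] b(3)] by (simp add: mult)
  moreover have "ereal e \<le> w ((x - a) * b)"
    using add_mono[OF a(3) b(2)] by (simp add: mult)
  ultimately have "ereal e \<le> w (x * (y - b) + (x - a) * b)" by (rule add_geI)
  then show "x * y \<in> near L e"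
    using is_subring_mult[OF S a(1) b(1)] mult_nonneg[OF a(2) b(2)]
    by (auto simp: near_def algebra_simps intro!: bexI[of _ "a * b"])
qed

text \<open>The approximant a must itself have value 0, its inverse lies in \<open>L\<close>, and
  the inverses differ by (a - x) / (x * a), whose value is that of a - x.\<close>

lemma near_inverse:
  assumes L: "is_subfield L" and e: "0 < e" and x: "x \<in> near L e" "w x = 0"
  shows "inverse x \<in> near L e"
proof -
  obtain a where a: "a \<in> L" "0 \<le> w a" "ereal e \<le> w (x - a)" using x by (auto simp: near_def)
  have "w x < w (a - x)"
    using a(3) e x(2) uminus[of "x - a"] by (auto intro: less_le_trans[of _ "ereal e"])
  then have wa: "w a = 0" using add_eq_left[of x "a - x"] x(2) by simp
  have nz: "x \<noteq> 0" "a \<noteq> 0" using x(2) wa by auto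
  have "w (inverse x - inverse a) = w ((a - x) * (inverse x * inverse a))"
    using nz by (simp add: field_simps)
  also have "\<dots> = w (x - a)"
    using inverse[of x 0] inverse[of a 0] x(2) wa uminus[of "x - a"] by (simp add: mult zero_ereal_def)
  finally have "ereal e \<le> w (inverse x - inverse a)" using a(3) by simp
  moreover have "inverse a \<in> L" using L a(1) by (simp add: is_subfield_def)
  moreover have "0 \<le> w (inverse a)" using inverse[of a 0] wa by (simp add: zero_ereal_def)
  ultimately show ?thesis by (auto simp: near_def)
qed

text \<open>The error has value at least \<open>e\<close>, which exceeds w x, so the approximant has
  exactly the value of x. This is the source of the final contradiction.\<close>

lemma near_small_value:
  assumes "x \<in> near L e" "w x < ereal e"
  obtains a where "a \<in> L" "w x = w a"
proof -
  obtain a where a: "a \<in> L" "0 \<le> w a" "ereal e \<le> w (x - a)" using assms(1) by (auto simp: near_def)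
  have "w x < w (a - x)" using a(3) assms(2) uminus[of "x - a"] by simp
  then have "w a = w x" using add_eq_left[of x "a - x"] by simp
  with a(1) that show ?thesis by metis
qed

lemma near_finite:
  assumes "finite G" "\<And>g. g \<in> G \<Longrightarrow> \<exists>a\<in>L. 0 \<le> w a \<and> 0 < w (g - a)"
  obtains e where "0 < e" "G \<subseteq> near L e"
proof -
  have "\<exists>e>0. G \<subseteq> near L e"
    using assms
  proof (induction G rule: finite_induct)
    case empty
    then show ?case by (auto intro: exI[of _ 1])
  next
    case (insert g G)
    then obtain e where e: "0 < e" "G \<subseteq> near L e" by auto
    obtain a where a: "a \<in> L" "0 \<le> w a" "0 < w (g - a)" using insert.prems[of g] by auto
    \<comment> \<open>The value of g - a may be infinite, so a positive real below it is
      taken.\<close>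
    obtain d where d: "0 < d" "ereal d \<le> w (g - a)"
      using a(3) by (metis ereal_dense2 ereal_less(2) less_imp_le)
    have min: "ereal (min e d) \<le> ereal e" "ereal (min e d) \<le> ereal d" by auto
    have "near L e \<subseteq> near L (min e d)"
      unfolding near_def using order_trans[OF min(1)] by blast
    moreover have "g \<in> near L (min e d)"
      unfolding near_def using a order_trans[OF min(2) d(2)] by blast
    ultimately
    show ?case using e d by (intro exI[of _ "min e d"]) auto
  qed
  with that show ?thesis by blast
qed

end

context gauss_valuation
begin

sublocale base: field_valuation v ..

sublocale fract: field_valuation "fract_val (gauss v l)"
  using gauss.domain_valuation_fract by (simp add: field_valuation_def)

section \<open>Laurent polynomials with exponents of weight in the value group, and their
  fractions\<close>

definition aligned :: "('a \<Rightarrow>\<^sub>0 'k) set" where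
  "aligned = {f. \<forall>t\<in>Poly_Mapping.keys f. l t \<in> value_group v}"

lemma is_subring_aligned: "is_subring aligned"
  unfolding is_subring_def
proof (intro conjI ballI)
  show "1 \<in> aligned" by (auto simp: aligned_def base.value_group_zero)
  fix f g assume "f \<in> aligned" "g \<in> aligned"
  note fg = this
  show "f - g \<in> aligned" using fg keys_diff[of f g] by (auto simp: aligned_def)
  show "f * g \<in> aligned"
    unfolding aligned_def
  proof (intro CollectI ballI)
    fix k assume "k \<in> Poly_Mapping.keys (f * g)"
    then obtain s t where "k = s + t" "s \<in> Poly_Mapping.keys f" "t \<in> Poly_Mapping.keys g"
      using keys_mult[of f g] by blast
    then show "l k \<in> value_group v"
      using fg base.value_group_add[of "l s" "l t"] by (auto simp: aligned_def weight_add)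
  qed
qed

definition aligned_fracts :: "('a \<Rightarrow>\<^sub>0 'k) fract set" where
  "aligned_fracts = {Fract a b | a b. a \<in> aligned \<and> b \<in> aligned \<and> b \<noteq> 0}"

lemma aligned_fractsI: "a \<in> aligned \<Longrightarrow> b \<in> aligned \<Longrightarrow> b \<noteq> 0 \<Longrightarrow> Fract a b \<in> aligned_fracts"
  by (auto simp: aligned_fracts_def)

lemma is_subfield_aligned_fracts: "is_subfield aligned_fracts"
  unfolding is_subfield_def is_subring_def
proof (intro conjI ballI)
  note S = is_subring_one[OF is_subring_aligned] is_subring_zero[OF is_subring_aligned]
    is_subring_mult[OF is_subring_aligned] is_subring_diff[OF is_subring_aligned]
  show "1 \<in> aligned_fracts" using S unfolding aligned_fracts_def One_fract_def by fastforce
  fix x assume "x \<in> aligned_fracts"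
  then obtain a b where x: "x = Fract a b" "a \<in> aligned" "b \<in> aligned" "b \<noteq> 0" by (auto simp: aligned_fracts_def)
  show "inverse x \<in> aligned_fracts"
  proof (cases "a = 0")
    case True
    then have "inverse x = Fract 0 1" using x by (simp add: eq_fract Zero_fract_def[symmetric])
    then show ?thesis using S unfolding aligned_fracts_def by fastforce
  next
    case False
    then show ?thesis using x by (auto simp: aligned_fracts_def)
  qed
  fix y assume "y \<in> aligned_fracts"
  then obtain c d where y: "y = Fract c d" "c \<in> aligned" "d \<in> aligned" "d \<noteq> 0" by (auto simp: aligned_fracts_def)
  have "x - y = Fract (a * d - c * b) (b * d)" "x * y = Fract (a * c) (b * d)" "b * d \<noteq> 0"
    using x y by simp_all
  moreover have "a * d - c * b \<in> aligned" "a * c \<in> aligned" "b * d \<in> aligned"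
    using x(2,3) y(2,3) by (simp_all add: S)
  ultimately show "x - y \<in> aligned_fracts" "x * y \<in> aligned_fracts"
    by (metis aligned_fractsI)+
qed

lemma gauss_aligned:
  assumes "f \<in> aligned" "f \<noteq> 0"
  obtains c where "c \<in> value_group v" "gauss v l f = ereal c"
proof -
  obtain t where t: "t \<in> Poly_Mapping.keys f" "gauss v l f = v (Poly_Mapping.lookup f t) + ereal (l t)"
    using gauss_attained[OF assms(2)] .
  obtain d where d: "v (Poly_Mapping.lookup f t) = ereal d"
    using t v.finiteE by (metis in_keys_iff)
  then have "d \<in> value_group v" using t by (auto simp: value_group_def in_keys_iff)
  moreover have "l t \<in> value_group v" using assms(1) t by (auto simp: aligned_def)
  ultimately show ?thesis using that[OF base.value_group_add] t(2) d by simp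
qed

lemma fract_val_aligned:
  assumes "x \<in> aligned_fracts" "x \<noteq> 0"
  obtains c where "c \<in> value_group v" "fract_val (gauss v l) x = ereal c"
proof -
  obtain a b where x: "x = Fract a b" "a \<in> aligned" "b \<in> aligned" "b \<noteq> 0"
    using assms by (auto simp: aligned_fracts_def)
  then have "a \<noteq> 0" using assms(2) by (auto simp: eq_fract Zero_fract_def)
  obtain c where "c \<in> value_group v" "gauss v l a = ereal c" using gauss_aligned[OF x(2) \<open>a \<noteq> 0\<close>] .
  moreover obtain d where "d \<in> value_group v" "gauss v l b = ereal d" using gauss_aligned[OF x(3,4)] .
  ultimately show ?thesis
    using x that[OF base.value_group_diff] by (simp add: gauss.fract_val_Fract)
qed

text \<open>\<open>f0\<close> collects the terms whose exponent has weight in the value group. A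
  term outside it cannot have value exactly 0, so nonnegative improves to positive.\<close>

lemma aligned_part:
  assumes "0 \<le> gauss v l f"
  obtains f0 f1 where "f = f0 + f1" "f0 \<in> aligned" "0 \<le> gauss v l f0" "0 < gauss v l f1"
proof -
  define K where "K = {t \<in> Poly_Mapping.keys f. l t \<in> value_group v}"
  define f0 where "f0 = (\<Sum>t\<in>K. Poly_Mapping.single t (Poly_Mapping.lookup f t))"
  have "finite K" by (simp add: K_def)
  then have lk: "Poly_Mapping.lookup f0 t = (if l t \<in> value_group v then Poly_Mapping.lookup f t else 0)" for t
    by (auto simp: f0_def lookup_sum lookup_single when_def K_def in_keys_iff)
  have ge: "0 \<le> v (Poly_Mapping.lookup f t) + ereal (l t)" for t
    using assms by (simp add: le_gauss_iff)
  have "0 \<le> gauss v l f0" unfolding le_gauss_iff using ge by (auto simp: lk)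
  moreover have "0 < gauss v l (f - f0)"
  proof (cases "f - f0 = 0")
    case False
    obtain t where t: "t \<in> Poly_Mapping.keys (f - f0)"
      "gauss v l (f - f0) = v (Poly_Mapping.lookup (f - f0) t) + ereal (l t)"
      using gauss_attained[OF False] .
    then have nl: "l t \<notin> value_group v" "Poly_Mapping.lookup f t \<noteq> 0" and e: "Poly_Mapping.lookup (f - f0) t = Poly_Mapping.lookup f t"
      by (auto simp: in_keys_iff lookup_minus lk split: if_splits)
    obtain d where d: "v (Poly_Mapping.lookup f t) = ereal d" using v.finiteE[OF nl(2)] .
    then have "d \<in> value_group v" using nl(2) by (auto simp: value_group_def)
    \<comment> \<open>Otherwise l t would be the negative of the value d of a coefficient, hence in
      the value group.\<close>
    then have "d + l t \<noteq> 0" using nl(1) base.value_group_uminus[of d] by (metis add.inverse_unique)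
    with ge[of t] t(2) d e show ?thesis by (simp add: zero_ereal_def)
  qed simp
  moreover have "f0 \<in> aligned" by (auto simp: aligned_def in_keys_iff lk split: if_splits)
  ultimately show ?thesis using that[of f0 "f - f0"] by simp
qed

text \<open>The aligned fractions exhaust the residue field even if their value group is smaller.\<close>

lemma aligned_approx:
  assumes "0 \<le> fract_val (gauss v l) x"
  shows "\<exists>a\<in>aligned_fracts. 0 \<le> fract_val (gauss v l) a \<and> 0 < fract_val (gauss v l) (x - a)"
proof (cases "fract_val (gauss v l) x = 0")
  case False
  then have "0 < fract_val (gauss v l) x" using assms by simp
  moreover have "0 \<in> aligned_fracts"
    using is_subring_zero is_subfield_aligned_fracts by (auto simp: is_subfield_def)
  ultimately show ?thesis by (intro bexI[of _ 0]) auto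
next
  case True
  obtain f g where x: "x = Fract f g" "g \<noteq> 0" by (cases x) auto
  obtain t where t: "t \<in> Poly_Mapping.keys g" "gauss v l g = v (Poly_Mapping.lookup g t) + ereal (l t)"
    using gauss_attained[OF x(2)] .
  \<comment> \<open>The inverse of a term of \<open>g\<close> that attains the Gauss value.
    Multiplying by it normalizes the denominator, and then also the numerator, to value 0.\<close>
  define m where "m = Poly_Mapping.single (- t) (inverse (Poly_Mapping.lookup g t))"
  obtain c where c: "v (Poly_Mapping.lookup g t) = ereal c" using t v.finiteE by (metis in_keys_iff)
  have gm: "gauss v l m = - gauss v l g"
    by (simp add: m_def gauss_single weight_uminus t(2) c base.inverse[OF c])
  obtain d where d: "gauss v l g = ereal d" using gauss_finite[OF x(2)] .
  have m0: "m \<noteq> 0" using gm d by auto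
  define f' where "f' = m * f"
  define g' where "g' = m * g"
  have g'0: "g' \<noteq> 0" and x': "x = Fract f' g'" using m0 x by (auto simp: g'_def f'_def eq_fract)
  have vg: "gauss v l g' = 0" by (simp add: g'_def gauss.mult gm d)
  have vf: "gauss v l f' = 0"
    using True vg unfolding x' gauss.fract_val_Fract[OF g'0] by simp
  obtain f0 f1 where f: "f' = f0 + f1" "f0 \<in> aligned" "0 \<le> gauss v l f0" "0 < gauss v l f1"
    by (rule aligned_part[of f']) (simp add: vf)
  obtain g0 g1 where g: "g' = g0 + g1" "g0 \<in> aligned" "0 \<le> gauss v l g0" "0 < gauss v l g1"
    by (rule aligned_part[of g']) (simp add: vg)
  \<comment> \<open>\<open>g1\<close> has positive value, so a positive value of \<open>g0\<close>
    would make that of \<open>g'\<close> positive. The aligned part of the denominator is thus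
    nonzero of value 0 and may be divided by.\<close>
  have vg0: "gauss v l g0 = 0"
    using gauss.diff_gtI[of 0 g' g1] g vg gauss.add_gtI[of 0 g0 g1] by (metis order_less_le)
  have g00: "g0 \<noteq> 0" using vg0 by auto
  have "x - Fract f0 g0 = Fract (f1 * g0 - f0 * g1) (g' * g0)"
    using g'0 g00 by (simp add: x' f(1) g(1) algebra_simps)
  moreover have "0 < gauss v l (f1 * g0 - f0 * g1)"
  proof (rule gauss.diff_gtI)
    show "0 < gauss v l (f1 * g0)" using f(4) vg0 by (simp add: gauss.mult)
    show "0 < gauss v l (f0 * g1)" using f(3) g(4) by (simp add: gauss.mult add_nonneg_pos)
  qed
  ultimately have "0 < fract_val (gauss v l) (x - Fract f0 g0)"
    using g'0 g00 vg vg0 by (simp add: gauss.fract_val_Fract gauss.mult)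
  moreover have "0 \<le> fract_val (gauss v l) (Fract f0 g0)"
    using f(3) g00 vg0 by (simp add: gauss.fract_val_Fract)
  ultimately show ?thesis using f(2) g(2) g00 by (auto simp: aligned_fracts_def)
qed

end

section \<open>Graded ideals of the polynomial ring\<close>

lemma poly_mapping_sum_single: "f = (\<Sum>t\<in>Poly_Mapping.keys f. Poly_Mapping.single t (Poly_Mapping.lookup f t))"
  by (rule poly_mapping_eqI) (simp add: lookup_sum lookup_single when_def in_keys_iff)

lemma mdeg_add: "mdeg (s + t) = mdeg s + mdeg t"
  unfolding mdeg_def by (rule setsum_keys_plus_distrib) auto

lemma mdeg_zero [simp]: "mdeg 0 = 0"
  by (simp add: mdeg_def)

lemma lookup_hcomp: "Poly_Mapping.lookup (hcomp d f) t = (if mdeg t = d then Poly_Mapping.lookup f t else 0)"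
  by (auto simp: hcomp_def lookup_sum lookup_single when_def in_keys_iff)

lemma hcomp_add: "hcomp d (f + g) = hcomp d f + hcomp d g"
  by (rule poly_mapping_eqI) (simp add: lookup_hcomp lookup_add)

lemma hcomp_zero [simp]: "hcomp d 0 = 0"
  by (rule poly_mapping_eqI) (simp add: lookup_hcomp)

lemma hcomp_sum: "hcomp d (sum f I) = (\<Sum>i\<in>I. hcomp d (f i))"
  by (induction I rule: infinite_finite_induct) (auto simp: hcomp_add)

lemma homog_iff: "homog d f \<longleftrightarrow> (\<forall>t. Poly_Mapping.lookup f t \<noteq> 0 \<longrightarrow> mdeg t = d)"
  by (auto simp: homog_def in_keys_iff)

lemma homog_hcomp [simp]: "homog d (hcomp d f)"
  by (auto simp: homog_iff lookup_hcomp split: if_splits)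

lemma hcomp_homog: "homog d f \<Longrightarrow> hcomp e f = (if e = d then f else 0)"
  by (rule poly_mapping_eqI) (auto simp: lookup_hcomp homog_iff)

lemma homog_add: "homog d f \<Longrightarrow> homog d g \<Longrightarrow> homog d (f + g)"
  by (auto simp: homog_iff lookup_add) (metis add.right_neutral add.left_neutral)

lemma homog_diff: "homog d f \<Longrightarrow> homog d g \<Longrightarrow> homog d (f - g)"
  by (auto simp: homog_iff lookup_minus) (metis diff_zero)

lemma homog_zero [simp]: "homog d 0"
  by (simp add: homog_def)

lemma homog_one [simp]: "homog 0 1"
  by (simp add: homog_def)

lemma homog_sum: "(\<And>i. i \<in> I \<Longrightarrow> homog d (f i)) \<Longrightarrow> homog d (sum f I)"
  by (induction I rule: infinite_finite_induct) (auto intro: homog_add)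

lemma homog_single: "homog (mdeg t) (Poly_Mapping.single t c)"
  by (simp add: homog_def)

lemma homog_mult: "homog d f \<Longrightarrow> homog e g \<Longrightarrow> homog (d + e) (f * g)"
proof -
  assume h: "homog d f" "homog e g"
  show ?thesis unfolding homog_def
  proof
    fix t assume "t \<in> Poly_Mapping.keys (f * g)"
    then obtain p q where "t = p + q" "p \<in> Poly_Mapping.keys f" "q \<in> Poly_Mapping.keys g"
      using keys_mult[of f g] by blast
    with h show "mdeg t = d + e" by (simp add: homog_def mdeg_add)
  qed
qed

lemma homog_power: "homog d f \<Longrightarrow> homog (k * d) (f ^ k)"
  by (induction k) (simp_all add: homog_mult)

lemma sum_hcomp: "f = (\<Sum>d\<in>mdeg ` Poly_Mapping.keys f. hcomp d f)"
  by (rule poly_mapping_eqI) (auto simp: lookup_sum lookup_hcomp in_keys_iff)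

lemma hcomp_mult: "hcomp k (f * g) = (\<Sum>i\<le>k. hcomp i f * hcomp (k - i) g)"
proof -
  let ?I = "mdeg ` Poly_Mapping.keys f" and ?J = "mdeg ` Poly_Mapping.keys g"
  have zf: "hcomp i f = 0" if "i \<notin> ?I" for i
    using that by (intro poly_mapping_eqI) (auto simp: lookup_hcomp in_keys_iff)
  have zg: "hcomp i g = 0" if "i \<notin> ?J" for i
    using that by (intro poly_mapping_eqI) (auto simp: lookup_hcomp in_keys_iff)
  have "f * g = (\<Sum>i\<in>?I. \<Sum>j\<in>?J. hcomp i f * hcomp j g)"
    using sum_hcomp[of f] sum_hcomp[of g] by (metis sum_product)
  then have "hcomp k (f * g) = (\<Sum>i\<in>?I. \<Sum>j\<in>?J. if i + j = k then hcomp i f * hcomp j g else 0)"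
    by (simp add: hcomp_sum hcomp_homog[OF homog_mult[OF homog_hcomp homog_hcomp]] eq_commute cong: if_cong)
  also have "\<dots> = (\<Sum>i\<in>?I. if i \<le> k then hcomp i f * hcomp (k - i) g else 0)"
  proof (rule sum.cong[OF refl])
    fix i
    have "(\<Sum>j\<in>?J. if i + j = k then hcomp i f * hcomp j g else 0) =
        (\<Sum>j\<in>?J. if j = k - i then (if i \<le> k then hcomp i f * hcomp j g else 0) else 0)"
      by (rule sum.cong) auto
    then show "(\<Sum>j\<in>?J. if i + j = k then hcomp i f * hcomp j g else 0) =
        (if i \<le> k then hcomp i f * hcomp (k - i) g else 0)"
      using zg[of "k - i"] by simp
  qed
  also have "\<dots> = (\<Sum>i\<in>?I \<inter> {..k}. hcomp i f * hcomp (k - i) g)"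
    by (simp add: sum.inter_restrict)
  also have "\<dots> = (\<Sum>i\<le>k. hcomp i f * hcomp (k - i) g)"
  proof (rule sum.mono_neutral_left)
    show "\<forall>i\<in>{..k} - ?I \<inter> {..k}. hcomp i f * hcomp (k - i) g = 0"
      using zf by (metis DiffD1 DiffD2 IntI mult_zero_left)
  qed auto
  finally show ?thesis .
qed

lemma is_subring_hcoord:
  assumes B: "is_subring B"
  shows "is_subring (hcoord m B)"
  unfolding is_subring_def
proof (intro conjI ballI)
  show "1 \<in> hcoord m B" using is_subring_one[OF B] is_subring_zero[OF B]
    by (auto simp: hcoord_def lookup_one when_def)
  fix f g assume fg: "f \<in> hcoord m B" "g \<in> hcoord m B"
  show "f - g \<in> hcoord m B"
    using fg keys_diff[of f g] is_subring_diff[OF B] by (simp add: hcoord_def lookup_minus) blast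
  have "Poly_Mapping.keys t \<subseteq> {..m}" if t: "t \<in> Poly_Mapping.keys (f * g)" for t
  proof -
    obtain p q where "t = p + q" "p \<in> Poly_Mapping.keys f" "q \<in> Poly_Mapping.keys g"
      using keys_mult[of f g] t by blast
    then have "Poly_Mapping.keys p \<subseteq> {..m}" "Poly_Mapping.keys q \<subseteq> {..m}" "Poly_Mapping.keys t \<subseteq> Poly_Mapping.keys p \<union> Poly_Mapping.keys q"
      using fg Poly_Mapping.keys_add[of p q] by (auto simp: hcoord_def)
    then show ?thesis by blast
  qed
  moreover have "Poly_Mapping.lookup (f * g) t \<in> B" for t
    unfolding lookup_mult_finite using fg
    by (intro is_subring_sum[OF B]) (auto simp: hcoord_def intro: is_subring_mult[OF B])
  ultimately show "f * g \<in> hcoord m B" by (simp add: hcoord_def)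
qed

lemma keys_hcomp: "Poly_Mapping.keys (hcomp d f) \<subseteq> Poly_Mapping.keys f"
  by (auto simp: in_keys_iff lookup_hcomp split: if_splits)

lemma hcomp_hcoord: "is_subring B \<Longrightarrow> f \<in> hcoord m B \<Longrightarrow> hcomp d f \<in> hcoord m B"
  using keys_hcomp[of d f] is_subring_zero[of B] by (simp add: hcoord_def lookup_hcomp) blast

lemma single_hcoord:
  "is_subring B \<Longrightarrow> c \<in> B \<Longrightarrow> Poly_Mapping.keys t \<subseteq> {..m} \<Longrightarrow> Poly_Mapping.single t c \<in> hcoord m B"
  by (simp add: hcoord_def lookup_single when_def is_subring_zero)

subsection \<open>Ideals of subrings\<close>

text \<open>Negation is multiplication by minus one, so closure under sums and multiples, with zero,
  already gives an additive subgroup.\<close>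

lemma (in cring) ideal_iff:
  "ideal I R \<longleftrightarrow> I \<subseteq> carrier R \<and> \<zero> \<in> I \<and> (\<forall>x\<in>I. \<forall>y\<in>I. x \<oplus> y \<in> I) \<and> (\<forall>x\<in>I. \<forall>a\<in>carrier R. x \<otimes> a \<in> I)"
  (is "_ \<longleftrightarrow> ?R")
proof
  assume "ideal I R"
  then interpret ideal I R .
  show ?R using I_r_closed a_subset by auto
next
  assume R: ?R
  have neg: "\<ominus> x \<in> I" if "x \<in> I" for x
  proof -
    have "x \<otimes> (\<ominus> \<one>) \<in> I" using R that by blast
    moreover have "x \<in> carrier R" using R that by blast
    ultimately show ?thesis by (simp add: r_minus)
  qed
  show "ideal I R"
  proof (rule idealI)
    show "ring R" by (rule ring_axioms)
    show "subgroup I (add_monoid R)"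
      using R neg by unfold_locales (auto simp: a_inv_def[symmetric])
    fix a x assume "a \<in> I" "x \<in> carrier R"
    then show "x \<otimes> a \<in> I" "a \<otimes> x \<in> I" using R m_comm by (metis subsetD)+
  qed
qed

lemma (in cring) primeideal_iff:
  "primeideal I R \<longleftrightarrow> ideal I R \<and> \<one> \<notin> I \<and>
     (\<forall>x\<in>carrier R. \<forall>y\<in>carrier R. x \<otimes> y \<in> I \<longrightarrow> x \<in> I \<or> y \<in> I)"
proof
  assume "primeideal I R"
  then interpret primeideal I R .
  show "ideal I R \<and> \<one> \<notin> I \<and> (\<forall>x\<in>carrier R. \<forall>y\<in>carrier R. x \<otimes> y \<in> I \<longrightarrow> x \<in> I \<or> y \<in> I)"
    using I_notcarr one_imp_carrier I_prime is_ideal by auto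
next
  assume *: "ideal I R \<and> \<one> \<notin> I \<and> (\<forall>x\<in>carrier R. \<forall>y\<in>carrier R. x \<otimes> y \<in> I \<longrightarrow> x \<in> I \<or> y \<in> I)"
  then show "primeideal I R"
    using cring_axioms by (intro primeidealI) auto
qed

lemma cring_sub_type_algebra:
  assumes "is_subring S"
  shows "cring (sub ring_of_type_algebra S)"
proof -
  interpret cring "ring_of_type_algebra :: 'a ring" by (rule cring_from_type_algebra)
  have "subcring S ring_of_type_algebra"
  proof (rule subcringI')
    have um: "\<ominus>\<^bsub>ring_of_type_algebra\<^esub> x = - x" for x :: 'a
      by (rule minus_equality) (auto simp: ring_of_type_algebra_def)
    show "subring S ring_of_type_algebra"
      by (rule subringI) (auto simp: um, auto simp: ring_of_type_algebra_def is_subring_one[OF assms]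
        is_subring_uminus[OF assms] is_subring_mult[OF assms] is_subring_add[OF assms])
  qed
  then show ?thesis using subcring_iff[of S] by (simp add: ring_of_type_algebra_def)
qed

lemma ideal_sub_type_algebra_iff:
  fixes S :: "'a::comm_ring_1 set"
  assumes "is_subring S"
  shows "ideal p (sub ring_of_type_algebra S) \<longleftrightarrow> p \<subseteq> S \<and> 0 \<in> p \<and> (\<forall>x\<in>p. \<forall>y\<in>p. x + y \<in> p) \<and>
     (\<forall>x\<in>p. \<forall>a\<in>S. x * a \<in> p)"
  using cring.ideal_iff[OF cring_sub_type_algebra[OF assms], of p]
  by (simp add: ring_of_type_algebra_def)

lemma primeideal_sub_type_algebra_iff:
  fixes S :: "'a::comm_ring_1 set"
  assumes "is_subring S"
  shows "primeideal p (sub ring_of_type_algebra S) \<longleftrightarrow> ideal p (sub ring_of_type_algebra S) \<and>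
     1 \<notin> p \<and> (\<forall>x\<in>S. \<forall>y\<in>S. x * y \<in> p \<longrightarrow> x \<in> p \<or> y \<in> p)"
  using cring.primeideal_iff[OF cring_sub_type_algebra[OF assms], of p]
  by (simp add: ring_of_type_algebra_def)

text \<open>A graded ideal is prime as soon as it is prime on homogeneous elements: compare the components
  of least degree outside the ideal.\<close>

lemma Proj_memI:
  fixes B :: "'k::field set"
  assumes B: "is_subring B"
    and zero: "\<And>d. Q d 0"
    and add: "\<And>d f g. f \<in> hcoord m B \<Longrightarrow> g \<in> hcoord m B \<Longrightarrow> homog d f \<Longrightarrow> homog d g \<Longrightarrow> Q d f \<Longrightarrow> Q d g \<Longrightarrow> Q d (f + g)"
    and mult: "\<And>d e f g. f \<in> hcoord m B \<Longrightarrow> g \<in> hcoord m B \<Longrightarrow> homog d f \<Longrightarrow> homog e g \<Longrightarrow> Q d f \<Longrightarrow> Q (d + e) (f * g)"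
    and prime: "\<And>d e f g. f \<in> hcoord m B \<Longrightarrow> g \<in> hcoord m B \<Longrightarrow> homog d f \<Longrightarrow> homog e g \<Longrightarrow> Q (d + e) (f * g) \<Longrightarrow> Q d f \<or> Q e g"
    and a: "a \<in> hcoord m B" "homog e a" "0 < e" "\<not> Q e a"
  shows "{f \<in> hcoord m B. \<forall>d. Q d (hcomp d f)} \<in> Proj m B" (is "?p \<in> _")
proof -
  let ?S = "hcoord m B"
  note S = is_subring_hcoord[OF B, of m]
  have H: "hcomp d f \<in> ?S" if "f \<in> ?S" for d f using that hcomp_hcoord[OF B] by blast
  have sum: "Q d (sum h I)" if "\<And>i. i \<in> I \<Longrightarrow> h i \<in> ?S" "\<And>i. i \<in> I \<Longrightarrow> homog d (h i)" "\<And>i. i \<in> I \<Longrightarrow> Q d (h i)" for d h and I :: "nat set"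
  proof -
    have "sum h I \<in> ?S \<and> homog d (sum h I) \<and> Q d (sum h I)"
      using that
      by (induction I rule: infinite_finite_induct)
        (auto simp: zero is_subring_zero[OF S] intro: add homog_add is_subring_add[OF S])
    then show ?thesis by blast
  qed
  have one: "1 \<notin> ?p"
  proof
    assume "1 \<in> ?p"
    then have "Q 0 1" by (auto simp: hcomp_homog[OF homog_one] split: if_splits)
    then have "Q (0 + e) (1 * a)" using a is_subring_one[OF S] by (intro mult) auto
    with a show False by simp
  qed
  have ideal: "ideal ?p (sub ring_of_type_algebra ?S)"
    unfolding ideal_sub_type_algebra_iff[OF S]
  proof (intro conjI ballI)
    show "?p \<subseteq> ?S" "0 \<in> ?p" by (auto simp: zero is_subring_zero[OF S])
    fix x assume x: "x \<in> ?p"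
    show "x + y \<in> ?p" if "y \<in> ?p" for y
      using x that by (auto simp: hcomp_add is_subring_add[OF S] intro!: add H)
    show "x * y \<in> ?p" if y: "y \<in> ?S" for y
    proof -
      have "Q d (hcomp d (x * y))" for d
        unfolding hcomp_mult
      proof (rule sum)
        fix i assume "i \<in> {..d}"
        then have i: "i + (d - i) = d" by simp
        show "hcomp i x * hcomp (d - i) y \<in> ?S" using x y by (auto intro!: is_subring_mult[OF S] H)
        show "homog d (hcomp i x * hcomp (d - i) y)" "Q d (hcomp i x * hcomp (d - i) y)"
          using homog_mult[of i "hcomp i x" "d - i" "hcomp (d - i) y"] mult[of "hcomp i x" "hcomp (d - i) y" i "d - i"] x y i
          by (auto simp: H)
      qed
      then show ?thesis using x y is_subring_mult[OF S] by auto
    qed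
  qed
  have prime': "f \<in> ?p \<or> g \<in> ?p" if f: "f \<in> ?S" and g: "g \<in> ?S" and fg: "f * g \<in> ?p" for f g
  proof (rule ccontr)
    assume n: "\<not> (f \<in> ?p \<or> g \<in> ?p)"
    define i where "i = (LEAST d. \<not> Q d (hcomp d f))"
    define j where "j = (LEAST d. \<not> Q d (hcomp d g))"
    have ex: "\<exists>d. \<not> Q d (hcomp d f)" "\<exists>d. \<not> Q d (hcomp d g)" using n f g by simp_all
    have i: "\<not> Q i (hcomp i f)" unfolding i_def by (rule LeastI_ex[OF ex(1)])
    have j: "\<not> Q j (hcomp j g)" unfolding j_def by (rule LeastI_ex[OF ex(2)])
    have li: "Q d (hcomp d f)" if "d < i" for d using not_less_Least[of d "\<lambda>d. \<not> Q d (hcomp d f)"] that by (auto simp: i_def)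
    have lj: "Q d (hcomp d g)" if "d < j" for d using not_less_Least[of d "\<lambda>d. \<not> Q d (hcomp d g)"] that by (auto simp: j_def)
    let ?h = "\<lambda>k. hcomp k f * hcomp (i + j - k) g"
    have hS: "?h k \<in> ?S" for k using f g by (auto intro!: is_subring_mult[OF S] H)
    have hh: "homog (i + j) (?h k)" if "k \<le> i + j" for k
      using homog_mult[of k "hcomp k f" "i + j - k" "hcomp (i + j - k) g"] that by simp
    \<comment> \<open>All other products in degree i + j have a factor of degree below
      \<open>i\<close> or below \<open>j\<close>, so they lie in the ideal by minimality;
      subtracting them isolates the product of the two chosen components.\<close>
    let ?r = "\<Sum>k\<in>{..i + j} - {i}. ?h k"
    have Qh: "Q (i + j) (?h k)" if "k \<in> {..i + j} - {i}" for k
    proof (cases "k < i")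
      case True
      then show ?thesis using mult[of "hcomp k f" "hcomp (i + j - k) g" k "i + j - k"] li that f g by (auto simp: H)
    next
      case False
      then have "i + j - k < j" using that by auto
      then show ?thesis
        using mult[of "hcomp (i + j - k) g" "hcomp k f" "i + j - k" k] lj that f g by (auto simp: H mult.commute)
    qed
    have Qr: "Q (i + j) ?r" using Qh hS hh by (intro sum) auto
    have Sr: "?r \<in> ?S" by (rule is_subring_sum[OF S]) (rule hS)
    have hr: "homog (i + j) ?r"
      by (rule homog_sum) (use hh in auto)
    have eq: "hcomp (i + j) (f * g) = hcomp i f * hcomp j g + ?r"
      unfolding hcomp_mult by (subst sum.remove[of _ i]) auto
    \<comment> \<open>\<open>Q\<close> is not assumed closed under negation; the degree 0 element -1
      together with \<open>mult\<close> provides it.\<close>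
    have "- ?r = ?r * (- 1)" by simp
    moreover have "Q (i + j + 0) (?r * (- 1))"
      using Sr hr Qr is_subring_uminus[OF S is_subring_one[OF S]] homog_diff[of 0 0 1] by (intro mult) auto
    ultimately have "Q (i + j) (- ?r)" by simp
    then have "Q (i + j) (hcomp (i + j) (f * g) + (- ?r))"
      using fg Sr hr homog_diff[of "i + j" 0 ?r] is_subring_uminus[OF S]
      by (intro add H) auto
    then have "Q (i + j) (hcomp i f * hcomp j g)" by (simp add: eq)
    with prime[of "hcomp i f" "hcomp j g" i j] i j f g show False by (auto simp: H)
  qed
  \<comment> \<open>The form \<open>a\<close> of positive degree shows that the irrelevant ideal is
    not contained in the prime.\<close>
  have "a \<in> {f \<in> ?S. hcomp 0 f = 0}" "a \<notin> ?p" using a by (auto simp: hcomp_homog)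
  moreover have "hcomp d f \<in> ?p" if "f \<in> ?p" for d f
    using that by (auto simp: H hcomp_homog[OF homog_hcomp] zero)
  ultimately show ?thesis
    unfolding Proj_def primeideal_sub_type_algebra_iff[OF S] using ideal one prime' by blast
qed

lemma ProjD:
  fixes B :: "'k::field set"
  assumes B: "is_subring B" and p: "p \<in> Proj m B"
  shows "p \<subseteq> hcoord m B" "0 \<in> p" "1 \<notin> p"
    "\<And>x y. x \<in> p \<Longrightarrow> y \<in> p \<Longrightarrow> x + y \<in> p"
    "\<And>x s. x \<in> p \<Longrightarrow> s \<in> hcoord m B \<Longrightarrow> x * s \<in> p" "\<And>x s. x \<in> p \<Longrightarrow> s \<in> hcoord m B \<Longrightarrow> s * x \<in> p"
    "\<And>x y. x \<in> hcoord m B \<Longrightarrow> y \<in> hcoord m B \<Longrightarrow> x * y \<in> p \<Longrightarrow> x \<in> p \<or> y \<in> p"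
    "\<And>x d. x \<in> p \<Longrightarrow> hcomp d x \<in> p"
proof -
  note S = is_subring_hcoord[OF B, of m]
  have P: "primeideal p (sub ring_of_type_algebra (hcoord m B))" and h: "\<forall>f\<in>p. \<forall>d. hcomp d f \<in> p"
    using p by (simp_all add: Proj_def)
  note P = P[unfolded primeideal_sub_type_algebra_iff[OF S] ideal_sub_type_algebra_iff[OF S]]
  show "p \<subseteq> hcoord m B" "0 \<in> p" "1 \<notin> p" using P by simp_all
  show "x + y \<in> p" if "x \<in> p" "y \<in> p" for x y using P that by simp
  show *: "x * s \<in> p" if "x \<in> p" "s \<in> hcoord m B" for x s using P that by simp
  show "s * x \<in> p" if "x \<in> p" "s \<in> hcoord m B" for x s using *[OF that] by (simp add: mult.commute)
  show "x \<in> p \<or> y \<in> p" if "x \<in> hcoord m B" "y \<in> hcoord m B" "x * y \<in> p" for x y using P that by simp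
  show "hcomp d x \<in> p" if "x \<in> p" for x d using h that by simp
qed

text \<open>A graded prime contains the homogeneous components of its elements, and each element is
  the finite sum of its components.\<close>

lemma Proj_subsetI:
  assumes B: "is_subring B" and p: "p \<in> Proj m B" and q: "q \<in> Proj m B"
    and le: "\<And>d f. f \<in> p \<Longrightarrow> homog d f \<Longrightarrow> f \<in> q"
  shows "p \<subseteq> q"
proof
  fix f assume f: "f \<in> p"
  have sum: "sum g I \<in> q" if "\<And>i. i \<in> I \<Longrightarrow> g i \<in> q" for g and I :: "nat set"
    using that by (induction I rule: infinite_finite_induct) (auto intro: ProjD[OF B q])
  have "(\<Sum>d\<in>mdeg ` Poly_Mapping.keys f. hcomp d f) \<in> q"
    by (rule sum, rule le[OF ProjD(8)[OF B p f] homog_hcomp])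
  then show "f \<in> q" by (simp only: sum_hcomp[symmetric])
qed

subsection \<open>Evaluation\<close>

lemma meval_superset:
  assumes "finite T" "Poly_Mapping.keys f \<subseteq> T"
  shows "meval u f = (\<Sum>t\<in>T. Poly_Mapping.single 0 (Poly_Mapping.lookup f t) * (\<Prod>i\<in>Poly_Mapping.keys t. u i ^ Poly_Mapping.lookup t i))"
  unfolding meval_def using assms by (intro sum.mono_neutral_left) (auto simp: in_keys_iff)

lemma meval_zero [simp]: "meval u 0 = 0"
  by (simp add: meval_def)

lemma meval_add: "meval u (f + g) = meval u f + meval u g"
proof -
  let ?T = "Poly_Mapping.keys f \<union> Poly_Mapping.keys g"
  have "Poly_Mapping.keys (f + g) \<subseteq> ?T" by (rule Poly_Mapping.keys_add)
  then show ?thesis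
    by (simp add: meval_superset[of ?T] lookup_add single_add distrib_right sum.distrib)
qed

lemma meval_sum: "meval u (sum f I) = (\<Sum>i\<in>I. meval u (f i))"
  by (induction I rule: infinite_finite_induct) (auto simp: meval_add)

lemma meval_single: "meval u (Poly_Mapping.single t c) = Poly_Mapping.single 0 c * (\<Prod>i\<in>Poly_Mapping.keys t. u i ^ Poly_Mapping.lookup t i)"
  by (cases "c = 0") (simp_all add: meval_def)

lemma meval_one [simp]: "meval u 1 = 1"
  using meval_single[of u 0 1] by simp

lemma prod_power_keys_add:
  fixes u :: "nat \<Rightarrow> 'a::comm_semiring_1"
  shows "(\<Prod>i\<in>Poly_Mapping.keys (s + t). u i ^ Poly_Mapping.lookup (s + t) i) =
    (\<Prod>i\<in>Poly_Mapping.keys s. u i ^ Poly_Mapping.lookup s i) * (\<Prod>i\<in>Poly_Mapping.keys t. u i ^ Poly_Mapping.lookup t i)"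
proof -
  let ?K = "Poly_Mapping.keys s \<union> Poly_Mapping.keys t"
  have ext: "(\<Prod>i\<in>Poly_Mapping.keys r. u i ^ Poly_Mapping.lookup r i) = (\<Prod>i\<in>?K. u i ^ Poly_Mapping.lookup r i)"
    if "Poly_Mapping.keys r \<subseteq> ?K" for r
    using that by (intro prod.mono_neutral_left) (auto simp: in_keys_iff)
  have K: "Poly_Mapping.keys (s + t) \<subseteq> ?K" "Poly_Mapping.keys s \<subseteq> ?K" "Poly_Mapping.keys t \<subseteq> ?K"
    using Poly_Mapping.keys_add[of s t] by auto
  show ?thesis
    unfolding ext[OF K(1)] ext[OF K(2)] ext[OF K(3)] by (simp only: lookup_add power_add prod.distrib)
qed

lemma meval_mult: "meval u (f * g) = meval u f * meval u g"
proof -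
  let ?s = "\<lambda>f t. Poly_Mapping.single t (Poly_Mapping.lookup f t)"
  have single: "meval u (Poly_Mapping.single s a * Poly_Mapping.single t b) =
      meval u (Poly_Mapping.single s a) * meval u (Poly_Mapping.single t b)" for s t a b
  proof -
    have "Poly_Mapping.single 0 (a * b) = Poly_Mapping.single 0 a * Poly_Mapping.single 0 b"
      by (simp add: mult_single)
    note e = this
    show ?thesis by (simp only: mult_single[of s a t b] e meval_single prod_power_keys_add ac_simps)
  qed
  have "f * g = (\<Sum>s\<in>Poly_Mapping.keys f. \<Sum>t\<in>Poly_Mapping.keys g. ?s f s * ?s g t)"
    by (subst sum_product[symmetric]) (simp only: poly_mapping_sum_single[symmetric])
  then have "meval u (f * g) = (\<Sum>s\<in>Poly_Mapping.keys f. \<Sum>t\<in>Poly_Mapping.keys g. meval u (?s f s) * meval u (?s g t))"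
    by (simp only: meval_sum single)
  also have "\<dots> = meval u (\<Sum>s\<in>Poly_Mapping.keys f. ?s f s) * meval u (\<Sum>t\<in>Poly_Mapping.keys g. ?s g t)"
    by (simp only: meval_sum sum_product)
  finally show ?thesis by (simp only: poly_mapping_sum_single[symmetric])
qed

section \<open>Integral closed subschemes of projective space\<close>

lemma topspace_zariski: "c \<in> A \<Longrightarrow> (\<And>p. p \<in> P \<Longrightarrow> c \<notin> p) \<Longrightarrow> topspace (zariski A P) = P"
  unfolding zariski_def topology_generated_by_topspace by auto

lemma openin_zariski_basic: "f \<in> A \<Longrightarrow> openin (zariski A P) {p \<in> P. f \<notin> p}"
  unfolding zariski_def by (rule topology_generated_by_Basis) blast

text \<open>Basic open sets are stable under passing to smaller primes, and unions and finite
  intersections keep this. Only functions from \<open>A\<close> define basic sets, hence the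
  intersection with \<open>A\<close>.\<close>

lemma openin_zariski_generization:
  assumes "openin (zariski A P) U" "p \<in> U" "q \<in> P" "q \<inter> A \<subseteq> p"
  shows "q \<in> U"
proof -
  have "generate_topology_on {{p \<in> P. f \<notin> p} | f. f \<in> A} U"
    using assms(1) unfolding zariski_def openin_topology_generated_by_iff .
  then show ?thesis using assms(2)
  proof (induction rule: generate_topology_on.induct)
    case (Basis s)
    then show ?case using assms(3,4) by auto
  qed auto
qed

lemma zariski_closure_of_singleton:
  assumes top: "topspace (zariski A P) = P" and x: "x \<in> P"
  shows "zariski A P closure_of {x} = {y \<in> P. x \<inter> A \<subseteq> y}"
proof (intro equalityI subsetI)
  fix y assume y: "y \<in> zariski A P closure_of {x}"
  then have "y \<in> P" using closure_of_subset_topspace top by fastforce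
  moreover have "x \<inter> A \<subseteq> y"
  proof (rule subsetI, rule ccontr)
    fix f assume f: "f \<in> x \<inter> A" "f \<notin> y"
    have "x \<in> T" if "y \<in> T" "openin (zariski A P) T" for T
      using y that by (simp add: in_closure_of)
    from this[OF _ openin_zariski_basic] f \<open>y \<in> P\<close> show False by auto
  qed
  ultimately show "y \<in> {y \<in> P. x \<inter> A \<subseteq> y}" by simp
next
  fix y assume "y \<in> {y \<in> P. x \<inter> A \<subseteq> y}"
  then show "y \<in> zariski A P closure_of {x}"
    using openin_zariski_generization[of A P _ y x] x top by (simp add: in_closure_of)
qed

text \<open>The prime \<open>\<eta>\<close> is the generic point of an integral closed subscheme. An element of its function
  field is written \<open>q a s\<close>, the class of the quotient a / s of homogeneous polynomials of the same degree.\<close>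

locale homog_prime =
  fixes m :: nat and B :: "'k::field set" and \<eta> :: "'k mpoly set"
  assumes B: "is_subring B" and eta: "\<eta> \<in> Proj m B"
begin

lemma is_subring_coords: "is_subring (hcoord m B)"
  using is_subring_hcoord[OF B] .

lemma topspace_Proj: "topspace (zariski (hcoord m B) (Proj m B)) = Proj m B"
  using is_subring_one[OF is_subring_coords] ProjD(3)[OF B] by (rule topspace_zariski)

lemma closure_of_Proj:
  "p \<in> Proj m B \<Longrightarrow> zariski (hcoord m B) (Proj m B) closure_of {p} = {q \<in> Proj m B. p \<subseteq> q}"
  using zariski_closure_of_singleton[OF topspace_Proj] ProjD(1)[OF B] by (auto simp: Int_absorb2)

text \<open>Uniqueness: if two primes have the same closure, each lies in the closure of the other,
  so they contain each other.\<close>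

lemma generic_point_closure:
  "generic_point (projective_space m B) {q \<in> Proj m B. \<eta> \<subseteq> q} = \<eta>"
  unfolding generic_point_def projective_space_def ischeme.simps
proof (rule the_equality)
  show "\<eta> \<in> topspace (zariski (hcoord m B) (Proj m B)) \<and>
      zariski (hcoord m B) (Proj m B) closure_of {\<eta>} = {q \<in> Proj m B. \<eta> \<subseteq> q}"
    using eta closure_of_Proj[OF eta] topspace_Proj by simp
  fix x assume "x \<in> topspace (zariski (hcoord m B) (Proj m B)) \<and>
      zariski (hcoord m B) (Proj m B) closure_of {x} = {q \<in> Proj m B. \<eta> \<subseteq> q}"
  then have "x \<in> Proj m B" "{q \<in> Proj m B. x \<subseteq> q} = {q \<in> Proj m B. \<eta> \<subseteq> q}"
    using topspace_Proj closure_of_Proj by auto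
  then show "x = \<eta>" using eta by blast
qed

abbreviation hpair :: "nat \<Rightarrow> 'k mpoly \<Rightarrow> 'k mpoly \<Rightarrow> bool" where
  "hpair d a s \<equiv> a \<in> hcoord m B \<and> s \<in> hcoord m B \<and> homog d a \<and> homog d s"

lemma hfrac_iff: "x \<in> hfrac m B p \<longleftrightarrow> (\<exists>d a s. hpair d a s \<and> s \<notin> p \<and> x = Fract a s)"
  unfolding hfrac_def by blast

lemma hpair_add: "hpair d a s \<Longrightarrow> hpair e b t \<Longrightarrow> hpair (d + e) (a * t + b * s) (s * t)"
  using homog_mult[of d a e t] homog_mult[of e b d s] homog_mult[of d s e t]
  by (simp add: is_subring_add[OF is_subring_coords] is_subring_mult[OF is_subring_coords] homog_add add.commute)

lemma hpair_diff: "hpair d a s \<Longrightarrow> hpair e b t \<Longrightarrow> hpair (d + e) (a * t - b * s) (s * t)"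
  using homog_mult[of d a e t] homog_mult[of e b d s] homog_mult[of d s e t]
  by (simp add: is_subring_diff[OF is_subring_coords] is_subring_mult[OF is_subring_coords] homog_diff add.commute)

lemma hpair_mult: "hpair d a s \<Longrightarrow> hpair e b t \<Longrightarrow> hpair (d + e) (a * b) (s * t)"
  using homog_mult[of d a e b] homog_mult[of d s e t]
  by (simp add: is_subring_mult[OF is_subring_coords])

lemma hpair_one: "hpair 0 1 1"
  by (simp add: is_subring_one[OF is_subring_coords])

lemma hpair_zero: "hpair 0 0 1"
  by (simp add: is_subring_one[OF is_subring_coords] is_subring_zero[OF is_subring_coords])

lemma not_mem_mult: "p \<in> Proj m B \<Longrightarrow> hpair d a s \<Longrightarrow> hpair e b t \<Longrightarrow> s \<notin> p \<Longrightarrow> t \<notin> p \<Longrightarrow> s * t \<notin> p"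
  using ProjD(7)[OF B, of p m s t] by blast

lemma not_mem_nonzero: "p \<in> Proj m B \<Longrightarrow> s \<notin> p \<Longrightarrow> s \<noteq> 0"
  using ProjD(2)[OF B] by blast

lemma is_subring_hfrac:
  assumes p: "p \<in> Proj m B" shows "is_subring (hfrac m B p)"
  unfolding is_subring_def
proof (intro conjI ballI)
  show "1 \<in> hfrac m B p"
    unfolding hfrac_iff using hpair_one ProjD(3)[OF B p] One_fract_def by metis
  fix x y assume "x \<in> hfrac m B p" "y \<in> hfrac m B p"
  then obtain d a s e b t where x: "hpair d a s" "s \<notin> p" "x = Fract a s" and y: "hpair e b t" "t \<notin> p" "y = Fract b t"
    unfolding hfrac_iff by blast
  have "x - y = Fract (a * t - b * s) (s * t)" "x * y = Fract (a * b) (s * t)"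
    using x y not_mem_nonzero[OF p] by simp_all
  then show "x - y \<in> hfrac m B p" "x * y \<in> hfrac m B p"
    unfolding hfrac_iff using hpair_diff[OF x(1) y(1)] hpair_mult[OF x(1) y(1)] not_mem_mult[OF p x(1) y(1) x(2) y(2)]
    by blast+
qed

section \<open>The function field of an integral closed subscheme\<close>

abbreviation lring :: "'k mpoly fract ring" where
  "lring \<equiv> sub ring_of_type_algebra (hfrac m B \<eta>)"

abbreviation lmax :: "'k mpoly fract set" where
  "lmax \<equiv> nonunits (ffield (projective_space m B)) (hfrac m B \<eta>)"

abbreviation ff :: "'k mpoly fract set ring" where
  "ff \<equiv> lring Quot lmax"

definition q :: "'k mpoly \<Rightarrow> 'k mpoly \<Rightarrow> 'k mpoly fract set" where
  "q a s = lmax +>\<^bsub>lring\<^esub> Fract a s"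

text \<open>If a is outside the prime, the swapped fraction is an inverse. If a is inside, an
  inverse b / t would give a * b = s * t, a product of two elements outside the prime.\<close>

lemma Fract_mem_lmax_iff:
  assumes "hpair d a s" "s \<notin> \<eta>" shows "Fract a s \<in> lmax \<longleftrightarrow> a \<in> \<eta>"
proof -
  have U: "Fract a s \<in> lmax \<longleftrightarrow> \<not> (\<exists>y\<in>hfrac m B \<eta>. Fract a s * y = 1)"
  proof -
    have "Fract a s \<in> hfrac m B \<eta>" unfolding hfrac_iff using assms by blast
    then show ?thesis
      by (auto simp: nonunits_def Units_def projective_space_def ring_of_type_algebra_def mult.commute)
  qed
  have s0: "s \<noteq> 0" using not_mem_nonzero[OF eta assms(2)] .
  show ?thesis
  proof
    assume l: "Fract a s \<in> lmax"
    show "a \<in> \<eta>"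
    proof (rule ccontr)
      assume a: "a \<notin> \<eta>"
      then have "Fract s a \<in> hfrac m B \<eta>" unfolding hfrac_iff using assms by blast
      moreover have "Fract a s * Fract s a = 1"
        using s0 not_mem_nonzero[OF eta a] by (simp add: One_fract_def eq_fract)
      ultimately show False using l U by blast
    qed
  next
    assume a: "a \<in> \<eta>"
    have False if "y \<in> hfrac m B \<eta>" "Fract a s * y = 1" for y
    proof -
      obtain e b t where y: "hpair e b t" "t \<notin> \<eta>" "y = Fract b t" using \<open>y \<in> _\<close> unfolding hfrac_iff by blast
      then have "a * b = s * t" using that(2) s0 not_mem_nonzero[OF eta y(2)]
        by (simp add: One_fract_def eq_fract)
      moreover have "a * b \<in> \<eta>" using a y by (intro ProjD(5)[OF B eta]) auto
      ultimately show False using not_mem_mult[OF eta assms(1) y(1) assms(2) y(2)] by simp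
    qed
    then show "Fract a s \<in> lmax" using U by blast
  qed
qed

lemma lmax_subset: "lmax \<subseteq> hfrac m B \<eta>"
  by (auto simp: nonunits_def)

lemma cring_lring: "cring lring"
  by (rule cring_sub_type_algebra[OF is_subring_hfrac[OF eta]])

lemma ideal_lmax: "ideal lmax lring"
  unfolding ideal_sub_type_algebra_iff[OF is_subring_hfrac[OF eta]]
proof (intro conjI ballI)
  show "lmax \<subseteq> hfrac m B \<eta>" by (rule lmax_subset)
  show "0 \<in> lmax"
    using Fract_mem_lmax_iff[OF hpair_zero] ProjD(2,3)[OF B eta] by (simp add: Zero_fract_def)
  fix x assume xl: "x \<in> lmax"
  then obtain d a s where x: "hpair d a s" "s \<notin> \<eta>" "x = Fract a s" using lmax_subset hfrac_iff by blast
  then have a: "a \<in> \<eta>" using Fract_mem_lmax_iff xl by blast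
  show "x + y \<in> lmax" if yl: "y \<in> lmax" for y
  proof -
    obtain e b t where y: "hpair e b t" "t \<notin> \<eta>" "y = Fract b t" using yl lmax_subset hfrac_iff by blast
    then have b: "b \<in> \<eta>" using Fract_mem_lmax_iff yl by blast
    have "a * t + b * s \<in> \<eta>" using a b x y by (intro ProjD(4,5)[OF B eta]) auto
    then have "Fract (a * t + b * s) (s * t) \<in> lmax"
      using Fract_mem_lmax_iff[OF hpair_add[OF x(1) y(1)] not_mem_mult[OF eta x(1) y(1) x(2) y(2)]] by blast
    then show ?thesis using x y not_mem_nonzero[OF eta] by simp
  qed
  show "x * y \<in> lmax" if yl: "y \<in> hfrac m B \<eta>" for y
  proof -
    obtain e b t where y: "hpair e b t" "t \<notin> \<eta>" "y = Fract b t" using yl hfrac_iff by blast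
    have "a * b \<in> \<eta>" using a y by (intro ProjD(5)[OF B eta]) auto
    then have "Fract (a * b) (s * t) \<in> lmax"
      using Fract_mem_lmax_iff[OF hpair_mult[OF x(1) y(1)] not_mem_mult[OF eta x(1) y(1) x(2) y(2)]] by blast
    then show ?thesis using x y by simp
  qed
qed

lemma maximalideal_lmax: "maximalideal lmax lring"
proof (rule maximalidealI[OF ideal_lmax])
  have one: "1 \<in> hfrac m B \<eta>" "1 \<notin> lmax"
    using is_subring_one[OF is_subring_hfrac[OF eta]] Fract_mem_lmax_iff[OF hpair_one] ProjD(3)[OF B eta]
    by (auto simp: One_fract_def)
  then show "carrier lring \<noteq> lmax" by auto
  fix J assume J: "ideal J lring" "lmax \<subseteq> J" "J \<subseteq> carrier lring"
  show "J = lmax \<or> J = carrier lring"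
  proof (rule disjCI)
    assume "J \<noteq> carrier lring"
    have "x \<in> lmax" if x: "x \<in> J" for x
    proof (rule ccontr)
      assume "x \<notin> lmax"
      then obtain y where "y \<in> hfrac m B \<eta>" "x * y = 1"
        using x J(3) by (auto simp: nonunits_def Units_def projective_space_def ring_of_type_algebra_def)
      then have "1 \<in> J" using J(1) x unfolding ideal_sub_type_algebra_iff[OF is_subring_hfrac[OF eta]] by metis
      then have "y * 1 \<in> J" if "y \<in> hfrac m B \<eta>" for y
        using J(1) that unfolding ideal_sub_type_algebra_iff[OF is_subring_hfrac[OF eta]] by (metis mult.commute)
      with J(3) \<open>J \<noteq> _\<close> show False by auto
    qed
    with J(2) show "J = lmax" by blast
  qed
qed

lemma field_ff: "field ff"
  by (rule maximalideal.quotient_is_field[OF maximalideal_lmax cring_lring])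

sublocale ff: field ff
  by (rule field_ff)

lemma res_hom: "(+>\<^bsub>lring\<^esub>) lmax \<in> Ring.ring_hom lring ff"
  by (rule ideal.rcos_ring_hom[OF ideal_lmax])

lemma Fract_mem: "hpair d a s \<Longrightarrow> s \<notin> \<eta> \<Longrightarrow> Fract a s \<in> carrier lring"
  using hfrac_iff by auto

lemma q_closed [simp]: "hpair d a s \<Longrightarrow> s \<notin> \<eta> \<Longrightarrow> q a s \<in> carrier ff"
  unfolding q_def using ring_hom_closed[OF res_hom] Fract_mem by blast

lemma q_cases:
  assumes "x \<in> carrier ff" obtains d a s where "hpair d a s" "s \<notin> \<eta>" "x = q a s"
proof -
  obtain f where "f \<in> hfrac m B \<eta>" "x = lmax +>\<^bsub>lring\<^esub> f"
    using assms by (auto simp: FactRing_def A_RCOSETS_def')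
  then show ?thesis using that unfolding hfrac_iff q_def by blast
qed

lemma q_add:
  assumes "hpair d a s" "s \<notin> \<eta>" "hpair e b t" "t \<notin> \<eta>"
  shows "q a s \<oplus>\<^bsub>ff\<^esub> q b t = q (a * t + b * s) (s * t)"
  using ring_hom_add[OF res_hom Fract_mem[OF assms(1,2)] Fract_mem[OF assms(3,4)]]
    not_mem_nonzero[OF eta] assms
  by (simp add: q_def ring_of_type_algebra_def)

lemma q_mult:
  assumes "hpair d a s" "s \<notin> \<eta>" "hpair e b t" "t \<notin> \<eta>"
  shows "q a s \<otimes>\<^bsub>ff\<^esub> q b t = q (a * b) (s * t)"
  using ring_hom_mult[OF res_hom Fract_mem[OF assms(1,2)] Fract_mem[OF assms(3,4)]]
  by (simp add: q_def ring_of_type_algebra_def)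

lemma q_one: "q 1 1 = \<one>\<^bsub>ff\<^esub>"
  using ring_hom_one[OF res_hom] by (simp add: q_def ring_of_type_algebra_def One_fract_def)

text \<open>Two cosets agree when the difference of the fractions is a nonunit. With this criterion,
  cross-multiplication modulo \<open>\<eta>\<close>, later computations need not mention
  cosets.\<close>

lemma q_eq_iff:
  assumes "hpair d a s" "s \<notin> \<eta>" "hpair e b t" "t \<notin> \<eta>"
  shows "q a s = q b t \<longleftrightarrow> a * t - b * s \<in> \<eta>"
proof -
  interpret L: cring lring by (rule cring_lring)
  have um: "\<ominus>\<^bsub>lring\<^esub> x = - x" if "x \<in> hfrac m B \<eta>" for x
    using that is_subring_uminus[OF is_subring_hfrac[OF eta]]
    by (intro L.minus_equality) (auto simp: ring_of_type_algebra_def)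
  have m: "Fract b t \<in> hfrac m B \<eta>" using Fract_mem[OF assms(3,4)] by simp
  have "q a s = q b t \<longleftrightarrow> Fract a s \<ominus>\<^bsub>lring\<^esub> Fract b t \<in> lmax"
    unfolding q_def using L.quotient_eq_iff_same_a_r_cos[OF ideal_lmax Fract_mem[OF assms(1,2)] Fract_mem[OF assms(3,4)]]
    by blast
  also have "Fract a s \<ominus>\<^bsub>lring\<^esub> Fract b t = Fract a s - Fract b t"
    unfolding a_minus_def um[OF m] by (simp add: ring_of_type_algebra_def)
  also have "\<dots> = Fract (a * t - b * s) (s * t)"
    using assms not_mem_nonzero[OF eta] by simp
  also have "\<dots> \<in> lmax \<longleftrightarrow> a * t - b * s \<in> \<eta>"
    by (rule Fract_mem_lmax_iff[OF hpair_diff[OF assms(1,3)] not_mem_mult[OF eta assms(1,3,2,4)]])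
  finally show ?thesis .
qed

lemma q_zero: "q 0 1 = \<zero>\<^bsub>ff\<^esub>"
proof -
  have n: "1 \<notin> \<eta>" using ProjD(3)[OF B eta] .
  have "q 0 1 \<oplus>\<^bsub>ff\<^esub> q 0 1 = q 0 1"
    using q_add[OF hpair_zero n hpair_zero n] by simp
  moreover have "q 0 1 \<in> carrier ff" using hpair_zero n by (rule q_closed)
  ultimately show ?thesis using ff.add.r_cancel_one[of "q 0 1" "q 0 1"] by simp
qed

lemma q_eq_zero_iff:
  assumes "hpair d a s" "s \<notin> \<eta>"
  shows "q a s = \<zero>\<^bsub>ff\<^esub> \<longleftrightarrow> a \<in> \<eta>"
  using q_eq_iff[OF assms hpair_zero ProjD(3)[OF B eta]] by (simp add: q_zero)

lemma q_inv:
  assumes "hpair d a s" "s \<notin> \<eta>" "a \<notin> \<eta>"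
  shows "inv\<^bsub>ff\<^esub> q a s = q s a"
proof -
  have sa: "hpair d s a" using assms by simp
  have 1: "q a s \<otimes>\<^bsub>ff\<^esub> q s a = \<one>\<^bsub>ff\<^esub>"
    using q_mult[OF assms(1,2) sa assms(3)] q_eq_iff[OF hpair_mult[OF assms(1) sa] not_mem_mult[OF eta assms(1) sa assms(2,3)]
        hpair_one ProjD(3)[OF B eta]] ProjD(2)[OF B eta]
    by (simp add: q_one mult.commute)
  show ?thesis by (rule ff.comm_inv_char[OF q_closed[OF assms(1,2)] q_closed[OF sa assms(3)] 1])
qed

section \<open>The reduced closed subscheme and its local rings\<close>

definition yscheme :: "('k mpoly set, 'k mpoly fract set, 'k) ischeme" where
  "yscheme = reduced_closed (projective_space m B) {p \<in> Proj m B. \<eta> \<subseteq> p}"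

lemma yscheme_simps:
  "pts yscheme = subtopology (zariski (hcoord m B) (Proj m B)) {p \<in> Proj m B. \<eta> \<subseteq> p}"
  "ffield yscheme = ff"
  "scal yscheme c = q (Poly_Mapping.single 0 c) 1"
  by (simp_all add: yscheme_def reduced_closed_def Let_def generic_point_closure)
    (simp_all add: projective_space_def q_def)

lemma stalk_yscheme:
  "stalk yscheme p = {q a s | a s. (\<exists>d. hpair d a s) \<and> s \<notin> p}"
proof -
  have "stalk yscheme p = (\<lambda>a. lmax +>\<^bsub>lring\<^esub> a) ` hfrac m B p"
    by (simp add: yscheme_def reduced_closed_def Let_def generic_point_closure)
      (simp add: projective_space_def)
  also have "\<dots> = {q a s | a s. (\<exists>d. hpair d a s) \<and> s \<notin> p}"
    unfolding image_def Bex_def hfrac_iff q_def by blast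
  finally show ?thesis .
qed

lemma topspace_yscheme: "topspace (pts yscheme) = {p \<in> Proj m B. \<eta> \<subseteq> p}"
  by (auto simp: yscheme_simps topspace_Proj)

lemma nonunits_stalk_iff:
  assumes p: "p \<in> Proj m B" "\<eta> \<subseteq> p" and h: "hpair d a s" "s \<notin> p"
  shows "q a s \<in> nonunits ff (stalk yscheme p) \<longleftrightarrow> a \<in> p"
proof -
  have s: "s \<notin> \<eta>" using p(2) h(2) by blast
  have mem: "q a s \<in> stalk yscheme p" unfolding stalk_yscheme using h by blast
  have U: "q a s \<in> nonunits ff (stalk yscheme p) \<longleftrightarrow> \<not> (\<exists>y\<in>stalk yscheme p. q a s \<otimes>\<^bsub>ff\<^esub> y = \<one>\<^bsub>ff\<^esub>)"
  proof -
    have "y \<in> carrier ff" if "y \<in> stalk yscheme p" for y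
      using that p(2) unfolding stalk_yscheme by (auto intro: q_closed)
    then show ?thesis using mem ff.m_comm[OF q_closed[OF h(1) s]]
      by (auto simp: nonunits_def Units_def)
  qed
  show ?thesis
  proof
    assume l: "q a s \<in> nonunits ff (stalk yscheme p)"
    show "a \<in> p"
    proof (rule ccontr)
      assume a: "a \<notin> p"
      then have a': "a \<notin> \<eta>" using p(2) by blast
      have "q s a \<in> stalk yscheme p" unfolding stalk_yscheme using a h by blast
      moreover have "q a s \<noteq> \<zero>\<^bsub>ff\<^esub>" using q_eq_zero_iff[OF h(1) s] a' by simp
      then have "q a s \<in> Units ff" using q_closed[OF h(1) s] ff.field_Units by blast
      then have "q a s \<otimes>\<^bsub>ff\<^esub> q s a = \<one>\<^bsub>ff\<^esub>"
        using q_inv[OF h(1) s a'] by (metis ff.Units_r_inv)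
      ultimately show False using l U by blast
    qed
  next
    assume a: "a \<in> p"
    have False if y: "y \<in> stalk yscheme p" "q a s \<otimes>\<^bsub>ff\<^esub> y = \<one>\<^bsub>ff\<^esub>" for y
    proof -
      obtain e b t where bt: "hpair e b t" "t \<notin> p" "y = q b t" using y(1) unfolding stalk_yscheme by blast
      then have t: "t \<notin> \<eta>" using p(2) by blast
      have "q (a * b) (s * t) = q 1 1" using y(2) q_mult[OF h(1) s bt(1) t] bt(3) q_one by simp
      \<comment> \<open>The equation holds only modulo \<open>\<eta>\<close>, but
        \<open>\<eta>\<close> lies in p and so does a * b; hence s * t would be in p.\<close>
      then have "a * b - s * t \<in> \<eta>"
        using q_eq_iff[OF hpair_mult[OF h(1) bt(1)] not_mem_mult[OF eta h(1) bt(1) s t] hpair_one ProjD(3)[OF B eta]] by simp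
      then have "a * b - s * t \<in> p" using p(2) by blast
      then have 1: "(a * b - s * t) * (- 1) \<in> p"
        using ProjD(5)[OF B p(1)] is_subring_uminus[OF is_subring_coords is_subring_one[OF is_subring_coords]] by blast
      have "a * b \<in> p" using a bt by (intro ProjD(5)[OF B p(1)]) auto
      from ProjD(4)[OF B p(1) 1 this] have "s * t \<in> p" by simp
      then show False using not_mem_mult[OF p(1) h(1) bt(1) h(2) bt(2)] by simp
    qed
    then show "q a s \<in> nonunits ff (stalk yscheme p)" using U by blast
  qed
qed

end

section \<open>Affine charts\<close>

text \<open>Zorn's lemma for the ideals that contain \<open>D\<close> and avoid one; a maximal such
  ideal is a maximal ideal, hence prime.\<close>

lemma (in cring) exists_primeideal:
  assumes D: "ideal D R" "\<one> \<notin> D"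
  obtains P where "primeideal P R" "D \<subseteq> P"
proof -
  define IS where "IS = {I. ideal I R \<and> \<one> \<notin> I \<and> D \<subseteq> I}"
  have AD: "I \<in> IS \<longleftrightarrow> ideal I R \<and> \<one> \<notin> I \<and> D \<subseteq> I" for I by (simp add: IS_def)
  have "\<exists>M\<in>IS. \<forall>J\<in>IS. M \<subseteq> J \<longrightarrow> J = M"
  proof (rule subset_Zorn_nonempty)
    have "D \<in> IS" using D AD by simp
    then show "IS \<noteq> {}" by blast
    fix C assume C: "C \<noteq> {}" "subset.chain IS C"
    then have sub: "C \<subseteq> IS" and tot: "\<And>I J. I \<in> C \<Longrightarrow> J \<in> C \<Longrightarrow> I \<subseteq> J \<or> J \<subseteq> I"
      by (auto simp: subset.chain_def)
    have id: "ideal I R" if "I \<in> C" for I using sub that AD by blast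
    note id = id[unfolded ideal_iff]
    obtain I0 where I0: "I0 \<in> C" using C(1) by blast
    have "ideal (\<Union>C) R"
      unfolding ideal_iff
    proof (intro conjI ballI)
      show "\<Union>C \<subseteq> carrier R" using id by (intro Union_least) simp
      show "\<zero> \<in> \<Union>C" using id[OF I0] I0 by (intro UnionI[of I0]) simp_all
      fix x assume "x \<in> \<Union>C"
      then obtain I where I: "I \<in> C" "x \<in> I" by blast
      show "x \<oplus> y \<in> \<Union>C" if y: "y \<in> \<Union>C" for y
      proof -
        obtain J where J: "J \<in> C" "y \<in> J" using y by blast
        obtain K where K: "K \<in> C" "x \<in> K" "y \<in> K" using tot[OF I(1) J(1)] I J by blast
        then show ?thesis using id[OF K(1)] by (intro UnionI[of K]) simp_all
      qed
      show "x \<otimes> a \<in> \<Union>C" if a: "a \<in> carrier R" for a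
        using I id[OF I(1)] a by (intro UnionI[of I]) simp_all
    qed
    moreover have "\<one> \<notin> \<Union>C" "D \<subseteq> \<Union>C" using sub AD I0 by blast+
    ultimately show "\<Union>C \<in> IS" using AD by blast
  qed
  then obtain M where MI: "M \<in> IS" and max': "\<And>J. J \<in> IS \<Longrightarrow> M \<subseteq> J \<Longrightarrow> J = M"
    by blast
  have M: "ideal M R" "\<one> \<notin> M" "D \<subseteq> M" using MI AD by simp_all
  have max: "J = M" if "ideal J R" "\<one> \<notin> J" "M \<subseteq> J" for J
    using max' that AD M(3) by simp
  have "maximalideal M R"
  proof (rule maximalidealI[OF M(1)])
    show "carrier R \<noteq> M" using M(2) by auto
    fix J assume J: "ideal J R" "M \<subseteq> J" "J \<subseteq> carrier R"
    show "J = M \<or> J = carrier R"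
      using M(3) max[OF J(1) _ J(2)] ideal.one_imp_carrier[OF J(1)] by blast
  qed
  from maximalideal_prime[OF this] M(3) that show ?thesis by blast
qed

lemma (in cring) cring_sub:
  assumes "A \<subseteq> carrier R" "\<one> \<in> A" "\<And>x. x \<in> A \<Longrightarrow> \<ominus> x \<in> A"
    "\<And>x y. x \<in> A \<Longrightarrow> y \<in> A \<Longrightarrow> x \<oplus> y \<in> A" "\<And>x y. x \<in> A \<Longrightarrow> y \<in> A \<Longrightarrow> x \<otimes> y \<in> A"
  shows "cring (R\<lparr>carrier := A\<rparr>)"
proof -
  have "subring A R" by (rule subringI) (use assms in auto)
  then show ?thesis using subcringI' subcring_iff assms(1) by blast
qed

locale chart = homog_prime +
  fixes x
  assumes x: "x \<in> hcoord m B" "homog 1 x" "x \<notin> \<eta>"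
begin

lemma xpow: "x ^ d \<in> hcoord m B" "homog d (x ^ d)"
  using is_subring_power[OF is_subring_coords x(1)] homog_power[OF x(2), of d] by simp_all

lemma xpow_notin: "p \<in> Proj m B \<Longrightarrow> x \<notin> p \<Longrightarrow> x ^ d \<notin> p"
proof (induction d)
  case 0
  then show ?case using ProjD(3)[OF B] by simp
next
  case (Suc d)
  then show ?case using ProjD(7)[OF B _ x(1) xpow(1)[of d]] by auto
qed

abbreviation hmem :: "nat \<Rightarrow> 'a mpoly \<Rightarrow> bool" where
  "hmem d a \<equiv> a \<in> hcoord m B \<and> homog d a"

text \<open>Dehomogenization of a form a of degree d. The degree is an argument because the zero
  polynomial is homogeneous of every degree.\<close>

definition psi :: "nat \<Rightarrow> 'a mpoly \<Rightarrow> 'a mpoly fract set" where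
  "psi d a = q a (x ^ d)"

lemma hpx: "hmem d a \<Longrightarrow> hpair d a (x ^ d)"
  using xpow by simp

lemma xne: "x ^ d \<notin> \<eta>"
  using xpow_notin[OF eta x(3)] .

lemma psi_closed: "hmem d a \<Longrightarrow> psi d a \<in> carrier ff"
  unfolding psi_def using q_closed[OF hpx xne] by blast

lemma psi_mult: "hmem d a \<Longrightarrow> hmem e b \<Longrightarrow> psi d a \<otimes>\<^bsub>ff\<^esub> psi e b = psi (d + e) (a * b)"
  unfolding psi_def power_add using q_mult[OF hpx xne hpx xne] by blast

lemma psi_add: 
  assumes "hmem d a" "hmem d b"
  shows "psi d a \<oplus>\<^bsub>ff\<^esub> psi d b = psi d (a + b)"
proof -
  have h: "hmem d (a + b)" using assms homog_add is_subring_add[OF is_subring_coords] by blast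
  have "q (a * x ^ d + b * x ^ d) (x ^ d * x ^ d) = q (a + b) (x ^ d)"
    using q_eq_iff[OF hpair_add[OF hpx hpx] not_mem_mult[OF eta hpx hpx xne xne] hpx[OF h] xne] assms ProjD(2)[OF B eta]
    by (simp add: algebra_simps)
  then show ?thesis
    unfolding psi_def using q_add[OF hpx[OF assms(1)] xne hpx[OF assms(2)] xne] by simp
qed

lemma psi_one: "psi 0 1 = \<one>\<^bsub>ff\<^esub>"
  by (simp add: psi_def q_one)

lemma hmem_one: "hmem 0 1"
  by (simp add: is_subring_one[OF is_subring_coords])

lemma hmem_zero: "hmem d 0"
  by (simp add: is_subring_zero[OF is_subring_coords])

lemma hmem_x: "hmem 1 x"
  using x by simp

lemma hmem_xpow: "hmem k (x ^ k)"
  using xpow by simp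

lemma hmem_mult: "hmem d a \<Longrightarrow> hmem e b \<Longrightarrow> hmem (d + e) (a * b)"
  by (simp add: homog_mult is_subring_mult[OF is_subring_coords])

lemma hmem_add: "hmem d a \<Longrightarrow> hmem d b \<Longrightarrow> hmem d (a + b)"
  by (simp add: homog_add is_subring_add[OF is_subring_coords])

lemma hmem_uminus: "hmem d a \<Longrightarrow> hmem d (- a)"
  using homog_diff[of d 0 a] by (simp add: is_subring_uminus[OF is_subring_coords])

lemma hmem_hcomp: "f \<in> hcoord m B \<Longrightarrow> hmem d (hcomp d f)"
  by (simp add: hcomp_hcoord[OF B])

lemma psi_xpow: "psi k (x ^ k) = \<one>\<^bsub>ff\<^esub>"
  using q_eq_iff[OF hpx[OF hmem_xpow] xne hpair_one ProjD(3)[OF B eta]] ProjD(2)[OF B eta]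
  by (simp add: psi_def q_one)

lemma psi_eq_zero_iff: "hmem d a \<Longrightarrow> psi d a = \<zero>\<^bsub>ff\<^esub> \<longleftrightarrow> a \<in> \<eta>"
  unfolding psi_def using q_eq_zero_iff[OF hpx xne] by blast

lemma psi_lift: "hmem d a \<Longrightarrow> psi d a = psi (d + k) (a * x ^ k)"
proof -
  assume a: "hmem d a"
  show ?thesis using psi_mult[OF a hmem_xpow[of k]] psi_closed[OF a] by (simp add: psi_xpow)
qed

lemma psi_uminus: "hmem d a \<Longrightarrow> \<ominus>\<^bsub>ff\<^esub> psi d a = psi d (- a)"
proof -
  assume a: "hmem d a"
  note a' = hmem_uminus[OF a]
  have "psi d (- a) \<oplus>\<^bsub>ff\<^esub> psi d a = \<zero>\<^bsub>ff\<^esub>"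
    using psi_add[OF a' a] psi_eq_zero_iff[OF hmem_zero] ProjD(2)[OF B eta] by simp
  then show ?thesis by (rule ff.minus_equality[OF _ psi_closed[OF a] psi_closed[OF a']])
qed

text \<open>Both numerator and denominator are divided by x^d, so every element of the function
  field is a quotient of two functions on the chart.\<close>

lemma q_eq_psi:
  assumes "hpair d a s" "s \<notin> \<eta>" shows "q a s = psi d a \<otimes>\<^bsub>ff\<^esub> inv\<^bsub>ff\<^esub> psi d s"
proof -
  have a: "hpair d a (x ^ d)" and s: "hpair d s (x ^ d)" and s': "hpair d (x ^ d) s"
    using assms xpow by auto
  have "psi d a \<otimes>\<^bsub>ff\<^esub> inv\<^bsub>ff\<^esub> psi d s = q (a * x ^ d) (x ^ d * s)"
    unfolding psi_def q_inv[OF s xne assms(2)] by (rule q_mult[OF a xne s' assms(2)])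
  also have "\<dots> = q a s"
    using q_eq_iff[OF hpair_mult[OF a s'] not_mem_mult[OF eta a s' xne assms(2)] assms] ProjD(2)[OF B eta]
    by (simp add: algebra_simps)
  finally show ?thesis ..
qed

definition A :: "'a mpoly fract set set" where
  "A = {psi d a | d a. hmem d a}"

lemma A_cases: "g \<in> A \<Longrightarrow> (\<And>d a. hmem d a \<Longrightarrow> g = psi d a \<Longrightarrow> P) \<Longrightarrow> P"
  unfolding A_def by blast

lemma psi_mem_A: "hmem d a \<Longrightarrow> psi d a \<in> A"
  unfolding A_def by blast

lemma A_subset: "A \<subseteq> carrier ff"
  using psi_closed by (auto elim: A_cases)

text \<open>Multiplication by powers of \<open>x\<close> leaves the function unchanged
  (\<open>psi_lift\<close>), so addition in the chart ring reduces to addition of forms of one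
  degree.\<close>

lemma A_common_degree:
  assumes "g \<in> A" "h \<in> A"
  obtains d a b where "hmem d a" "hmem d b" "g = psi d a" "h = psi d b"
proof -
  obtain d a where g: "hmem d a" "g = psi d a" using assms(1) by (rule A_cases)
  obtain e b where h: "hmem e b" "h = psi e b" using assms(2) by (rule A_cases)
  show ?thesis
  proof (rule that)
    show "hmem (d + e) (a * x ^ e)" by (rule hmem_mult[OF g(1) hmem_xpow])
    show "hmem (d + e) (b * x ^ d)" unfolding add.commute[of d e] by (rule hmem_mult[OF h(1) hmem_xpow])
    show "g = psi (d + e) (a * x ^ e)" unfolding g(2) by (rule psi_lift[OF g(1)])
    show "h = psi (d + e) (b * x ^ d)" unfolding h(2) add.commute[of d e] by (rule psi_lift[OF h(1)])
  qed
qed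

lemma A_add: "g \<in> A \<Longrightarrow> h \<in> A \<Longrightarrow> g \<oplus>\<^bsub>ff\<^esub> h \<in> A"
proof -
  assume "g \<in> A" "h \<in> A"
  then obtain d a b where "hmem d a" "hmem d b" and gh: "g = psi d a" "h = psi d b"
    by (rule A_common_degree)
  from psi_add[OF this(1,2)] psi_mem_A[OF hmem_add[OF this(1,2)]] show ?thesis by (simp add: gh)
qed

lemma A_mult: "g \<in> A \<Longrightarrow> h \<in> A \<Longrightarrow> g \<otimes>\<^bsub>ff\<^esub> h \<in> A"
proof -
  assume "g \<in> A" "h \<in> A"
  then obtain d a e b where g: "hmem d a" "g = psi d a" and h: "hmem e b" "h = psi e b"
    by (meson A_cases)
  show ?thesis using psi_mult[OF g(1) h(1)] psi_mem_A[OF hmem_mult[OF g(1) h(1)]] g h by simp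
qed

lemma A_one: "\<one>\<^bsub>ff\<^esub> \<in> A"
  using psi_mem_A[OF hmem_one] by (simp add: psi_one)

lemma A_zero: "\<zero>\<^bsub>ff\<^esub> \<in> A"
  using psi_mem_A[OF hmem_zero[of 0]] psi_eq_zero_iff[OF hmem_zero[of 0]] ProjD(2)[OF B eta] by simp

lemma A_uminus: "g \<in> A \<Longrightarrow> \<ominus>\<^bsub>ff\<^esub> g \<in> A"
proof -
  assume "g \<in> A"
  then obtain d a where a: "hmem d a" "g = psi d a" by (rule A_cases)
  show ?thesis unfolding a(2) psi_uminus[OF a(1)] by (rule psi_mem_A[OF hmem_uminus[OF a(1)]])
qed

lemma cring_A: "cring (sub ff A)"
  by (rule ff.cring_sub[OF A_subset A_one A_uminus A_add A_mult])

lemma ideal_A_iff: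
  "ideal I (sub ff A) \<longleftrightarrow> I \<subseteq> A \<and> \<zero>\<^bsub>ff\<^esub> \<in> I \<and> (\<forall>x\<in>I. \<forall>y\<in>I. x \<oplus>\<^bsub>ff\<^esub> y \<in> I) \<and>
    (\<forall>x\<in>I. \<forall>a\<in>A. x \<otimes>\<^bsub>ff\<^esub> a \<in> I)"
  using cring.ideal_iff[OF cring_A, of I] by simp

lemma primeideal_A_iff:
  "primeideal I (sub ff A) \<longleftrightarrow> ideal I (sub ff A) \<and> \<one>\<^bsub>ff\<^esub> \<notin> I \<and>
    (\<forall>x\<in>A. \<forall>y\<in>A. x \<otimes>\<^bsub>ff\<^esub> y \<in> I \<longrightarrow> x \<in> I \<or> y \<in> I)"
  using cring.primeideal_iff[OF cring_A, of I] by simp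

section \<open>The chart as the spectrum of its ring of sections\<close>

definition U :: "'a mpoly set set" where
  "U = {p \<in> Proj m B. \<eta> \<subseteq> p \<and> x \<notin> p}"

text \<open>The inverse of the canonical map \<open>point_ideal\<close>: the graded prime whose
  forms dehomogenize into \<open>P\<close>.\<close>

definition homogenize :: "'a mpoly fract set set \<Rightarrow> 'a mpoly set" where
  "homogenize P = {f \<in> hcoord m B. \<forall>d. psi d (hcomp d f) \<in> P}"

text \<open>Dehomogenization respects sums in a fixed degree and products, so primality of
  \<open>P\<close> passes to forms and \<open>Proj_memI\<close> applies. The form \<open>x\<close>
  stays outside because it dehomogenizes to 1.\<close>

lemma
  assumes P: "P \<in> Spec (sub ff A)"
  shows homogenize_U: "homogenize P \<in> U"
    and mem_homogenize: "hmem d a \<Longrightarrow> a \<in> homogenize P \<longleftrightarrow> psi d a \<in> P"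
proof -
  have pr: "primeideal P (sub ff A)" using P by (simp add: Spec_def)
  then have "ideal P (sub ff A)" unfolding primeideal_A_iff by blast
  note I = this[unfolded ideal_A_iff]
  have one: "\<one>\<^bsub>ff\<^esub> \<notin> P" using pr unfolding primeideal_A_iff by blast
  have prime: "g \<in> P \<or> h \<in> P" if "g \<in> A" "h \<in> A" "g \<otimes>\<^bsub>ff\<^esub> h \<in> P" for g h
    using pr that unfolding primeideal_A_iff by blast
  have zero: "psi d a \<in> P" if "hmem d a" "a \<in> \<eta>" for d a
    using psi_eq_zero_iff[OF that(1)] that(2) I by simp
  have mem: "a \<in> homogenize P \<longleftrightarrow> psi d a \<in> P" if a: "hmem d a" for d a
    using a zero[OF hmem_zero ProjD(2)[OF B eta]] unfolding homogenize_def
    by (auto simp: hcomp_homog[of d a])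
  then show "hmem d a \<Longrightarrow> a \<in> homogenize P \<longleftrightarrow> psi d a \<in> P" .
  have x1: "psi 1 x \<notin> P" using psi_xpow[of 1] one by simp
  have "homogenize P \<in> Proj m B"
    unfolding homogenize_def
  proof (rule Proj_memI[OF B, where Q = "\<lambda>d f. psi d f \<in> P" and a = x and e = 1])
    show "psi d 0 \<in> P" for d using zero[OF hmem_zero ProjD(2)[OF B eta]] .
    show "psi d (f + g) \<in> P" if "f \<in> hcoord m B" "g \<in> hcoord m B" "homog d f" "homog d g" "psi d f \<in> P" "psi d g \<in> P" for d f g
    proof -
      have "psi d f \<oplus>\<^bsub>ff\<^esub> psi d g \<in> P" using that I by simp
      then show ?thesis using psi_add[of f d g] that by simp
    qed
    show "psi (d + e) (f * g) \<in> P" if "f \<in> hcoord m B" "g \<in> hcoord m B" "homog d f" "homog e g" "psi d f \<in> P" for d e f g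
    proof -
      have "psi d f \<otimes>\<^bsub>ff\<^esub> psi e g \<in> P" using that psi_mem_A[of g e] I by simp
      then show ?thesis using psi_mult[of f d g e] that by simp
    qed
    show "psi d f \<in> P \<or> psi e g \<in> P" if "f \<in> hcoord m B" "g \<in> hcoord m B" "homog d f" "homog e g" "psi (d + e) (f * g) \<in> P" for d e f g
      using psi_mult[of f d g e] that by (intro prime psi_mem_A) simp_all
  qed (use x x1 in auto)
  moreover have "\<eta> \<subseteq> homogenize P"
    unfolding homogenize_def using zero[OF hmem_hcomp] ProjD(1)[OF B eta] ProjD(8)[OF B eta] by (simp add: subset_iff)
  moreover have "x \<notin> homogenize P" using mem[OF hmem_x] x1 by blast
  ultimately show "homogenize P \<in> U" unfolding U_def by blast
qed

lemma U_D: "p \<in> U \<Longrightarrow> p \<in> Proj m B" "p \<in> U \<Longrightarrow> \<eta> \<subseteq> p" "p \<in> U \<Longrightarrow> x ^ d \<notin> p"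
  by (simp_all add: U_def xpow_notin)

text \<open>For a section s, consider the ideal \<open>D\<close> of denominators b with b * s in
  \<open>A\<close>. If it were proper, it would lie in a prime P; but near the point of P the
  section is a fraction whose denominator belongs to \<open>D\<close> and not to P.\<close>

lemma sections_U: "sections yscheme U = A"
proof (intro equalityI subsetI)
  fix g assume "g \<in> A"
  then obtain d a where g: "hmem d a" "g = psi d a" by (rule A_cases)
  then have "g \<in> stalk yscheme p" if "p \<in> U" for p
    unfolding stalk_yscheme using hpx[OF g(1)] U_D(3)[OF that] psi_def by blast
  then show "g \<in> sections yscheme U"
    using \<open>g \<in> A\<close> A_subset by (auto simp: sections_def yscheme_simps)
next
  fix s assume "s \<in> sections yscheme U"
  then have sc: "s \<in> carrier ff" and s: "\<And>p. p \<in> U \<Longrightarrow> s \<in> stalk yscheme p"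
    by (auto simp: sections_def yscheme_simps)
  define D where "D = {b \<in> A. b \<otimes>\<^bsub>ff\<^esub> s \<in> A}"
  have idD: "ideal D (sub ff A)"
    unfolding ideal_A_iff
  proof (intro conjI ballI)
    show "D \<subseteq> A" "\<zero>\<^bsub>ff\<^esub> \<in> D" using A_zero sc by (auto simp: D_def)
    fix b assume b: "b \<in> D"
    have bc: "b \<in> carrier ff" using b A_subset by (auto simp: D_def)
    show "b \<oplus>\<^bsub>ff\<^esub> c \<in> D" if "c \<in> D" for c
    proof -
      have "c \<in> carrier ff" using that A_subset by (auto simp: D_def)
      then show ?thesis using b that bc sc A_add by (auto simp: D_def ff.l_distr)
    qed
    show "b \<otimes>\<^bsub>ff\<^esub> c \<in> D" if "c \<in> A" for c
    proof -
      have cc: "c \<in> carrier ff" using that A_subset by auto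
      have "b \<otimes>\<^bsub>ff\<^esub> c \<otimes>\<^bsub>ff\<^esub> s = (b \<otimes>\<^bsub>ff\<^esub> s) \<otimes>\<^bsub>ff\<^esub> c"
        using bc cc sc by (simp add: ff.m_ac)
      then show ?thesis using b that A_mult by (simp add: D_def)
    qed
  qed
  have "\<one>\<^bsub>ff\<^esub> \<in> D"
  proof (rule ccontr)
    assume "\<one>\<^bsub>ff\<^esub> \<notin> D"
    then obtain P where P: "primeideal P (sub ff A)" "D \<subseteq> P"
      using cring.exists_primeideal[OF cring_A idD] by auto
    then have Sp: "P \<in> Spec (sub ff A)" by (simp add: Spec_def)
    note pU = homogenize_U[OF Sp]
    obtain d a t where t: "hpair d a t" "t \<notin> homogenize P" "s = q a t"
      using s[OF pU] unfolding stalk_yscheme by blast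
    have tn: "t \<notin> \<eta>" using t(2) U_D(2)[OF pU] by blast
    have th: "hmem d t" and ah: "hmem d a" using t(1) by auto
    have tx: "hpair d t (x ^ d)" using hpx[OF th] .
    have "psi d t \<in> Units ff"
      using psi_closed[OF th] psi_eq_zero_iff[OF th] tn by (simp add: ff.field_Units)
    then have "psi d t \<otimes>\<^bsub>ff\<^esub> s = psi d a"
      unfolding t(3) q_eq_psi[OF t(1) tn] using psi_closed[OF th] psi_closed[OF ah]
      by (metis ff.Units_inv_closed ff.Units_r_inv ff.m_lcomm ff.r_one)
    then have "psi d t \<in> D" using psi_mem_A[OF th] psi_mem_A[OF ah] by (simp add: D_def)
    then have "psi d t \<in> P" using P(2) by blast
    then show False using mem_homogenize[OF Sp th] t(2) by blast
  qed
  then show "s \<in> A" using sc by (simp add: D_def)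
qed

lemma mem_point_ideal_iff:
  assumes "p \<in> U" "hmem d a"
  shows "psi d a \<in> point_ideal yscheme A p \<longleftrightarrow> a \<in> p"
  using nonunits_stalk_iff[OF U_D(1,2) hpx U_D(3), OF assms(1,1,2,1)] psi_mem_A[OF assms(2)]
  by (simp add: point_ideal_def yscheme_simps psi_def)

lemma point_ideal_subset: "point_ideal yscheme A p \<subseteq> A"
  by (auto simp: point_ideal_def)

lemma point_ideal_Spec:
  assumes p: "p \<in> U" shows "point_ideal yscheme A p \<in> Spec (sub ff A)"
proof -
  let ?I = "point_ideal yscheme A p"
  note pP = U_D(1)[OF p]
  note iff = mem_point_ideal_iff[OF p]
  have "ideal ?I (sub ff A)"
    unfolding ideal_A_iff
  proof (intro conjI ballI)
    show "?I \<subseteq> A" by (rule point_ideal_subset)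
    have "psi 0 0 = \<zero>\<^bsub>ff\<^esub>" using psi_eq_zero_iff[OF hmem_zero] ProjD(2)[OF B eta] by blast
    then show "\<zero>\<^bsub>ff\<^esub> \<in> ?I" using iff[OF hmem_zero, of 0] ProjD(2)[OF B pP] by simp
    fix g assume g: "g \<in> ?I"
    then obtain d a where a: "hmem d a" "g = psi d a" using point_ideal_subset by (blast elim: A_cases)
    then have ap: "a \<in> p" using g iff by blast
    show "g \<oplus>\<^bsub>ff\<^esub> h \<in> ?I" if h: "h \<in> ?I" for h
    proof -
      obtain e b c where hm: "hmem e b" "hmem e c" and lift: "g = psi e b" "h = psi e c"
        by (rule A_common_degree[OF subsetD[OF point_ideal_subset g] subsetD[OF point_ideal_subset h]])
      have "b \<in> p" "c \<in> p" using g h iff[OF hm(1)] iff[OF hm(2)] lift by simp_all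
      then have "b + c \<in> p" by (rule ProjD(4)[OF B pP])
      then show ?thesis using iff[OF hmem_add[OF hm]] lift psi_add[OF hm] by simp
    qed
    show "g \<otimes>\<^bsub>ff\<^esub> h \<in> ?I" if h: "h \<in> A" for h
    proof -
      obtain e b where b: "hmem e b" "h = psi e b" using h by (blast elim: A_cases)
      then have "a * b \<in> p" using ap by (intro ProjD(5)[OF B pP]) auto
      then show ?thesis using iff[OF hmem_mult[OF a(1) b(1)]] psi_mult[OF a(1) b(1)] a b by simp
    qed
  qed
  moreover have "\<one>\<^bsub>ff\<^esub> \<notin> ?I" using iff[OF hmem_one] ProjD(3)[OF B pP] by (simp add: psi_one)
  moreover have "g \<in> ?I \<or> h \<in> ?I" if gh: "g \<in> A" "h \<in> A" "g \<otimes>\<^bsub>ff\<^esub> h \<in> ?I" for g h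
  proof -
    obtain d a where a: "hmem d a" "g = psi d a" using gh(1) by (rule A_cases)
    obtain e b where b: "hmem e b" "h = psi e b" using gh(2) by (rule A_cases)
    have "a * b \<in> p" using gh(3) iff[OF hmem_mult[OF a(1) b(1)]] psi_mult[OF a(1) b(1)] a b by simp
    then show ?thesis using ProjD(7)[OF B pP] a b iff by blast
  qed
  ultimately show ?thesis unfolding Spec_def primeideal_A_iff by blast
qed

lemma homogenize_point_ideal:
  assumes p: "p \<in> U" shows "homogenize (point_ideal yscheme A p) = p"
proof (rule antisym)
  let ?J = "homogenize (point_ideal yscheme A p)"
  note Sp = point_ideal_Spec[OF p]
  have J: "?J \<in> Proj m B" using U_D(1)[OF homogenize_U[OF Sp]] .
  have iff: "a \<in> ?J \<longleftrightarrow> a \<in> p" if "hmem d a" for d a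
    using mem_homogenize[OF Sp that] mem_point_ideal_iff[OF p that] by blast
  show "?J \<subseteq> p" by (rule Proj_subsetI[OF B J U_D(1)[OF p]]) (use iff ProjD(1)[OF B J] in blast)
  show "p \<subseteq> ?J" by (rule Proj_subsetI[OF B U_D(1)[OF p] J]) (use iff ProjD(1)[OF B U_D(1)[OF p]] in blast)
qed

lemma point_ideal_homogenize:
  assumes P: "P \<in> Spec (sub ff A)" shows "point_ideal yscheme A (homogenize P) = P"
proof -
  have "P \<subseteq> A" using P unfolding Spec_def primeideal_A_iff ideal_A_iff by blast
  moreover have "psi d a \<in> point_ideal yscheme A (homogenize P) \<longleftrightarrow> psi d a \<in> P" if "hmem d a" for d a
    using mem_point_ideal_iff[OF homogenize_U[OF P] that] mem_homogenize[OF P that] by blast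
  ultimately show ?thesis using point_ideal_subset by (blast elim: A_cases)
qed

lemma topspace_Spec_A: "topspace (zariski A (Spec (sub ff A))) = Spec (sub ff A)"
  by (rule topspace_zariski[OF A_one]) (auto simp: Spec_def primeideal_A_iff)

lemma openin_U: "openin (pts yscheme) U"
proof -
  have "U = {p \<in> Proj m B. x \<notin> p} \<inter> {p \<in> Proj m B. \<eta> \<subseteq> p}" by (auto simp: U_def)
  then show ?thesis
    unfolding yscheme_simps openin_subtopology using openin_zariski_basic[OF x(1)] by blast
qed

lemma topspace_U: "topspace (subtopology (pts yscheme) U) = U"
  using openin_subset[OF openin_U] by (simp add: Int_absorb1)

lemma openin_Spec_A_basic:
  "g \<in> A \<Longrightarrow> openin (zariski A (Spec (sub ff A))) {P \<in> Spec (sub ff A). g \<notin> P}"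
  by (rule openin_zariski_basic)

lemma continuous_point_ideal:
  "continuous_map (subtopology (pts yscheme) U) (zariski A (Spec (sub ff A))) (point_ideal yscheme A)"
  unfolding zariski_def[of A]
proof (rule continuous_on_generated_topo)
  fix V assume "V \<in> {{P \<in> Spec (sub ff A). g \<notin> P} | g. g \<in> A}"
  then obtain d a where a: "hmem d a" "V = {P \<in> Spec (sub ff A). psi d a \<notin> P}" by (blast elim: A_cases)
  have "point_ideal yscheme A -` V \<inter> U = {p \<in> Proj m B. a \<notin> p} \<inter> {p \<in> Proj m B. \<eta> \<subseteq> p} \<inter> U"
    using mem_point_ideal_iff[OF _ a(1)] point_ideal_Spec U_D(1,2) unfolding a(2) by blast
  moreover have "openin (zariski (hcoord m B) (Proj m B)) {p \<in> Proj m B. a \<notin> p}"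
    using a(1) by (intro openin_zariski_basic) auto
  ultimately show "openin (subtopology (pts yscheme) U) (point_ideal yscheme A -` V \<inter> topspace (subtopology (pts yscheme) U))"
    unfolding topspace_U unfolding yscheme_simps openin_subtopology by blast
next
  have "\<Union>{{P \<in> Spec (sub ff A). g \<notin> P} | g. g \<in> A} = Spec (sub ff A)"
    using topspace_Spec_A unfolding zariski_def topology_generated_by_topspace .
  then show "point_ideal yscheme A ` topspace (subtopology (pts yscheme) U) \<subseteq> \<Union>{{P \<in> Spec (sub ff A). g \<notin> P} | g. g \<in> A}"
    by (simp only: topspace_U image_subset_iff) (simp add: point_ideal_Spec)
qed

lemma continuous_homogenize:
  "continuous_map (zariski A (Spec (sub ff A))) (subtopology (pts yscheme) U) homogenize"
  unfolding yscheme_simps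
proof (intro continuous_map_into_subtopology)
  let ?T = "zariski A (Spec (sub ff A))"
  show "continuous_map ?T (zariski (hcoord m B) (Proj m B)) homogenize"
    unfolding zariski_def[of "hcoord m B"]
  proof (rule continuous_on_generated_topo)
    fix V assume "V \<in> {{p \<in> Proj m B. f \<notin> p} | f. f \<in> hcoord m B}"
    then obtain f where f: "f \<in> hcoord m B" "V = {p \<in> Proj m B. f \<notin> p}" by blast
    have "homogenize P \<in> V \<longleftrightarrow> (\<exists>d. psi d (hcomp d f) \<notin> P)" if "P \<in> Spec (sub ff A)" for P
      using f U_D(1)[OF homogenize_U[OF that]] by (simp add: homogenize_def)
    \<comment> \<open>\<open>f\<close> need not be homogeneous, so its basic open set pulls back to
      a union over the degrees of its components.\<close>
    then have "homogenize -` V \<inter> topspace ?T = (\<Union>d. {P \<in> Spec (sub ff A). psi d (hcomp d f) \<notin> P})"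
      unfolding topspace_Spec_A by blast
    also have "openin ?T \<dots>"
      using psi_mem_A[OF hmem_hcomp[OF f(1)]] by (intro openin_Union) (auto intro: openin_Spec_A_basic)
    finally show "openin ?T (homogenize -` V \<inter> topspace ?T)" .
  next
    have "\<Union>{{p \<in> Proj m B. f \<notin> p} | f. f \<in> hcoord m B} = Proj m B"
      using topspace_Proj unfolding zariski_def topology_generated_by_topspace .
    then show "homogenize ` topspace ?T \<subseteq> \<Union>{{p \<in> Proj m B. f \<notin> p} | f. f \<in> hcoord m B}"
      by (simp only: topspace_Spec_A image_subset_iff) (simp add: homogenize_U U_D(1))
  qed
  show "homogenize \<in> topspace ?T \<rightarrow> {p \<in> Proj m B. \<eta> \<subseteq> p}"
    unfolding topspace_Spec_A Pi_iff using homogenize_U U_D(1,2) by simp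
  show "homogenize \<in> topspace ?T \<rightarrow> U"
    unfolding topspace_Spec_A Pi_iff using homogenize_U by simp
qed

lemma homeomorphic_point_ideal:
  "homeomorphic_map (subtopology (pts yscheme) U) (zariski A (Spec (sub ff A))) (point_ideal yscheme A)"
  unfolding homeomorphic_map_maps homeomorphic_maps_def topspace_U topspace_Spec_A
  by (intro exI[of _ homogenize] conjI ballI continuous_point_ideal continuous_homogenize
    homogenize_point_ideal point_ideal_homogenize)

lemma carrier_ff_eq_loc: "carrier ff = loc ff A {\<zero>\<^bsub>ff\<^esub>}"
proof (intro equalityI subsetI)
  fix y assume "y \<in> carrier ff"
  then obtain d a s where s: "hpair d a s" "s \<notin> \<eta>" "y = q a s" by (rule q_cases)
  have "psi d s \<noteq> \<zero>\<^bsub>ff\<^esub>" using psi_eq_zero_iff[of s d] s by simp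
  then show "y \<in> loc ff A {\<zero>\<^bsub>ff\<^esub>}"
    unfolding loc_def s(3) q_eq_psi[OF s(1,2)] using s(1) psi_mem_A by blast
next
  fix y assume "y \<in> loc ff A {\<zero>\<^bsub>ff\<^esub>}"
  then obtain a s where as: "a \<in> A" "s \<in> A" "s \<noteq> \<zero>\<^bsub>ff\<^esub>" "y = a \<otimes>\<^bsub>ff\<^esub> inv\<^bsub>ff\<^esub> s"
    unfolding loc_def by blast
  have "s \<in> Units ff" using as A_subset by (auto simp: ff.field_Units)
  then show "y \<in> carrier ff" using as A_subset by (auto intro!: ff.m_closed)
qed

lemma stalk_eq_loc:
  assumes p: "p \<in> U" shows "stalk yscheme p = loc ff A (point_ideal yscheme A p)"
proof (intro equalityI subsetI)
  fix y assume "y \<in> stalk yscheme p"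
  then obtain d a s where s: "hpair d a s" "s \<notin> p" "y = q a s" unfolding stalk_yscheme by blast
  have s\<eta>: "s \<notin> \<eta>" using s(2) U_D(2)[OF p] by blast
  have "psi d s \<notin> point_ideal yscheme A p" using mem_point_ideal_iff[OF p] s by simp
  then show "y \<in> loc ff A (point_ideal yscheme A p)"
    unfolding loc_def s(3) q_eq_psi[OF s(1) s\<eta>] using s(1) psi_mem_A by blast
next
  fix y assume "y \<in> loc ff A (point_ideal yscheme A p)"
  then obtain g h where gh: "g \<in> A" "h \<in> A" "h \<notin> point_ideal yscheme A p" "y = g \<otimes>\<^bsub>ff\<^esub> inv\<^bsub>ff\<^esub> h"
    unfolding loc_def by blast
  obtain d a where a: "hmem d a" "g = psi d a" using gh(1) by (rule A_cases)
  obtain e b where b: "hmem e b" "h = psi e b" using gh(2) by (rule A_cases)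
  have bp: "b \<notin> p" using gh(3) b mem_point_ideal_iff[OF p b(1)] by simp
  then have b\<eta>: "b \<notin> \<eta>" using U_D(2)[OF p] by blast
  have b': "hpair e (x ^ e) b" using hpx[OF b(1)] by simp
  have "y = q (a * x ^ e) (x ^ d * b)"
    unfolding gh(4) a(2) b(2) psi_def q_inv[OF hpx[OF b(1)] xne b\<eta>] by (rule q_mult[OF hpx[OF a(1)] xne b' b\<eta>])
  moreover have "x ^ d * b \<notin> p" by (rule not_mem_mult[OF U_D(1)[OF p] hpx[OF a(1)] b' U_D(3)[OF p] bp])
  ultimately show "y \<in> stalk yscheme p"
    unfolding stalk_yscheme using hpair_mult[OF hpx[OF a(1)] b'] by blast
qed

text \<open>Needed because the topology of \<open>normalization\<close> is generated by sets over
  affine open sets: only points over such sets exist in it.\<close>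

theorem affine_open_U: "affine_open yscheme U"
proof -
  have "\<eta> \<in> U" using eta x(3) by (simp add: U_def)
  then show ?thesis
    unfolding affine_open_def Let_def sections_U yscheme_simps(2)
    using openin_U carrier_ff_eq_loc homeomorphic_point_ideal stalk_eq_loc by blast
qed

end

section \<open>The orbit closure\<close>

text \<open>If x had value c < 0, then x^k would have value k * c, strictly below the values of all
  lower terms of its integral equation.\<close>

lemma (in field_valuation) integral_over_nonneg:
  assumes A: "is_subring A" "\<And>a. a \<in> A \<Longrightarrow> 0 \<le> w a" and x: "integral_over A x"
  shows "0 \<le> w x"
proof (rule ccontr)
  assume neg: "\<not> 0 \<le> w x"
  then obtain c where c: "w x = ereal c" "c < 0" using not_minfty[of x] by (cases "w x") auto
  obtain k a where k: "0 < k" and a: "\<And>i. a i \<in> A" and eq: "x ^ k = (\<Sum>i<k. a i * x ^ i)"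
    using integral_over_power_expand[OF A(1) x] by metis
  have "ereal (real k * c) < w (\<Sum>i<k. a i * x ^ i)"
  proof (rule sum_gtI)
    fix i assume "i \<in> {..<k}"
    then have "real k * c < real i * c" using c(2) by simp
    moreover have "ereal (real i * c) \<le> w (a i * x ^ i)"
      using add_mono[OF A(2)[OF a[of i]], of "ereal (real i * c)" "ereal (real i * c)"]
      by (simp add: mult power[OF c(1)])
    ultimately show "ereal (real k * c) < w (a i * x ^ i)" using less_le_trans[of "ereal (real k * c)" "ereal (real i * c)"] by simp
  qed simp
  then show False using eq power[OF c(1), of k] by simp
qed

text \<open>The equation is X^k - x^k; positivity of k keeps the constant term apart from the
  leading one.\<close>

lemma integral_over_root:
  assumes A: "is_subring A" and x: "x ^ k \<in> A" "0 < k"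
  shows "integral_over A x"
proof -
  let ?p = "Polynomial.monom 1 k - [:x ^ k:]"
  have c: "Polynomial.coeff ?p i = (if i = k then 1 else if i = 0 then - (x ^ k) else 0)" for i
    using x(2) by (auto simp: coeff_pCons split: nat.splits)
  have "Polynomial.degree ?p = k"
    by (rule antisym[OF Polynomial.degree_le le_degree]) (auto simp only: c, auto)
  then have "Polynomial.lead_coeff ?p = 1" by (simp only: c) simp
  moreover have "Polynomial.coeff ?p i \<in> A" for i
    unfolding c using is_subring_one[OF A] is_subring_zero[OF A] is_subring_uminus[OF A x(1)] by simp
  moreover have "poly ?p x = 0" by (simp add: poly_monom)
  ultimately show ?thesis unfolding integral_over_def by blast
qed

lemma integral_over_mem:
  assumes A: "is_subring A" and x: "x \<in> A"
  shows "integral_over A x"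
  using integral_over_root[OF A, of x 1] x by simp

text \<open>The lowest coefficient of value 0 in an integral equation becomes a multiple of c modulo the
  ideal of positive elements.\<close>

lemma (in field_valuation) unit_coefficient:
  assumes C: "is_subring C" "A \<subseteq> C" "c \<in> C" and nonneg: "\<And>a. a \<in> A \<Longrightarrow> 0 \<le> w a" and c: "w c = 0"
    and p: "\<And>i. Polynomial.coeff p i \<in> A" "w (Polynomial.coeff p j) = 0" "0 < w (poly p c)"
  shows "\<exists>a\<in>A. \<exists>b\<in>C. w a = 0 \<and> 0 < w (a + c * b)"
  using p
proof (induction p arbitrary: j)
  case 0
  then show ?case by simp
next
  case (pCons a p)
  have aA: "a \<in> A" using pCons.prems(1)[of 0] by simp
  have pA: "Polynomial.coeff p i \<in> A" for i using pCons.prems(1)[of "Suc i"] by simp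
  show ?case
  proof (cases "w a = 0")
    case True
    \<comment> \<open>The polynomial takes the value a + c * poly p c at c, so
      \<open>poly p c\<close> is the witness for b.\<close>
    have "poly p c \<in> C"
      unfolding poly_altdef using pA C
      by (intro is_subring_sum[OF C(1)] is_subring_mult[OF C(1)] is_subring_power[OF C(1)]) auto
    then show ?thesis using aA True pCons.prems(3) by auto
  next
    case False
    then have pos: "0 < w a" using nonneg[OF aA] by simp
    \<comment> \<open>What remains is c * poly p c; since c has value 0, the hypothesis passes to
      \<open>p\<close>.\<close>
    have "0 < w (poly (pCons a p) c - a)" by (rule diff_gtI[OF pCons.prems(3) pos])
    then have "0 < w (poly p c)" using c by (simp add: mult)
    moreover obtain i where "j = Suc i"
      using pCons.prems(2) False by (cases j) auto
    then have "w (Polynomial.coeff p i) = 0" using pCons.prems(2) by simp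
    ultimately show ?thesis using pCons.IH pA by blast
  qed
qed

text \<open>Near a non-isolated element there is another one, and their difference gives an element
  g of the group with 0 < g < \<epsilon>. The largest multiple of g below \<omega> is the required
  s; it differs from \<omega> because \<omega> is outside the group.\<close>

lemma dense_subgroup:
  fixes \<Gamma> :: "real set"
  assumes diff: "\<And>s t. s \<in> \<Gamma> \<Longrightarrow> t \<in> \<Gamma> \<Longrightarrow> s - t \<in> \<Gamma>"
    and nd: "\<not> discrete \<Gamma>" and w: "0 < \<omega>" "\<omega> \<notin> \<Gamma>" and e: "0 < \<epsilon>"
  obtains s where "s \<in> \<Gamma>" "0 \<le> s" "s < \<omega>" "\<omega> - s < \<epsilon>"
proof -
  obtain x where x: "x \<in> \<Gamma>" "\<not> x isolated_in \<Gamma>" using nd by (auto simp: discrete_def)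
  have "ball x (min \<omega> \<epsilon>) \<inter> \<Gamma> \<noteq> {x}" using x w e unfolding isolated_in_def by (metis open_ball)
  moreover have "x \<in> ball x (min \<omega> \<epsilon>)" using w e by simp
  ultimately obtain y where y: "y \<in> \<Gamma>" "y \<noteq> x" "dist x y < min \<omega> \<epsilon>" using x(1) by (auto simp: ball_def)
  define g where "g = \<bar>x - y\<bar>"
  have g: "0 < g" "g < \<omega>" "g < \<epsilon>" using y by (auto simp: g_def dist_real_def)
  have gG: "g \<in> \<Gamma>" using diff x(1) y(1) by (auto simp: g_def abs_if)
  have zero: "0 \<in> \<Gamma>" using diff[OF gG gG] by simp
  have add: "s + g \<in> \<Gamma>" if "s \<in> \<Gamma>" for s using diff[OF that diff[OF zero gG]] by simp
  have mult: "real k * g \<in> \<Gamma>" for k by (induction k) (auto simp: zero distrib_right add add.commute[of g])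
  define k where "k = nat \<lfloor>\<omega> / g\<rfloor>"
  have kk: "real k = of_int \<lfloor>\<omega> / g\<rfloor>" using w g by (simp add: k_def)
  have le: "real k * g \<le> \<omega>" using g(1) by (simp add: kk) (metis floor_divide_lower)
  moreover have "real k * g \<noteq> \<omega>" using mult w(2) by metis
  moreover have "\<omega> < (real k + 1) * g" using g(1) by (simp add: kk) (metis floor_divide_upper)
  ultimately show ?thesis using that[OF mult, of k] g by (simp add: distrib_right)
qed

section \<open>Coordinates of the orbit, its generic point and the center of the valuation\<close>

locale orbit_setting =
  fixes v :: "'k::field \<Rightarrow> ereal" and r n :: nat and \<gamma> :: real and \<pi> :: 'k
  assumes val: "valuation v" and r: "0 < r" and n: "0 < n" and \<gamma>: "0 < \<gamma>" and \<pi>: "v \<pi> = ereal \<gamma>"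
begin

definition weight :: "(nat \<Rightarrow>\<^sub>0 int) \<Rightarrow> real" where
  "weight t = \<gamma> / r * (\<Sum>i\<in>Poly_Mapping.keys t. real_of_int (Poly_Mapping.lookup t i))"

sublocale gauss_valuation v weight
proof -
  interpret domain_valuation v using val by (rule domain_valuation_if_valuation)
  show "gauss_valuation v weight"
  proof
    fix s t
    show "weight (s + t) = weight s + weight t"
      unfolding weight_def distrib_left[symmetric]
      by (subst setsum_keys_plus_distrib[of "\<lambda>_ x. real_of_int x"]) auto
  qed
qed

abbreviation g :: "'k lpoly \<Rightarrow> ereal" where "g \<equiv> gauss v weight"
abbreviation W :: "'k lpoly fract \<Rightarrow> ereal" where "W \<equiv> fract_val g"

abbreviation B :: "'k set" where "B \<equiv> val_ring v"

lemma is_subring_B: "is_subring B"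
  unfolding is_subring_def val_ring_def using v.diff_geI v.mult_nonneg by auto

definition u :: "nat \<Rightarrow> 'k lpoly" where
  "u j = torus_emb r j * Poly_Mapping.single 0 (if j = 0 then \<pi> else 1)"

lemma g_zvar: "g (zvar i) = ereal (\<gamma> / r)"
  by (simp add: zvar_def gauss_single weight_def)

lemma g_u: "g (u j) = ereal (if j = 0 \<or> odd j then \<gamma> else \<gamma> + \<gamma> / r)"
proof -
  have "g (zvar i ^ r) = ereal \<gamma>" for i using gauss.power[OF g_zvar, of i r] r by simp
  moreover have "g (zvar i ^ (r + 1)) = ereal (\<gamma> + \<gamma> / r)" for i
    using gauss.power[OF g_zvar, of i "r + 1"] r by (simp add: distrib_right del: power_Suc)
  ultimately show ?thesis
    by (simp add: u_def torus_emb_def gauss.mult gauss_single \<pi> del: power_Suc)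
qed

abbreviation ev :: "'k mpoly \<Rightarrow> 'k lpoly" where "ev \<equiv> meval u"

lemma ev_uminus: "ev (- f) = - ev f"
  using meval_add[of u f "- f"] by (simp add: eq_neg_iff_add_eq_0 add.commute)

lemma ev_diff: "ev (f - f') = ev f - ev f'"
  using meval_add[of u f "- f'"] by (simp add: ev_uminus)

text \<open>Coefficients from \<open>B\<close> have nonnegative value, and each of the d coordinate
  factors of a monomial contributes at least \<gamma>.\<close>

lemma g_ev_ge:
  assumes f: "f \<in> hcoord (2 * n) B" "homog d f"
  shows "ereal (d * \<gamma>) \<le> g (ev f)"
  unfolding meval_def
proof (rule gauss.sum_geI)
  fix t assume t: "t \<in> Poly_Mapping.keys f"
  \<comment> \<open>Stated for any set \<open>K\<close> of variables to allow induction; for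
    infinite \<open>K\<close> the sum is 0 and the product is 1.\<close>
  have "ereal (real (\<Sum>i\<in>K. Poly_Mapping.lookup t i) * \<gamma>) \<le> g (\<Prod>i\<in>K. u i ^ Poly_Mapping.lookup t i)" for K
  proof (induction K rule: infinite_finite_induct)
    case (insert i K)
    let ?c = "if i = 0 \<or> odd i then \<gamma> else \<gamma> + \<gamma> / r"
    have "ereal (Poly_Mapping.lookup t i * \<gamma>) \<le> g (u i ^ Poly_Mapping.lookup t i)"
      using gauss.power[OF g_u, of i "Poly_Mapping.lookup t i"] \<gamma> by (auto intro: mult_left_mono)
    from add_mono[OF this insert.IH] show ?case
      using insert.hyps by (simp add: gauss.mult distrib_right)
  qed (simp_all add: zero_ereal_def[symmetric])
  from this[of "Poly_Mapping.keys t"] have "ereal (d * \<gamma>) \<le> g (\<Prod>i\<in>Poly_Mapping.keys t. u i ^ Poly_Mapping.lookup t i)"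
    using f(2) t by (simp add: homog_def mdeg_def del: of_nat_sum)
  moreover have "0 \<le> g (Poly_Mapping.single 0 (Poly_Mapping.lookup f t))"
    using f(1) by (simp add: gauss_single hcoord_def val_ring_def)
  ultimately show "ereal (d * \<gamma>) \<le> g (Poly_Mapping.single 0 (Poly_Mapping.lookup f t) * (\<Prod>i\<in>Poly_Mapping.keys t. u i ^ Poly_Mapping.lookup t i))"
    using add_mono[of 0 _ "ereal (d * \<gamma>)"] by (simp add: gauss.mult)
qed

definition var :: "nat \<Rightarrow> 'k mpoly" where
  "var j = Poly_Mapping.single (Poly_Mapping.single j 1) 1"

lemma homog_var: "homog 1 (var j)"
  using homog_single[of "Poly_Mapping.single j 1"] by (simp add: var_def mdeg_def)

lemma var_hcoord: "j \<le> 2 * n \<Longrightarrow> var j \<in> hcoord (2 * n) B"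
  unfolding var_def using is_subring_one[OF is_subring_B] by (intro single_hcoord[OF is_subring_B]) auto

lemma ev_var: "ev (var j) = u j"
  by (simp add: var_def meval_single)

lemma ev_const: "ev (Poly_Mapping.single 0 c) = Poly_Mapping.single 0 c"
  by (simp add: meval_single)

lemma homog_const: "homog 0 (Poly_Mapping.single 0 c)"
  using homog_single[of 0 c] by simp

lemma const_hcoord: "c \<in> B \<Longrightarrow> Poly_Mapping.single 0 c \<in> hcoord (2 * n) B"
  by (intro single_hcoord[OF is_subring_B]) auto

text \<open>The generic point of the orbit closure, and the center of the Gauss valuation: all the coordinates
  \<open>u j\<close> have value at least \<open>\<gamma>\<close>, and \<open>u 0\<close> has value \<open>\<gamma>\<close>.\<close>

definition \<eta> :: "'k mpoly set" where
  "\<eta> = {f \<in> hcoord (2 * n) B. \<forall>d. ev (hcomp d f) = 0}"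

definition \<xi> :: "'k mpoly set" where
  "\<xi> = {f \<in> hcoord (2 * n) B. \<forall>d. ereal (d * \<gamma>) < g (ev (hcomp d f))}"

text \<open>Primality comes from evaluation into Laurent polynomials, which have no zero
  divisors.\<close>

lemma \<eta>_Proj: "\<eta> \<in> Proj (2 * n) B"
  unfolding \<eta>_def
proof (rule Proj_memI[OF is_subring_B, where Q = "\<lambda>_ f. ev f = 0" and a = "var 0" and e = 1])
  have "u 0 \<noteq> 0" using g_u[of 0] by auto
  then show "ev (var 0) \<noteq> 0" by (simp add: ev_var)
qed (auto simp: meval_add meval_mult homog_var var_hcoord simp del: One_nat_def)

text \<open>Primality: if two forms both attain the bound of \<open>g_ev_ge\<close>, so does their
  product, since the Gauss valuation is multiplicative.\<close>

lemma \<xi>_Proj: "\<xi> \<in> Proj (2 * n) B"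
  unfolding \<xi>_def
proof (rule Proj_memI[OF is_subring_B, where Q = "\<lambda>d f. ereal (d * \<gamma>) < g (ev f)" and a = "var 0" and e = 1])
  show "\<not> ereal (real 1 * \<gamma>) < g (ev (var 0))" by (simp add: ev_var g_u)
  fix d e :: nat and f h
  assume fh: "f \<in> hcoord (2 * n) B" "h \<in> hcoord (2 * n) B" "homog d f" "homog e h"
  have f: "ereal (d * \<gamma>) \<le> g (ev f)" and h: "ereal (e * \<gamma>) \<le> g (ev h)"
    using g_ev_ge fh by auto
  show "ereal (real (d + e) * \<gamma>) < g (ev (f * h))" if "ereal (d * \<gamma>) < g (ev f)"
    using ereal_add_strict_mono_left_finite[OF that h] by (simp add: meval_mult gauss.mult distrib_right)
  show "ereal (d * \<gamma>) < g (ev f) \<or> ereal (e * \<gamma>) < g (ev h)" if "ereal (real (d + e) * \<gamma>) < g (ev (f * h))"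
  proof (rule ccontr)
    assume "\<not> ?thesis"
    then have "g (ev f) = ereal (d * \<gamma>)" "g (ev h) = ereal (e * \<gamma>)" using f h by auto
    then show False using that by (simp add: meval_mult gauss.mult distrib_right)
  qed
qed (auto simp: meval_add homog_var var_hcoord gauss.add_gtI simp del: One_nat_def)

lemma mem_\<eta>_iff: "f \<in> hcoord (2 * n) B \<Longrightarrow> homog d f \<Longrightarrow> f \<in> \<eta> \<longleftrightarrow> ev f = 0"
  unfolding \<eta>_def by (auto simp: hcomp_homog[of d f])

lemma mem_\<xi>_iff: "f \<in> hcoord (2 * n) B \<Longrightarrow> homog d f \<Longrightarrow> f \<in> \<xi> \<longleftrightarrow> ereal (d * \<gamma>) < g (ev f)"
  unfolding \<xi>_def by (auto simp: hcomp_homog[of d f])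

lemma \<eta>_subset_\<xi>: "\<eta> \<subseteq> \<xi>"
  by (auto simp: \<eta>_def \<xi>_def)

text \<open>Coordinate 0 evaluates to the nonzero constant \<open>\<pi>\<close>, of value exactly
  \<gamma>, so its chart contains both \<open>\<eta>\<close> and \<open>\<xi>\<close>.\<close>

sublocale chart "2 * n" B \<eta> "var 0"
proof
  show "is_subring B" by (rule is_subring_B)
  show "\<eta> \<in> Proj (2 * n) B" by (rule \<eta>_Proj)
  show "var 0 \<in> hcoord (2 * n) B" "homog 1 (var 0)" by (simp_all only: var_hcoord homog_var)
  have "u 0 \<noteq> 0" using g_u[of 0] by auto
  then show "var 0 \<notin> \<eta>" using mem_\<eta>_iff[OF var_hcoord homog_var, of 0] by (simp add: ev_var)
qed

lemma \<xi>_U: "\<xi> \<in> U"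
  using \<xi>_Proj \<eta>_subset_\<xi> mem_\<xi>_iff[OF var_hcoord homog_var, of 0] by (simp add: U_def ev_var g_u)

lemma is_subring_laurent: "is_subring (laurent n :: 'k lpoly set)"
  unfolding is_subring_def
proof (intro conjI ballI)
  show "1 \<in> laurent n" by (simp add: laurent_def)
  fix f h :: "'k lpoly" assume fh: "f \<in> laurent n" "h \<in> laurent n"
  show "f - h \<in> laurent n"
    using fh keys_diff[of f h] unfolding laurent_def by blast
  have "Poly_Mapping.keys t \<subseteq> {1..n}" if t: "t \<in> Poly_Mapping.keys (f * h)" for t
  proof -
    obtain p q where "t = p + q" "p \<in> Poly_Mapping.keys f" "q \<in> Poly_Mapping.keys h"
      using keys_mult[of f h] t by blast
    then have "Poly_Mapping.keys p \<subseteq> {1..n}" "Poly_Mapping.keys q \<subseteq> {1..n}"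
        "Poly_Mapping.keys t \<subseteq> Poly_Mapping.keys p \<union> Poly_Mapping.keys q"
      using fh Poly_Mapping.keys_add[of p q] by (auto simp: laurent_def)
    then show ?thesis by blast
  qed
  then show "f * h \<in> laurent n" by (simp add: laurent_def)
qed

text \<open>The zero ideal, the generic point of the torus, maps to \<open>\<eta>\<close>, and every
  other point of the orbit contains \<open>\<eta>\<close>. Hence orbit and \<open>\<eta>\<close>
  have the same closure.\<close>

lemma orbit_closure_eq:
  assumes y: "y = (\<lambda>j. if j = 0 then \<pi> else 1)"
  shows "orbit_closure n r B y = yscheme"
proof -
  let ?P = "projective_space (2 * n) B" and ?O = "torus_orbit n r B y"
  have u: "(\<lambda>j. torus_emb r j * Poly_Mapping.single 0 (y j)) = u" by (auto simp: u_def y)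
  have O: "?O = torus_map (2 * n) B u ` Spec (sub ring_of_type_algebra (laurent n))"
    unfolding torus_orbit_def u ..
  have zero: "{0} \<in> Spec (sub ring_of_type_algebra (laurent n :: 'k lpoly set))"
    unfolding Spec_def primeideal_sub_type_algebra_iff[OF is_subring_laurent] ideal_sub_type_algebra_iff[OF is_subring_laurent]
    using is_subring_zero[OF is_subring_laurent] by auto
  have "torus_map (2 * n) B u {0} = \<eta>" by (simp add: torus_map_def \<eta>_def)
  with zero have \<eta>O: "\<eta> \<in> ?O" unfolding O by blast
  have ge: "\<eta> \<subseteq> p" if p: "p \<in> ?O" for p
  proof -
    obtain P where P: "P \<in> Spec (sub ring_of_type_algebra (laurent n))" "p = torus_map (2 * n) B u P"
      using p unfolding O by blast
    have "0 \<in> P"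
      using P(1) unfolding Spec_def primeideal_sub_type_algebra_iff[OF is_subring_laurent] ideal_sub_type_algebra_iff[OF is_subring_laurent]
      by blast
    then show ?thesis unfolding P(2) by (auto simp: torus_map_def \<eta>_def)
  qed
  have cl: "pts ?P closure_of {\<eta>} = {p \<in> Proj (2 * n) B. \<eta> \<subseteq> p}"
    using closure_of_Proj[OF \<eta>_Proj] by (simp add: projective_space_def)
  have "pts ?P closure_of ?O = {p \<in> Proj (2 * n) B. \<eta> \<subseteq> p}"
  proof (rule antisym)
    have "topspace (pts ?P) \<inter> ?O \<subseteq> pts ?P closure_of {\<eta>}"
      unfolding cl using ge topspace_Proj by (auto simp: projective_space_def)
    then show "pts ?P closure_of ?O \<subseteq> {p \<in> Proj (2 * n) B. \<eta> \<subseteq> p}"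
      unfolding cl[symmetric] by (subst closure_of_restrict) (rule closure_of_minimal, simp_all)
    show "{p \<in> Proj (2 * n) B. \<eta> \<subseteq> p} \<subseteq> pts ?P closure_of ?O"
      unfolding cl[symmetric] by (rule closure_of_mono) (use \<eta>O in blast)
  qed
  then show ?thesis by (simp add: orbit_closure_def Let_def yscheme_def)
qed

end

context orbit_setting
begin

text \<open>The embedding of the function field into the fractions of Laurent polynomials.\<close>

definition \<Phi> :: "'k mpoly fract set \<Rightarrow> 'k lpoly fract" where
  "\<Phi> z = (THE e. \<exists>d a s. hpair d a s \<and> s \<notin> \<eta> \<and> z = q a s \<and> e = Fract (ev a) (ev s))"

lemma ev_nonzero: "hpair d a s \<Longrightarrow> s \<notin> \<eta> \<Longrightarrow> ev s \<noteq> 0"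
  using mem_\<eta>_iff by blast

text \<open>Equality of two quotients is cross-multiplication modulo \<open>\<eta>\<close>, and
  \<open>\<eta>\<close> is the graded kernel of evaluation, so the image is independent of the
  representation.\<close>

lemma \<Phi>_q:
  assumes "hpair d a s" "s \<notin> \<eta>"
  shows "\<Phi> (q a s) = Fract (ev a) (ev s)"
  unfolding \<Phi>_def
proof (rule the_equality)
  show "\<exists>d' a' s'. hpair d' a' s' \<and> s' \<notin> \<eta> \<and> q a s = q a' s' \<and> Fract (ev a) (ev s) = Fract (ev a') (ev s')"
    using assms by blast
  fix e assume "\<exists>d' a' s'. hpair d' a' s' \<and> s' \<notin> \<eta> \<and> q a s = q a' s' \<and> e = Fract (ev a') (ev s')"
  then obtain d' b t where b: "hpair d' b t" "t \<notin> \<eta>" "q a s = q b t" "e = Fract (ev b) (ev t)" by blast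
  have "a * t - b * s \<in> \<eta>" using q_eq_iff[OF assms b(1,2)] b(3) by simp
  moreover have "hpair (d + d') (a * t - b * s) (s * t)" by (rule hpair_diff[OF assms(1) b(1)])
  ultimately have "ev a * ev t - ev b * ev s = 0"
    using mem_\<eta>_iff[of "a * t - b * s" "d + d'"] by (simp add: ev_diff meval_mult)
  then show "e = Fract (ev a) (ev s)"
    using ev_nonzero[OF assms] ev_nonzero[OF b(1,2)] by (simp add: b(4) eq_fract)
qed

lemma \<Phi>_add:
  assumes "y \<in> carrier ff" "z \<in> carrier ff" shows "\<Phi> (y \<oplus>\<^bsub>ff\<^esub> z) = \<Phi> y + \<Phi> z"
proof -
  obtain d a s where y: "hpair d a s" "s \<notin> \<eta>" "y = q a s" using assms(1) by (rule q_cases)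
  obtain e b t where z: "hpair e b t" "t \<notin> \<eta>" "z = q b t" using assms(2) by (rule q_cases)
  have "\<Phi> (y \<oplus>\<^bsub>ff\<^esub> z) = Fract (ev (a * t + b * s)) (ev (s * t))"
    unfolding y(3) z(3) q_add[OF y(1,2) z(1,2)]
    by (rule \<Phi>_q[OF hpair_add[OF y(1) z(1)] not_mem_mult[OF \<eta>_Proj y(1) z(1) y(2) z(2)]])
  also have "\<dots> = \<Phi> y + \<Phi> z"
    unfolding y(3) z(3) \<Phi>_q[OF y(1,2)] \<Phi>_q[OF z(1,2)]
    using ev_nonzero[OF y(1,2)] ev_nonzero[OF z(1,2)] by (simp add: meval_add meval_mult)
  finally show ?thesis .
qed

lemma \<Phi>_mult:
  assumes "y \<in> carrier ff" "z \<in> carrier ff" shows "\<Phi> (y \<otimes>\<^bsub>ff\<^esub> z) = \<Phi> y * \<Phi> z"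
proof -
  obtain d a s where y: "hpair d a s" "s \<notin> \<eta>" "y = q a s" using assms(1) by (rule q_cases)
  obtain e b t where z: "hpair e b t" "t \<notin> \<eta>" "z = q b t" using assms(2) by (rule q_cases)
  have "\<Phi> (y \<otimes>\<^bsub>ff\<^esub> z) = Fract (ev (a * b)) (ev (s * t))"
    unfolding y(3) z(3) q_mult[OF y(1,2) z(1,2)]
    by (rule \<Phi>_q[OF hpair_mult[OF y(1) z(1)] not_mem_mult[OF \<eta>_Proj y(1) z(1) y(2) z(2)]])
  also have "\<dots> = \<Phi> y * \<Phi> z"
    unfolding y(3) z(3) \<Phi>_q[OF y(1,2)] \<Phi>_q[OF z(1,2)] by (simp add: meval_mult)
  finally show ?thesis .
qed

lemma one_notin_\<eta>: "1 \<notin> \<eta>"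
  using ProjD(3)[OF is_subring_B \<eta>_Proj] .

lemma \<Phi>_one: "\<Phi> \<one>\<^bsub>ff\<^esub> = 1"
  using \<Phi>_q[OF hpair_one one_notin_\<eta>] by (simp add: q_one One_fract_def)

lemma \<Phi>_eq_0_iff:
  assumes "y \<in> carrier ff" shows "\<Phi> y = 0 \<longleftrightarrow> y = \<zero>\<^bsub>ff\<^esub>"
proof -
  obtain d a s where y: "hpair d a s" "s \<notin> \<eta>" "y = q a s" using assms by (rule q_cases)
  show ?thesis
    unfolding y(3) \<Phi>_q[OF y(1,2)] q_eq_zero_iff[OF y(1,2)]
    using ev_nonzero[OF y(1,2)] mem_\<eta>_iff[of a d] y(1) by (simp add: Zero_fract_def eq_fract)
qed

lemma \<Phi>_zero: "\<Phi> \<zero>\<^bsub>ff\<^esub> = 0"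
  using \<Phi>_eq_0_iff by simp

lemma \<Phi>_uminus: "y \<in> carrier ff \<Longrightarrow> \<Phi> (\<ominus>\<^bsub>ff\<^esub> y) = - \<Phi> y"
  using \<Phi>_add[of y "\<ominus>\<^bsub>ff\<^esub> y"] by (simp add: ff.r_neg \<Phi>_zero eq_neg_iff_add_eq_0 add.commute)

lemma \<Phi>_inv:
  assumes "y \<in> carrier ff" "y \<noteq> \<zero>\<^bsub>ff\<^esub>" shows "\<Phi> (inv\<^bsub>ff\<^esub> y) = inverse (\<Phi> y)"
proof -
  have U: "y \<in> Units ff" using assms by (simp add: ff.field_Units)
  have "\<Phi> y * \<Phi> (inv\<^bsub>ff\<^esub> y) = 1"
    using \<Phi>_mult[OF assms(1) ff.Units_inv_closed[OF U]] ff.Units_r_inv[OF U] by (simp add: \<Phi>_one)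
  then show ?thesis by (metis inverse_unique)
qed

text \<open>\<open>ring.eval\<close> expects the leading coefficient first, \<open>Poly\<close> the
  constant coefficient, hence the reversal.\<close>

lemma \<Phi>_eval:
  "set p \<subseteq> carrier ff \<Longrightarrow> y \<in> carrier ff \<Longrightarrow> \<Phi> (ring.eval ff p y) = poly (Poly (rev (map \<Phi> p))) (\<Phi> y)"
proof (induction p)
  case Nil
  then show ?case by (simp add: \<Phi>_zero)
next
  case (Cons a p)
  have pow: "\<Phi> (y [^]\<^bsub>ff\<^esub> k) = \<Phi> y ^ k" for k :: nat
    using Cons.prems(2) by (induction k) (simp_all add: \<Phi>_one \<Phi>_mult mult.commute[of "\<Phi> y"])
  have c: "a \<in> carrier ff" "y [^]\<^bsub>ff\<^esub> length p \<in> carrier ff" "ring.eval ff p y \<in> carrier ff"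
    using Cons.prems ff.eval_in_carrier[of p y] by simp_all
  have "\<Phi> (ring.eval ff (a # p) y) = \<Phi> a * \<Phi> y ^ length p + \<Phi> (ring.eval ff p y)"
    using c by (simp add: \<Phi>_add \<Phi>_mult pow)
  also have "\<Phi> (ring.eval ff p y) = poly (Poly (rev (map \<Phi> p))) (\<Phi> y)"
    using Cons by simp
  finally show ?case
    by (simp add: Poly_append poly_monom mult.commute[of "\<Phi> a"])
qed

section \<open>The local ring at the center and its integral closure\<close>

definition O\<xi> :: "'k mpoly fract set set" where
  "O\<xi> = stalk yscheme \<xi>"

definition C :: "'k mpoly fract set set" where
  "C = integral_closure_in ff O\<xi>"

text \<open>A denominator outside \<open>\<xi>\<close> attains the bound of \<open>g_ev_ge\<close>,
  which fixes its value.\<close>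

lemma O\<xi>_E:
  assumes "z \<in> O\<xi>" obtains d a s where "hpair d a s" "s \<notin> \<xi>" "s \<notin> \<eta>" "z = q a s" "g (ev s) = ereal (d * \<gamma>)"
proof -
  obtain d a s where s: "hpair d a s" "s \<notin> \<xi>" "z = q a s"
    using assms unfolding O\<xi>_def stalk_yscheme by blast
  have "ereal (d * \<gamma>) \<le> g (ev s)" using g_ev_ge[of s d] s(1) by blast
  moreover have "\<not> ereal (d * \<gamma>) < g (ev s)" using mem_\<xi>_iff[of s d] s by blast
  ultimately have "g (ev s) = ereal (d * \<gamma>)" by simp
  then show ?thesis using that s \<eta>_subset_\<xi> by blast
qed

lemma O\<xi>_I: "hpair d a s \<Longrightarrow> s \<notin> \<xi> \<Longrightarrow> q a s \<in> O\<xi>"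
  unfolding O\<xi>_def stalk_yscheme by blast

lemma O\<xi>_carrier: "O\<xi> \<subseteq> carrier ff"
proof
  fix z assume "z \<in> O\<xi>"
  then obtain d a s where s: "hpair d a s" "s \<notin> \<eta>" "z = q a s" by (rule O\<xi>_E)
  show "z \<in> carrier ff" unfolding s(3) by (rule q_closed[OF s(1,2)])
qed

lemma W_\<Phi>_q:
  assumes "hpair d a s" "s \<notin> \<eta>" shows "W (\<Phi> (q a s)) = g (ev a) - g (ev s)"
  using \<Phi>_q[OF assms] gauss.fract_val_Fract[OF ev_nonzero[OF assms]] by simp

lemma O\<xi>_nonneg: "z \<in> O\<xi> \<Longrightarrow> 0 \<le> W (\<Phi> z)"
proof -
  assume "z \<in> O\<xi>"
  then obtain d a s where s: "hpair d a s" "s \<notin> \<eta>" "z = q a s" "g (ev s) = ereal (d * \<gamma>)" by (rule O\<xi>_E)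
  have "ereal (d * \<gamma>) \<le> g (ev a)" using g_ev_ge[of a d] s(1) by blast
  then show ?thesis unfolding s(3) W_\<Phi>_q[OF s(1,2)] s(4) by (simp add: ereal_le_minus)
qed

text \<open>Value 0 forces the numerator to attain the same bound as the denominator, so it is
  outside \<open>\<xi>\<close> and the fraction may be inverted.\<close>

lemma O\<xi>_unit:
  assumes "z \<in> O\<xi>" "W (\<Phi> z) = 0"
  obtains y where "y \<in> O\<xi>" "z \<otimes>\<^bsub>ff\<^esub> y = \<one>\<^bsub>ff\<^esub>"
proof -
  obtain d a s where s: "hpair d a s" "s \<notin> \<xi>" "s \<notin> \<eta>" "z = q a s" "g (ev s) = ereal (d * \<gamma>)"
    using assms(1) by (rule O\<xi>_E)
  have "g (ev a) - ereal (d * \<gamma>) = 0" using assms(2) unfolding s(4) W_\<Phi>_q[OF s(1,3)] s(5) .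
  then have "g (ev a) = ereal (d * \<gamma>)" by (cases "g (ev a)") auto
  then have a: "a \<notin> \<xi>" using mem_\<xi>_iff[of a d] s(1) by simp
  then have a': "a \<notin> \<eta>" using \<eta>_subset_\<xi> by blast
  have "z \<in> Units ff"
    unfolding s(4) ff.field_Units using q_closed[OF s(1,3)] q_eq_zero_iff[OF s(1,3)] a' by simp
  then have "z \<otimes>\<^bsub>ff\<^esub> q s a = \<one>\<^bsub>ff\<^esub>"
    using ff.Units_r_inv[of z] q_inv[OF s(1,3) a'] s(4) by simp
  moreover have "q s a \<in> O\<xi>" by (rule O\<xi>_I[where d = d]) (use s(1) a in simp_all)
  ultimately show ?thesis using that by blast
qed

lemma is_subring_\<Phi>_image:
  assumes "D \<subseteq> carrier ff" "\<one>\<^bsub>ff\<^esub> \<in> D" "\<And>y z. y \<in> D \<Longrightarrow> z \<in> D \<Longrightarrow> y \<oplus>\<^bsub>ff\<^esub> z \<in> D"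
    "\<And>y. y \<in> D \<Longrightarrow> \<ominus>\<^bsub>ff\<^esub> y \<in> D" "\<And>y z. y \<in> D \<Longrightarrow> z \<in> D \<Longrightarrow> y \<otimes>\<^bsub>ff\<^esub> z \<in> D"
  shows "is_subring (\<Phi> ` D)"
  unfolding is_subring_def
proof (intro conjI ballI)
  show "1 \<in> \<Phi> ` D" using assms(2) \<Phi>_one by (metis imageI)
  fix x' y' assume "x' \<in> \<Phi> ` D" "y' \<in> \<Phi> ` D"
  then obtain y z where yz: "y \<in> D" "z \<in> D" "x' = \<Phi> y" "y' = \<Phi> z" by blast
  have c: "y \<in> carrier ff" "z \<in> carrier ff" using yz assms(1) by auto
  have "x' - y' = \<Phi> (y \<oplus>\<^bsub>ff\<^esub> (\<ominus>\<^bsub>ff\<^esub> z))" "x' * y' = \<Phi> (y \<otimes>\<^bsub>ff\<^esub> z)"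
    using c yz by (simp_all add: \<Phi>_add \<Phi>_uminus \<Phi>_mult)
  then show "x' - y' \<in> \<Phi> ` D" "x' * y' \<in> \<Phi> ` D" using yz assms(3-5) by simp_all
qed

lemma \<Phi>_O\<xi>_I:
  assumes "hpair d a s" "s \<notin> \<xi>" shows "Fract (ev a) (ev s) \<in> \<Phi> ` O\<xi>"
proof -
  have "s \<notin> \<eta>" using assms(2) \<eta>_subset_\<xi> by blast
  from \<Phi>_q[OF assms(1) this] show ?thesis using O\<xi>_I[OF assms] by (metis imageI)
qed

lemma \<Phi>_O\<xi>_E:
  assumes "e \<in> \<Phi> ` O\<xi>" obtains d a s where "hpair d a s" "s \<notin> \<xi>" "e = Fract (ev a) (ev s)" "ev s \<noteq> 0"
proof -
  obtain z where z: "z \<in> O\<xi>" "e = \<Phi> z" using assms by blast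
  obtain d a s where s: "hpair d a s" "s \<notin> \<xi>" "s \<notin> \<eta>" "z = q a s" using z(1) by (rule O\<xi>_E)
  show ?thesis using that[OF s(1,2) _ ev_nonzero[OF s(1,3)]] z(2) s(4) \<Phi>_q[OF s(1,3)] by simp
qed

lemma is_subring_\<Phi>_O\<xi>: "is_subring (\<Phi> ` O\<xi>)"
  unfolding is_subring_def
proof (intro conjI ballI)
  show "1 \<in> \<Phi> ` O\<xi>"
    using \<Phi>_O\<xi>_I[OF hpair_one ProjD(3)[OF is_subring_B \<xi>_Proj]] by (simp add: One_fract_def)
  fix y z assume "y \<in> \<Phi> ` O\<xi>" and zO: "z \<in> \<Phi> ` O\<xi>"
  then obtain d a s where y: "hpair d a s" "s \<notin> \<xi>" "y = Fract (ev a) (ev s)" "ev s \<noteq> 0" by (elim \<Phi>_O\<xi>_E)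
  obtain e b t where z: "hpair e b t" "t \<notin> \<xi>" "z = Fract (ev b) (ev t)" "ev t \<noteq> 0" using zO by (rule \<Phi>_O\<xi>_E)
  have st: "s * t \<notin> \<xi>" by (rule not_mem_mult[OF \<xi>_Proj y(1) z(1) y(2) z(2)])
  have "y - z = Fract (ev (a * t - b * s)) (ev (s * t))" "y * z = Fract (ev (a * b)) (ev (s * t))"
    using y z by (simp_all add: ev_diff meval_mult)
  then show "y - z \<in> \<Phi> ` O\<xi>" "y * z \<in> \<Phi> ` O\<xi>"
    using \<Phi>_O\<xi>_I[OF hpair_diff[OF y(1) z(1)] st] \<Phi>_O\<xi>_I[OF hpair_mult[OF y(1) z(1)] st] by simp_all
qed

text \<open>Integral equations are moved along the injective \<open>\<Phi>\<close> in both
  directions, between lists over the record field and type-class polynomials.\<close>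

lemma mem_C_iff: "z \<in> C \<longleftrightarrow> z \<in> carrier ff \<and> integral_over (\<Phi> ` O\<xi>) (\<Phi> z)"
proof (cases "z \<in> carrier ff")
  case z: True
  have zero: "0 \<in> \<Phi> ` O\<xi>" and one: "1 \<in> \<Phi> ` O\<xi>"
    using is_subring_zero[OF is_subring_\<Phi>_O\<xi>] is_subring_one[OF is_subring_\<Phi>_O\<xi>] by auto
  have "(\<exists>p. set p \<subseteq> O\<xi> \<and> ring.eval ff (\<one>\<^bsub>ff\<^esub> # p) z = \<zero>\<^bsub>ff\<^esub>) \<longleftrightarrow> integral_over (\<Phi> ` O\<xi>) (\<Phi> z)"
  proof
    assume "\<exists>p. set p \<subseteq> O\<xi> \<and> ring.eval ff (\<one>\<^bsub>ff\<^esub> # p) z = \<zero>\<^bsub>ff\<^esub>"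
    then obtain p where p: "set p \<subseteq> O\<xi>" "ring.eval ff (\<one>\<^bsub>ff\<^esub> # p) z = \<zero>\<^bsub>ff\<^esub>" by blast
    have pc: "set (\<one>\<^bsub>ff\<^esub> # p) \<subseteq> carrier ff" using p(1) O\<xi>_carrier by auto
    let ?l = "rev (map \<Phi> p)"
    \<comment> \<open>\<open>p\<close> omits the leading coefficient, so after reversal the 1 stands
      last, at position \<open>length p\<close>, which is the degree.\<close>
    let ?P = "Poly (?l @ [1])"
    have "poly ?P (\<Phi> z) = 0"
      using \<Phi>_eval[OF pc z] p(2) by (simp add: \<Phi>_zero \<Phi>_one)
    moreover have c: "Polynomial.coeff ?P i = nth_default 0 (?l @ [1]) i" for i
      by (simp only: coeff_Poly_eq)
    have deg: "Polynomial.degree ?P = length p"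
    proof (rule antisym[OF Polynomial.degree_le le_degree])
      show "\<forall>i>length p. Polynomial.coeff ?P i = 0" unfolding c by (simp add: nth_default_beyond)
      show "Polynomial.coeff ?P (length p) \<noteq> 0" unfolding c by (simp add: nth_default_append)
    qed
    have "Polynomial.lead_coeff ?P = 1" unfolding deg c by (simp add: nth_default_append)
    moreover have "Polynomial.coeff ?P i \<in> \<Phi> ` O\<xi>" for i
    proof -
      have "insert 0 (set (?l @ [1])) \<subseteq> \<Phi> ` O\<xi>" using p(1) zero one by auto
      moreover have "nth_default 0 (?l @ [1]) i \<in> insert 0 (set (?l @ [1]))"
        unfolding nth_default_def using nth_mem[of i "?l @ [1]"] by (simp only: insert_iff split: if_split) blast
      ultimately show ?thesis unfolding c by (rule subsetD)
    qed
    ultimately show "integral_over (\<Phi> ` O\<xi>) (\<Phi> z)" unfolding integral_over_def by blast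
  next
    assume "integral_over (\<Phi> ` O\<xi>) (\<Phi> z)"
    then obtain P where P: "Polynomial.lead_coeff P = 1" "\<And>i. Polynomial.coeff P i \<in> \<Phi> ` O\<xi>" "poly P (\<Phi> z) = 0"
      unfolding integral_over_def by blast
    \<comment> \<open>Preimages of the coefficients are chosen; only those below the degree enter
      \<open>?p\<close>, as the leading 1 is prepended separately.\<close>
    have "\<forall>i. \<exists>y. y \<in> O\<xi> \<and> \<Phi> y = Polynomial.coeff P i"
      using P(2) by (metis imageE)
    from choice[OF this] obtain f where f: "\<And>i. f i \<in> O\<xi>" "\<And>i. \<Phi> (f i) = Polynomial.coeff P i" by blast
    let ?p = "rev (map f [0..<Polynomial.degree P])"
    have pc: "set (\<one>\<^bsub>ff\<^esub> # ?p) \<subseteq> carrier ff" and po: "set ?p \<subseteq> O\<xi>" using f(1) O\<xi>_carrier by auto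
    have "P \<noteq> 0" using P(1) by auto
    then have "coeffs P = map (Polynomial.coeff P) [0..<Polynomial.degree P] @ [1]"
      using P(1) by (simp add: coeffs_def)
    also have "\<dots> = rev (map \<Phi> (\<one>\<^bsub>ff\<^esub> # ?p))" by (simp add: \<Phi>_one f(2) rev_map o_def)
    finally have "Poly (rev (map \<Phi> (\<one>\<^bsub>ff\<^esub> # ?p))) = P" by (metis Poly_coeffs)
    then have "\<Phi> (ring.eval ff (\<one>\<^bsub>ff\<^esub> # ?p) z) = 0" using \<Phi>_eval[OF pc z] P(3) by simp
    then have "ring.eval ff (\<one>\<^bsub>ff\<^esub> # ?p) z = \<zero>\<^bsub>ff\<^esub>"
      using \<Phi>_eq_0_iff ff.eval_in_carrier[OF pc z] by blast
    with po show "\<exists>p. set p \<subseteq> O\<xi> \<and> ring.eval ff (\<one>\<^bsub>ff\<^esub> # p) z = \<zero>\<^bsub>ff\<^esub>" by blast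
  qed
  then show ?thesis using z unfolding C_def integral_closure_in_def by simp
qed (simp add: C_def integral_closure_in_def)

lemma C_carrier: "C \<subseteq> carrier ff"
  by (rule subsetI) (simp add: mem_C_iff)

lemma O\<xi>_subset_C: "O\<xi> \<subseteq> C"
proof
  fix z assume z: "z \<in> O\<xi>"
  then show "z \<in> C"
    unfolding mem_C_iff using O\<xi>_carrier integral_over_mem[OF is_subring_\<Phi>_O\<xi> imageI[OF z]] by blast
qed

lemma C_nonneg: "z \<in> C \<Longrightarrow> 0 \<le> W (\<Phi> z)"
proof (rule fract.integral_over_nonneg[OF is_subring_\<Phi>_O\<xi>])
  show "0 \<le> W a" if "a \<in> \<Phi> ` O\<xi>" for a using that O\<xi>_nonneg by auto
  show "z \<in> C \<Longrightarrow> integral_over (\<Phi> ` O\<xi>) (\<Phi> z)" by (simp add: mem_C_iff)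
qed

text \<open>Closure is transported along \<open>\<Phi>\<close> from
  \<open>is_subring_integral_over\<close>, which is stated for type-class fields.\<close>

lemma
  shows C_one: "\<one>\<^bsub>ff\<^esub> \<in> C"
    and C_add: "y \<in> C \<Longrightarrow> z \<in> C \<Longrightarrow> y \<oplus>\<^bsub>ff\<^esub> z \<in> C"
    and C_uminus: "y \<in> C \<Longrightarrow> \<ominus>\<^bsub>ff\<^esub> y \<in> C"
    and C_mult: "y \<in> C \<Longrightarrow> z \<in> C \<Longrightarrow> y \<otimes>\<^bsub>ff\<^esub> z \<in> C"
proof -
  note I = is_subring_integral_over[OF is_subring_\<Phi>_O\<xi>]
  show "\<one>\<^bsub>ff\<^esub> \<in> C" using is_subring_one[OF I] by (simp add: mem_C_iff \<Phi>_one)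
  show "y \<oplus>\<^bsub>ff\<^esub> z \<in> C" if "y \<in> C" "z \<in> C"
    using is_subring_add[OF I, of "\<Phi> y" "\<Phi> z"] that by (simp add: mem_C_iff \<Phi>_add)
  show "\<ominus>\<^bsub>ff\<^esub> y \<in> C" if "y \<in> C"
    using is_subring_uminus[OF I, of "\<Phi> y"] that by (simp add: mem_C_iff \<Phi>_uminus)
  show "y \<otimes>\<^bsub>ff\<^esub> z \<in> C" if "y \<in> C" "z \<in> C"
    using is_subring_mult[OF I, of "\<Phi> y" "\<Phi> z"] that by (simp add: mem_C_iff \<Phi>_mult)
qed

lemma cring_C: "cring (sub ff C)"
  by (rule ff.cring_sub[OF C_carrier C_one C_uminus C_add C_mult])

section \<open>The point of the normalization over the center\<close>

definition \<qq> :: "'k mpoly fract set set" where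
  "\<qq> = {c \<in> C. 0 < W (\<Phi> c)}"

lemma ideal_C_iff:
  "ideal I (sub ff C) \<longleftrightarrow> I \<subseteq> C \<and> \<zero>\<^bsub>ff\<^esub> \<in> I \<and> (\<forall>x\<in>I. \<forall>y\<in>I. x \<oplus>\<^bsub>ff\<^esub> y \<in> I) \<and>
    (\<forall>x\<in>I. \<forall>a\<in>C. x \<otimes>\<^bsub>ff\<^esub> a \<in> I)"
  using cring.ideal_iff[OF cring_C, of I] by simp

lemma ideal_\<qq>: "ideal \<qq> (sub ff C)"
  unfolding ideal_C_iff
proof (intro conjI ballI)
  show "\<qq> \<subseteq> C" by (auto simp: \<qq>_def)
  have "\<one>\<^bsub>ff\<^esub> \<oplus>\<^bsub>ff\<^esub> (\<ominus>\<^bsub>ff\<^esub> \<one>\<^bsub>ff\<^esub>) \<in> C" by (intro C_add C_uminus C_one)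
  then show "\<zero>\<^bsub>ff\<^esub> \<in> \<qq>" by (simp add: \<qq>_def ff.r_neg \<Phi>_zero)
  fix y assume y: "y \<in> \<qq>"
  then have yc: "y \<in> C" "y \<in> carrier ff" "0 < W (\<Phi> y)" using C_carrier by (auto simp: \<qq>_def)
  show "y \<oplus>\<^bsub>ff\<^esub> z \<in> \<qq>" if "z \<in> \<qq>" for z
  proof -
    have zc: "z \<in> C" "z \<in> carrier ff" "0 < W (\<Phi> z)" using that C_carrier by (auto simp: \<qq>_def)
    then show ?thesis
      using yc fract.add_gtI[OF yc(3) zc(3)] C_add[OF yc(1) zc(1)] by (simp add: \<qq>_def \<Phi>_add)
  qed
  show "y \<otimes>\<^bsub>ff\<^esub> z \<in> \<qq>" if "z \<in> C" for z
  proof -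
    have zc: "z \<in> carrier ff" "0 \<le> W (\<Phi> z)" using that C_carrier C_nonneg by auto
    then show ?thesis
      using yc C_mult[OF yc(1) that] add_pos_nonneg[OF yc(3) zc(2)] by (simp add: \<qq>_def \<Phi>_mult fract.mult)
  qed
qed

text \<open>A strictly larger ideal J contains some c of value 0. By \<open>unit_coefficient\<close>
  an integral equation of c yields a of value 0 in the local ring that is congruent modulo
  \<open>\<qq>\<close> to a multiple of c. So a lies in J, and a is invertible by
  \<open>O\<xi>_unit\<close>.\<close>

lemma maximalideal_\<qq>: "maximalideal \<qq> (sub ff C)"
proof (rule maximalidealI[OF ideal_\<qq>])
  have "\<one>\<^bsub>ff\<^esub> \<notin> \<qq>" by (simp add: \<qq>_def \<Phi>_one)
  then show "carrier (sub ff C) \<noteq> \<qq>" using C_one by auto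
  fix J assume J: "ideal J (sub ff C)" "\<qq> \<subseteq> J" "J \<subseteq> carrier (sub ff C)"
  note JI = J(1)[unfolded ideal_C_iff]
  show "J = \<qq> \<or> J = carrier (sub ff C)"
  proof (cases "J \<subseteq> \<qq>")
    case True
    then show ?thesis using J(2) by blast
  next
    case False
    then obtain c where c: "c \<in> J" "c \<notin> \<qq>" by blast
    then have cC: "c \<in> C" using JI by blast
    then have wc: "W (\<Phi> c) = 0" using c(2) C_nonneg[OF cC] by (auto simp: \<qq>_def)
    have cc: "c \<in> carrier ff" using cC C_carrier by blast
    obtain P where P: "Polynomial.lead_coeff P = 1" "\<And>i. Polynomial.coeff P i \<in> \<Phi> ` O\<xi>" "poly P (\<Phi> c) = 0"
      using cC unfolding mem_C_iff integral_over_def by blast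
    have CE: "is_subring (\<Phi> ` C)" by (rule is_subring_\<Phi>_image[OF C_carrier C_one C_add C_uminus C_mult])
    have "\<exists>a\<in>\<Phi> ` O\<xi>. \<exists>b\<in>\<Phi> ` C. W a = 0 \<and> 0 < W (a + \<Phi> c * b)"
    proof (rule fract.unit_coefficient[OF CE _ _ _ wc P(2)])
      show "\<Phi> ` O\<xi> \<subseteq> \<Phi> ` C" using O\<xi>_subset_C by blast
      show "\<Phi> c \<in> \<Phi> ` C" using cC by blast
      show "0 \<le> W a" if "a \<in> \<Phi> ` O\<xi>" for a using that O\<xi>_nonneg by blast
      show "W (Polynomial.lead_coeff P) = 0" unfolding P(1) by simp
      show "0 < W (poly P (\<Phi> c))" unfolding P(3) by simp
    qed
    then obtain a b where ab: "a \<in> O\<xi>" "b \<in> C" "W (\<Phi> a) = 0" "0 < W (\<Phi> a + \<Phi> c * \<Phi> b)" by blast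
    have bc: "a \<in> C" "a \<in> carrier ff" "b \<in> carrier ff" using ab O\<xi>_subset_C C_carrier by blast+
    have cb: "c \<otimes>\<^bsub>ff\<^esub> b \<in> J" "c \<otimes>\<^bsub>ff\<^esub> b \<in> C" using JI c(1) ab(2) by blast+
    let ?m = "a \<oplus>\<^bsub>ff\<^esub> c \<otimes>\<^bsub>ff\<^esub> b"
    have "?m \<in> \<qq>" using ab(4) bc cc C_add[OF bc(1) cb(2)] by (simp add: \<qq>_def \<Phi>_add \<Phi>_mult)
    then have mJ: "?m \<in> J" using J(2) by blast
    \<comment> \<open>The ideal criterion speaks of sums and multiples only, so subtraction is
      expressed by the factor minus one.\<close>
    have "(c \<otimes>\<^bsub>ff\<^esub> b) \<otimes>\<^bsub>ff\<^esub> (\<ominus>\<^bsub>ff\<^esub> \<one>\<^bsub>ff\<^esub>) \<in> J" using JI cb(1) C_uminus[OF C_one] by blast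
    then have "?m \<oplus>\<^bsub>ff\<^esub> (c \<otimes>\<^bsub>ff\<^esub> b) \<otimes>\<^bsub>ff\<^esub> (\<ominus>\<^bsub>ff\<^esub> \<one>\<^bsub>ff\<^esub>) \<in> J" using JI mJ by blast
    also have "?m \<oplus>\<^bsub>ff\<^esub> (c \<otimes>\<^bsub>ff\<^esub> b) \<otimes>\<^bsub>ff\<^esub> (\<ominus>\<^bsub>ff\<^esub> \<one>\<^bsub>ff\<^esub>) = a"
      using bc cc by (simp add: ff.r_minus ff.a_assoc ff.r_neg)
    finally have aJ: "a \<in> J" .
    obtain y where y: "y \<in> O\<xi>" "a \<otimes>\<^bsub>ff\<^esub> y = \<one>\<^bsub>ff\<^esub>" using O\<xi>_unit[OF ab(1,3)] .
    have "a \<otimes>\<^bsub>ff\<^esub> y \<in> J" using JI aJ subsetD[OF O\<xi>_subset_C y(1)] by blast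
    then have one: "\<one>\<^bsub>ff\<^esub> \<in> J" by (simp only: y(2))
    have "J = carrier (sub ff C)"
      using ideal.one_imp_carrier[OF J(1)] one by simp
    then show ?thesis ..
  qed
qed

text \<open>Denominators outside \<open>\<qq>\<close> have value exactly 0, so division by them
  keeps values nonnegative.\<close>

lemma loc_C_nonneg:
  assumes "z \<in> loc ff C \<qq>" shows "z \<in> carrier ff" "0 \<le> W (\<Phi> z)"
proof -
  obtain a s where as: "a \<in> C" "s \<in> C" "s \<notin> \<qq>" "z = a \<otimes>\<^bsub>ff\<^esub> inv\<^bsub>ff\<^esub> s"
    using assms unfolding loc_def by blast
  have c: "a \<in> carrier ff" "s \<in> carrier ff" using as C_carrier by auto
  have ws: "W (\<Phi> s) = 0" using as(2,3) C_nonneg[OF as(2)] by (auto simp: \<qq>_def)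
  then have s0: "s \<noteq> \<zero>\<^bsub>ff\<^esub>" by (auto simp: \<Phi>_zero)
  then have "inv\<^bsub>ff\<^esub> s \<in> carrier ff" using c ff.field_Units by simp
  then show "z \<in> carrier ff" "0 \<le> W (\<Phi> z)"
    using c C_nonneg[OF as(1)] fract.inverse[of "\<Phi> s" 0] ws
    by (simp_all add: as(4) \<Phi>_mult \<Phi>_inv[OF c(2) s0] fract.mult zero_ereal_def)
qed

lemma C_subset_loc: "C \<subseteq> loc ff C \<qq>"
proof
  fix c assume c: "c \<in> C"
  then have "c \<otimes>\<^bsub>ff\<^esub> inv\<^bsub>ff\<^esub> \<one>\<^bsub>ff\<^esub> = c" using C_carrier by auto
  moreover have "\<one>\<^bsub>ff\<^esub> \<notin> \<qq>" by (simp add: \<qq>_def \<Phi>_one)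
  ultimately show "c \<in> loc ff C \<qq>" unfolding loc_def using c C_one by force
qed

lemma normalization_simps:
  "ffield (normalization yscheme) = ff"
  "scal (normalization yscheme) = scal yscheme"
  "stalk (normalization yscheme) (\<xi>, \<qq>) = loc ff C \<qq>"
  by (simp_all add: normalization_def yscheme_simps C_def O\<xi>_def)

text \<open>The point lies in the generating open set given by the chart \<open>U\<close> and the
  function 1.\<close>

lemma point_in_normalization: "(\<xi>, \<qq>) \<in> topspace (pts (normalization yscheme))"
proof -
  have "\<xi> \<in> topspace (pts yscheme)" using \<xi>_Proj \<eta>_subset_\<xi> by (simp add: topspace_yscheme)
  then have mem: "(\<xi>, \<qq>) \<in> normalization_points yscheme"
    using maximalideal_\<qq> by (simp add: normalization_points_def yscheme_simps C_def O\<xi>_def)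
  have "\<one>\<^bsub>ff\<^esub> \<in> integral_closure_in ff A"
    unfolding integral_closure_in_def
    by (intro CollectI conjI exI[of _ "[\<ominus>\<^bsub>ff\<^esub> \<one>\<^bsub>ff\<^esub>]"]) (auto simp: A_uminus A_one ff.r_neg)
  then have one: "\<one>\<^bsub>ff\<^esub> \<in> integral_closure_in (ffield yscheme) (sections yscheme U)"
    by (simp add: sections_U yscheme_simps)
  have "\<one>\<^bsub>ff\<^esub> \<notin> \<qq>" by (simp add: \<qq>_def \<Phi>_one)
  then have "(\<xi>, \<qq>) \<in> {(x, q) \<in> normalization_points yscheme. x \<in> U \<and> \<one>\<^bsub>ff\<^esub> \<notin> q}"
    using mem \<xi>_U by simp
  then show ?thesis
    unfolding normalization_def ischeme.simps topology_generated_by_topspace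
    using affine_open_U one by blast
qed

end

section \<open>Failure of finite generation\<close>

context orbit_setting
begin

text \<open>The element is \<open>z\<^sub>1 / c\<close> with \<open>v c = s\<close>: its r-th power is \<open>\<pi> / c^r\<close>, an element of B, times
  the quotient of the homogeneous coordinates 1 and 0, which is regular at \<open>\<xi>\<close>.\<close>

lemma exists_small_value:
  assumes s: "s \<in> value_group v" "0 \<le> s" "s < \<gamma> / r"
  obtains e where "e \<in> C" "W (\<Phi> e) = ereal (\<gamma> / r - s)"
proof -
  obtain c where c: "c \<noteq> 0" "v c = ereal s" using s(1) by (auto simp: value_group_def)
  have cB: "c \<in> B" using c(2) s(2) by (simp add: val_ring_def)
  have n1: "1 \<le> 2 * n" "2 \<le> 2 * n" using n by auto
  let ?d = "Poly_Mapping.single 0 c * var 1"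
  let ?c = "Poly_Mapping.single 0 c :: 'k lpoly"
  have hd: "?d \<in> hcoord (2 * n) B" "homog 1 ?d"
    using is_subring_mult[OF is_subring_coords const_hcoord[OF cB] var_hcoord[OF n1(1)]] homog_mult[OF homog_const homog_var, of c 1] by simp_all
  have hp: "hpair 1 (var 2) ?d" using hd var_hcoord[OF n1(2)] homog_var[of 2] by simp
  have u1: "u 1 = zvar 1 ^ r" and u2: "u 2 = zvar 1 ^ (r + 1)"
    by (simp_all add: u_def torus_emb_def)
  have evd: "ev ?d = ?c * u 1" by (simp only: meval_mult ev_const ev_var)
  have gd: "g (ev ?d) = ereal (s + \<gamma>)" unfolding evd by (simp add: gauss.mult gauss_single c(2) g_u)
  have d\<eta>: "?d \<notin> \<eta>" using mem_\<eta>_iff[OF hd] gd by auto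
  \<comment> \<open>Evaluates to z_1^(r + 1) / (c * z_1^r), that is, z_1 / c.\<close>
  define e where "e = q (var 2) ?d"
  have ec: "e \<in> carrier ff" unfolding e_def by (rule q_closed[OF hp d\<eta>])
  have \<Phi>e: "\<Phi> e = Fract (u 2) (?c * u 1)"
    unfolding e_def \<Phi>_q[OF hp d\<eta>] by (simp only: evd ev_var)
  have We: "W (\<Phi> e) = ereal (\<gamma> / r - s)"
    unfolding e_def W_\<Phi>_q[OF hp d\<eta>] gd ev_var by (simp add: g_u)
  define b where "b = \<pi> / c ^ r"
  have bc: "b * c ^ r = \<pi>" using c(1) by (simp add: b_def)
  have bB: "b \<in> B"
  proof -
    have "v b + v (c ^ r) = v \<pi>" using bc v.mult by metis
    then have "v b = ereal (\<gamma> - r * s)"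
      using v.power[OF c(2), of r] \<pi> by (cases "v b") auto
    \<comment> \<open>The bound s < \<gamma> / r enters here: it keeps the coefficient b in the
      valuation ring.\<close>
    moreover have "0 \<le> \<gamma> - r * s" using s(3) r by (simp add: field_simps)
    ultimately show ?thesis by (simp add: val_ring_def)
  qed
  let ?b = "Poly_Mapping.single 0 b * var 1"
  have hb: "?b \<in> hcoord (2 * n) B" "homog 1 ?b"
    using is_subring_mult[OF is_subring_coords const_hcoord[OF bB] var_hcoord[OF n1(1)]] homog_mult[OF homog_const homog_var, of b 1] by simp_all
  have hp0: "hpair 1 ?b (var 0)" using hb var_hcoord[of 0] homog_var[of 0] by simp
  have "var 0 \<notin> \<xi>" using \<xi>_U by (simp add: U_def)
  from \<Phi>_O\<xi>_I[OF hp0 this]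
  have mem: "Fract (Poly_Mapping.single 0 b * u 1) (u 0) \<in> \<Phi> ` O\<xi>"
    by (simp only: meval_mult ev_const ev_var)
  have u0: "u 0 = Poly_Mapping.single 0 \<pi>" by (simp add: u_def torus_emb_def)
  have cpow: "?c ^ k = Poly_Mapping.single 0 (c ^ k)" for k
    by (induction k) (simp_all add: mult_single)
  have z0: "zvar 1 \<noteq> (0 :: 'k lpoly)" and c0: "?c \<noteq> 0" and p0: "Poly_Mapping.single 0 \<pi> \<noteq> (0 :: 'k lpoly)"
    using g_zvar[of 1] gauss_single[of 0 c] c(2) gauss_single[of 0 \<pi>] \<pi> by auto
  have fr: "Fract a d ^ k = Fract (a ^ k) (d ^ k)" for a d :: "'k lpoly" and k
    by (induction k) (simp_all add: One_fract_def)
  have \<Phi>e': "\<Phi> e = Fract (zvar 1) ?c"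
    unfolding \<Phi>e u1 u2 using z0 c0 by (simp add: eq_fract)
  \<comment> \<open>Both sides are z_1^r / c^r, since \<open>\<pi>\<close> in coordinate 0 equals b
    * c^r.\<close>
  have "\<Phi> e ^ r = Fract (Poly_Mapping.single 0 b * u 1) (u 0)"
  proof -
    have p: "Poly_Mapping.single 0 \<pi> = Poly_Mapping.single 0 b * ?c ^ r"
      unfolding cpow mult_single bc[symmetric] by simp
    then have "Poly_Mapping.single 0 b * ?c ^ r \<noteq> 0" using p0 by simp
    then show ?thesis
      unfolding \<Phi>e' fr u0 u1 p using c0 by (simp add: eq_fract)
  qed
  then have "\<Phi> e ^ r \<in> \<Phi> ` O\<xi>" using mem by simp
  then have "e \<in> C" unfolding mem_C_iff using ec integral_over_root[OF is_subring_\<Phi>_O\<xi> _ r] by blast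
  with We that show ?thesis by blast
qed

theorem not_finite_type_normalization:
  assumes nd: "\<not> discrete (value_group v)" and \<gamma>r: "\<gamma> \<notin> (\<lambda>t. real r * t) ` value_group v"
  shows "\<not> finite_type B (normalization yscheme)"
proof
  let ?N = "normalization yscheme"
  have \<omega>: "\<gamma> / r \<notin> value_group v"
  proof
    assume "\<gamma> / r \<in> value_group v"
    then have "real r * (\<gamma> / r) \<in> (\<lambda>t. real r * t) ` value_group v" by (rule imageI)
    then show False using \<gamma>r r by simp
  qed
  assume "finite_type B ?N"
  then obtain V G where V: "affine_open ?N V" "(\<xi>, \<qq>) \<in> V" and G: "finite G" "G \<subseteq> sections ?N V"
    and gen: "sections ?N V = generate_ring ff (scal ?N ` B \<union> G)"
    using point_in_normalization unfolding finite_type_def normalization_simps by (metis UnionE)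
  let ?A = "sections ?N V"
  have A_loc: "?A \<subseteq> loc ff C \<qq>"
    using V(2) unfolding sections_def normalization_simps(3)[symmetric] by blast
  \<comment> \<open>Affineness of \<open>V\<close> presents the local ring as a localization of the
    sections, so what is shown for the generators can be carried to all of it.\<close>
  have loc_A: "loc ff C \<qq> = loc ff ?A (point_ideal ?N ?A (\<xi>, \<qq>))"
    using V unfolding affine_open_def Let_def normalization_simps(1) normalization_simps(3)[symmetric] by blast
  have approx: "\<exists>a\<in>aligned_fracts. 0 \<le> W a \<and> 0 < W (x - a)" if x: "x \<in> \<Phi> ` G" for x
  proof -
    obtain z where "z \<in> G" "x = \<Phi> z" using x by blast
    then have "0 \<le> W x" using loc_C_nonneg(2) A_loc G(2) by blast
    then show ?thesis by (rule aligned_approx)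
  qed
  obtain \<epsilon> where \<epsilon>: "0 < \<epsilon>" "\<Phi> ` G \<subseteq> fract.near aligned_fracts \<epsilon>"
    using fract.near_finite[OF finite_imageI[OF G(1)] approx] by metis
  let ?R = "fract.near aligned_fracts \<epsilon>"
  have R: "is_subring ?R" by (rule fract.is_subring_near[OF is_subfield_aligned_fracts \<epsilon>(1)])
  \<comment> \<open>Constants have exponent 0 of weight 0, so scalars are aligned and approximate
    themselves.\<close>
  have scalR: "scal ?N c \<in> carrier ff \<and> \<Phi> (scal ?N c) \<in> ?R" if c: "c \<in> B" for c
  proof -
    have hp: "hpair 0 (Poly_Mapping.single 0 c) 1"
      using const_hcoord[OF c] homog_const[of c] hpair_one by simp
    have "\<Phi> (scal ?N c) = Fract (Poly_Mapping.single 0 c) 1"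
      unfolding normalization_simps yscheme_simps \<Phi>_q[OF hp one_notin_\<eta>] by (simp add: ev_const)
    moreover have "(Poly_Mapping.single 0 c :: 'k lpoly) \<in> aligned" "(1 :: 'k lpoly) \<in> aligned"
      using base.value_group_zero by (auto simp: aligned_def)
    then have "Fract (Poly_Mapping.single 0 c) 1 \<in> aligned_fracts" by (rule aligned_fractsI) simp
    moreover have "0 \<le> W (Fract (Poly_Mapping.single 0 c) 1)"
      using c by (simp add: gauss.fract_val_Fract gauss_single val_ring_def)
    moreover have "scal ?N c \<in> carrier ff"
      unfolding normalization_simps yscheme_simps by (rule q_closed[OF hp one_notin_\<eta>])
    ultimately show ?thesis by (auto simp: fract.near_def intro!: bexI[of _ "Fract (Poly_Mapping.single 0 c) 1"])
  qed
  have AR: "z \<in> carrier ff \<and> \<Phi> z \<in> ?R" if "z \<in> ?A" for z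
    using that unfolding gen
  proof (induction rule: generate_ring.induct)
    case one
    then show ?case using is_subring_one[OF R] by (simp add: \<Phi>_one)
  next
    case (incl h)
    then show ?case using scalR \<epsilon>(2) A_loc G(2) loc_C_nonneg(1) by blast
  next
    case (a_inv h)
    then show ?case using is_subring_uminus[OF R] by (simp add: \<Phi>_uminus)
  next
    case (eng_add h1 h2)
    then show ?case using is_subring_add[OF R] by (simp add: \<Phi>_add)
  next
    case (eng_mult h1 h2)
    then show ?case using is_subring_mult[OF R] by (simp add: \<Phi>_mult)
  qed
  \<comment> \<open>\<open>s\<close> is chosen after \<epsilon>, that is, after the supposed
    generators.\<close>
  obtain s where s: "s \<in> value_group v" "0 \<le> s" "s < \<gamma> / r" "\<gamma> / r - s < \<epsilon>"
    using dense_subgroup[OF base.value_group_diff nd _ \<omega> \<epsilon>(1)] \<gamma> r by auto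
  obtain e where e: "e \<in> C" "W (\<Phi> e) = ereal (\<gamma> / r - s)" using exists_small_value[OF s(1-3)] .
  have "e \<in> loc ff ?A (point_ideal ?N ?A (\<xi>, \<qq>))" using C_subset_loc e(1) loc_A by blast
  then obtain a t where at: "a \<in> ?A" "t \<in> ?A" "t \<notin> point_ideal ?N ?A (\<xi>, \<qq>)" "e = a \<otimes>\<^bsub>ff\<^esub> inv\<^bsub>ff\<^esub> t"
    unfolding loc_def by blast
  have tl: "t \<in> loc ff C \<qq>" using at(2) A_loc by blast
  \<comment> \<open>The denominator is a unit of the local ring; it and its inverse have nonnegative
    values with sum 0, so both values are 0 and \<open>near_inverse\<close> applies.\<close>
  then have "t \<in> Units (sub ff (loc ff C \<qq>))"
    using at(2,3) unfolding point_ideal_def nonunits_def normalization_simps by blast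
  then obtain t' where t': "t' \<in> loc ff C \<qq>" "t \<otimes>\<^bsub>ff\<^esub> t' = \<one>\<^bsub>ff\<^esub>"
    unfolding Units_def by auto
  have tc: "t \<in> carrier ff" "t' \<in> carrier ff" and tw: "0 \<le> W (\<Phi> t)" "0 \<le> W (\<Phi> t')"
    using loc_C_nonneg tl t'(1) by blast+
  have "W (\<Phi> t) + W (\<Phi> t') = 0"
    using \<Phi>_mult[OF tc] t'(2) fract.mult[of "\<Phi> t" "\<Phi> t'"] by (simp add: \<Phi>_one)
  then have wt: "W (\<Phi> t) = 0" using tw by (cases "W (\<Phi> t)"; cases "W (\<Phi> t')") auto
  then have t0: "t \<noteq> \<zero>\<^bsub>ff\<^esub>" by (auto simp: \<Phi>_zero)
  then have "inv\<^bsub>ff\<^esub> t \<in> carrier ff" using tc ff.field_Units by simp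
  then have "\<Phi> e = \<Phi> a * inverse (\<Phi> t)"
    using AR[OF at(1)] by (simp add: at(4) \<Phi>_mult \<Phi>_inv[OF tc(1) t0])
  moreover have "inverse (\<Phi> t) \<in> ?R"
    using AR[OF at(2)] by (intro fract.near_inverse[OF is_subfield_aligned_fracts \<epsilon>(1) _ wt]) simp
  ultimately have "\<Phi> e \<in> ?R" using AR[OF at(1)] is_subring_mult[OF R] by simp
  \<comment> \<open>The value \<gamma> / r - s is below \<epsilon>, so an aligned fraction has it
    too and it lies in the value group; adding s would put \<gamma> / r there.\<close>
  then obtain l where l: "l \<in> aligned_fracts" "W (\<Phi> e) = W l"
    by (rule fract.near_small_value) (use e(2) s(4) in simp_all)
  then have "l \<noteq> 0" using e(2) by auto
  then obtain c where "c \<in> value_group v" "W l = ereal c" using fract_val_aligned[OF l(1)] by blast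
  then have "\<gamma> / r - s \<in> value_group v" using l(2) e(2) by simp
  then have "\<gamma> / r \<in> value_group v" using base.value_group_add[OF _ s(1)] by fastforce
  with \<omega> show False ..
qed

end

theorem theorem5p5:
  fixes v :: "'k::field \<Rightarrow> ereal" and r n :: nat and \<gamma> :: real and \<pi> :: 'k and y :: "nat \<Rightarrow> 'k"
  assumes "nontrivial_valuation v"
    and "\<not> discrete (value_group v)"
    and "\<not> divisible (value_group v)"
    and "0 < r"
    and "(\<lambda>t. real r * t) ` value_group v \<noteq> value_group v"
    and "\<gamma> \<in> value_group v - (\<lambda>t. real r * t) ` value_group v"
    and "0 < \<gamma>"
    and "\<pi> \<in> val_ring v"
    and "v \<pi> = ereal \<gamma>"
    and "0 < n"
    and "y = (\<lambda>j. if j = 0 then \<pi> else 1)"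
  shows "\<not> finite_type (val_ring v) (normalization (orbit_closure n r (val_ring v) y))"
proof -
  interpret orbit_setting v r n \<gamma> \<pi>
    using assms by unfold_locales (auto simp: nontrivial_valuation_def)
  show ?thesis
    using not_finite_type_normalization assms by (simp add: orbit_closure_eq)
qed

end
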